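(* Let $m$ be an integer with $m>2$. Suppose that $f_1,\dots,f_{m+1}$ are pairwise relatively shifting prime entire functions of order less than $1$, that $f_1,\dots,f_m$ are linearly independent over the field of periodic functions with period one, and that $$f_1+f_2+\cdots+f_m=f_{m+1}.$$ Put $\delta=\max_{1\le j\le m+1}\rho(f_j)$, where $\rho$ denotes the order of growth. Then there exists $R>0$ such that for any $\varepsilon>0$ $$\widetilde{T}_{f_1,\dots,f_{m+1}}(r)\le (m-1)\overline{N}_\Delta\Big(r,\frac{1}{f_1\cdots f_{m+1}}\Big)-\frac{m(m-1)}{2}(1-\delta-\varepsilon)\log r=(m-1)\sum_{j=1}^{m+1}\overline{N}_\Delta\Big(r,\frac1{f_j}\Big)-\frac{m(m-1)}{2}(1-\delta-\varepsilon)\log r$$ holds for all $r>R$ outside an exceptional set of $r$ of finite logarithmic measure.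
   Context: Notation. $\Delta f(z)=f(z+1)-f(z)$, $\Delta^0f=f$, $\Delta^n f=\Delta(\Delta^{n-1}f)$; $z^{\underline{0}}=1$, $z^{\underline{n}}=z(z-1)\cdots(z-n+1)$ for $n\ge1$. A set $E\subset[1,\infty)$ has finite logarithmic measure if $\int_E dr/r<\infty$. The field of periodic functions with period one is the field of meromorphic functions $\pi$ on $\mathbb{C}$ with $\pi(z+1)=\pi(z)$. Length of zeros. For an entire function $f$, a point $z_0$ is a zero of $f$ with length $n\ge 1$ if $\Delta^k f(z_0)=0$ for all $0\le k<n$ and $\Delta^n f(z_0)\ne0$. Relatively shifting prime. Let $f,g$ be entire, let $z_1$ be a zero of $f$ with length $m'$ and $z_2$ a zero of $g$ with length $n'$. For $1\le m_1\le m'$ and $1\le n_1\le n'$ there are entire $F,G$ with $f(z)=(z-z_1)^{\underline{m_1}}F(z)$ and $g(z)=(z-z_2)^{\underline{n_1}}G(z)$. If for some such $m_1,n_1$ one has $f(z)g(z)=(z-z_0)^{\underline{m_1+n_1}}F(z)G(z)$ with $z_0\in\{z_1,z_2\}$, then $z-z_0$ is called a common shifting divisor of $f$ and $g$. If $f$ and $g$ have no common shifting divisor (for any choice of $z_1,z_2$), they are called relatively shifting prime. (Common zeros are thus not excluded in general.) Counting functions. For a meromorphic $f\not\equiv0$ let $\mathrm{ord}_w(f)$ be the multiplicity of $w$ as a zero of $f$ ($0$ if $w$ is not a zero). Set $$\overline{n}_\Delta\Big(r,\frac1f\Big)=\sum_{|w|\le r}\Big(\mathrm{ord}_w(f)-\min\{\mathrm{ord}_w(f),\mathrm{Ord}_{w-1}(f)\}\Big),$$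 where $\mathrm{Ord}_{w-1}(f)=\mathrm{ord}_{w-1}(f)$ if $|w-1|\le r$ and $\mathrm{Ord}_{w-1}(f)=0$ otherwise, and $$\overline{N}_\Delta\Big(r,\frac1f\Big)=\int_0^r\frac{\overline{n}_\Delta(t,1/f)-\overline{n}_\Delta(0,1/f)}{t}\,dt+\overline{n}_\Delta\Big(0,\frac1f\Big)\log r.$$ Characteristic. For entire functions $a_1,\dots,a_n$ (common zeros allowed), with $u(z)=\max_{1\le j\le n}|a_j(z)|$, $$\widetilde{T}_{a_1,\dots,a_n}(r)=\frac1{2\pi}\int_0^{2\pi}\log u(re^{i\theta})\,d\theta-\log u(0)$$ if $u(0)\ne0$; if $u(0)=0$, the term $\log u(0)$ is replaced by $\max_{j}\log|c_{\lambda_j}|$, where $c_{\lambda_j}z^{\lambda_j}$, $c_{\lambda_j}\neq 0$, is the leading term of the expansion of $a_j$ at $0$. *)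

theory Defs
  imports "HOL-Complex_Analysis.Complex_Analysis"
begin

definition fdiff :: "(complex \<Rightarrow> complex) \<Rightarrow> complex \<Rightarrow> complex" where
  "fdiff f z = f (z + 1) - f z"

definition falling_fact :: "complex \<Rightarrow> nat \<Rightarrow> complex" where
  "falling_fact z n = (\<Prod>i<n. z - of_nat i)"

definition entire :: "(complex \<Rightarrow> complex) \<Rightarrow> bool" where
  "entire f \<longleftrightarrow> f holomorphic_on UNIV"

definition max_modulus :: "(complex \<Rightarrow> complex) \<Rightarrow> real \<Rightarrow> real" where
  "max_modulus f r = (SUP z\<in>sphere 0 r. cmod (f z))"

definition log_plus :: "real \<Rightarrow> real" where
  "log_plus x = ln (max 1 x)"

text \<open>
  The order of growth of an entire function,
  $\limsup_{r\to\infty} \log^+ \log^+ M(r, f) / \log r$.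
\<close>

definition growth_order :: "(complex \<Rightarrow> complex) \<Rightarrow> ereal" where
  "growth_order f = Limsup at_top (\<lambda>r. ereal (log_plus (log_plus (max_modulus f r)) / ln r))"

text \<open>
  A meromorphic function on the plane is represented by its canonical version, which is
  continuous outside its poles and takes the value 0 at the poles, so that equality in the field
  of meromorphic functions is equality of functions. A linear combination need not be canonical
  at the poles of its coefficients; it is the zero function of the field if and only if it
  vanishes off a set without accumulation points.
\<close>

definition periodic_meromorphic :: "(complex \<Rightarrow> complex) \<Rightarrow> bool" where
  "periodic_meromorphic p \<longleftrightarrow> p nicely_meromorphic_on UNIV \<and> (\<forall>z. p (z + 1) = p z)"

definition lin_indep_over_periodic :: "'i set \<Rightarrow> ('i \<Rightarrow> complex \<Rightarrow> complex) \<Rightarrow> bool" where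
  "lin_indep_over_periodic I f \<longleftrightarrow>
     (\<forall>p. (\<forall>i\<in>I. periodic_meromorphic (p i)) \<and>
          (\<forall>\<^sub>\<approx>z\<in>UNIV. (\<Sum>i\<in>I. p i z * f i z) = 0)
        \<longrightarrow> (\<forall>i\<in>I. \<forall>z. p i z = 0))"

definition zero_of_length :: "(complex \<Rightarrow> complex) \<Rightarrow> complex \<Rightarrow> nat \<Rightarrow> bool" where
  "zero_of_length f z0 n \<longleftrightarrow>
     1 \<le> n \<and> (\<forall>k<n. (fdiff ^^ k) f z0 = 0) \<and> (fdiff ^^ n) f z0 \<noteq> 0"

text \<open>The linear polynomial $z - z_0$ is a common shifting divisor of \<open>f\<close> and \<open>g\<close>.\<close>

definition common_shifting_divisor ::
    "(complex \<Rightarrow> complex) \<Rightarrow> (complex \<Rightarrow> complex) \<Rightarrow> complex \<Rightarrow> bool" where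
  "common_shifting_divisor f g z0 \<longleftrightarrow>
     (\<exists>z1 z2 m' n' m1 n1 F G.
        zero_of_length f z1 m' \<and> zero_of_length g z2 n' \<and>
        1 \<le> m1 \<and> m1 \<le> m' \<and> 1 \<le> n1 \<and> n1 \<le> n' \<and>
        entire F \<and> entire G \<and>
        (\<forall>z. f z = falling_fact (z - z1) m1 * F z) \<and>
        (\<forall>z. g z = falling_fact (z - z2) n1 * G z) \<and>
        (z0 = z1 \<or> z0 = z2) \<and>
        (\<forall>z. f z * g z = falling_fact (z - z0) (m1 + n1) * F z * G z))"

definition rel_shifting_prime :: "(complex \<Rightarrow> complex) \<Rightarrow> (complex \<Rightarrow> complex) \<Rightarrow> bool" where
  "rel_shifting_prime f g \<longleftrightarrow> \<not> (\<exists>z0. common_shifting_divisor f g z0)"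

text \<open>Poles have negative \<^const>\<open>zorder\<close>, which is truncated to 0.\<close>

definition zero_mult :: "(complex \<Rightarrow> complex) \<Rightarrow> complex \<Rightarrow> nat" where
  "zero_mult f w = nat (zorder f w)"

text \<open>
  The functions $\overline{n}_\Delta(r, 1/f)$ and $\overline{N}_\Delta(r, 1/f)$ for a meromorphic
  \<open>f\<close> that is not identically zero. The sum over the disc is restricted to the zeros of \<open>f\<close>,
  where alone the summand can be nonzero, to make the index set finite.
\<close>

definition nbar_diff :: "real \<Rightarrow> (complex \<Rightarrow> complex) \<Rightarrow> nat" where
  "nbar_diff r f =
     (\<Sum>w\<in>{w. cmod w \<le> r \<and> zero_mult f w \<noteq> 0}.
        zero_mult f w -
        min (zero_mult f w) (if cmod (w - 1) \<le> r then zero_mult f (w - 1) else 0))"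

definition Nbar_diff :: "real \<Rightarrow> (complex \<Rightarrow> complex) \<Rightarrow> real" where
  "Nbar_diff r f =
     integral {0..r} (\<lambda>t. (real (nbar_diff t f) - real (nbar_diff 0 f)) / t) +
     real (nbar_diff 0 f) * ln r"

text \<open>The coefficient $c_\lambda$ of the leading term $c_\lambda z^\lambda$ of \<open>a\<close> at 0.\<close>

definition leading_coeff_at_0 :: "(complex \<Rightarrow> complex) \<Rightarrow> complex" where
  "leading_coeff_at_0 a = fps_nth (fps_expansion a 0) (subdegree (fps_expansion a 0))"

definition max_norm :: "'i set \<Rightarrow> ('i \<Rightarrow> complex \<Rightarrow> complex) \<Rightarrow> complex \<Rightarrow> real" where
  "max_norm J a z = (MAX j\<in>J. cmod (a j z))"

text \<open>
  The characteristic $\widetilde{T}$ of a finite family of entire functions, not all identically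
  zero. A member that is identically zero has no leading term and is omitted from the second
  maximum.
\<close>

definition T_tilde :: "'i set \<Rightarrow> ('i \<Rightarrow> complex \<Rightarrow> complex) \<Rightarrow> real \<Rightarrow> real" where
  "T_tilde J a r =
     1 / (2 * pi) * integral {0..2 * pi} (\<lambda>\<theta>. ln (max_norm J a (rcis r \<theta>))) -
     (if max_norm J a 0 \<noteq> 0 then ln (max_norm J a 0)
      else (MAX j\<in>{j\<in>J. \<exists>z. a j z \<noteq> 0}. ln (cmod (leading_coeff_at_0 (a j)))))"

definition finite_log_measure :: "real set \<Rightarrow> bool" where
  "finite_log_measure E \<longleftrightarrow>
     E \<subseteq> {1..} \<and> E \<in> sets lebesgue \<and> (\<integral>\<^sup>+ r\<in>E. ennreal (1 / r) \<partial>lebesgue) < \<infinity>"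

end

theory Submission
  imports Defs "Jordan_Normal_Form.Determinant"
begin

text \<open>
  Write $C$ for the Casoratian $\det(\Delta^i f_j)_{i<m,\,1\le j\le m}$ and $P = f_1\cdots
  f_{m+1}$. Since $f_{m+1}$ is the sum of the other functions, $C$ is unchanged when one of its
  columns is replaced by that of $f_{m+1}$; so at each point the function of largest modulus can
  be kept out of $C$. Off a set of finite logarithmic measure, an entire function $g$ with $\log^+
  |g(z)| = O(|z|^s)$, $s < u < 1$, satisfies $|\Delta g(z)| \le |z|^{u-1} |g(z)|$, and iterating
  this bounds $|C|\max_j |f_j|$ by a constant times $|z|^{-(1-u)m(m-1)/2}\,|P|$. Integrating
  logarithms over circles and applying the Jensen formula to $P$ and $C$ leaves the difference of
  their zero counts. Each run of $L$ consecutive zeros of $P$ contributes at least $L - m + 1$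
  zeros to $C$, so that this difference is at most $m-1$ times the number of runs, which is what
  $\overline{n}_\Delta$ counts.

  The estimate for $\Delta g / g$ does not need a factorisation of $g$ over the whole plane: for
  $|z|$ comparable to $x$, split off the zeros $a$ with $|a| \le 32x$. The zero-free part
  contributes $O(x^{s-1})$ by the Schwarz lemma applied to its logarithm, and the zeros contribute
  at most $\sum_a 1 / \bigl| |z| - |a| \bigr|$, which is small for most $|z|$ because its mean
  over $[x, 2x]$ is $O(x^{s-1}\log x)$.
\<close>

section \<open>Zeros of entire functions\<close>

text \<open>Relative shifting primality enters through a single consequence: if f_i vanishes at w
  and j differs from i, then f_j does not vanish at w + 1. Hence a run of at least two consecutive
  zeros of P belongs to one function f_k. This puts the factor (z - w)^N into a whole column of C,
  and it also makes the difference counting function additive over the factors of P, which is the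
  equality in the theorem. Common zeros remain possible, but such a point has no neighbour in a run.
  The freedom to replace a column by f_{m+1} is used in two opposite ways: the upper bound leaves
  the largest function out of C, whereas the lower bound for the zeros of C needs f_k as a column.
  Linear independence serves to make C not identically zero. Order less than 1 is used twice: it
  makes the difference quotients small, and it gives every zero a finite length, without which
  shifting primality would say nothing about it. Since R has to be chosen before epsilon, all
  bounded ranges of radii on which an asymptotic estimate is not yet valid are moved into the
  exceptional set.\<close>

lemma entire_analytic: "entire f \<Longrightarrow> f analytic_on A"
  unfolding entire_def by (metis analytic_on_open analytic_on_subset open_UNIV subset_UNIV)

lemma entire_continuous_on: "entire f \<Longrightarrow> continuous_on A f"
  unfolding entire_def
  by (meson continuous_on_subset holomorphic_on_imp_continuous_on subset_UNIV)

lemma entire_eventually_nonzero: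
  assumes "entire f" "\<exists>z. f z \<noteq> 0"
  shows "eventually (\<lambda>z. f z \<noteq> 0) (at w)"
proof -
  obtain z0 where "f z0 \<noteq> 0" using assms by blast
  then have "\<forall>\<^sub>F z in at w. f z \<noteq> 0 \<and> z \<in> UNIV"
    by (intro non_zero_neighbour_alt[where S=UNIV and \<beta>=z0])
      (use assms in \<open>auto simp: entire_def\<close>)
  then show ?thesis by simp
qed

lemma entire_frequently_nonzero:
  assumes "entire f" "\<exists>z. f z \<noteq> 0"
  shows "frequently (\<lambda>z. f z \<noteq> 0) (at w)"
  using eventually_frequently[OF _ entire_eventually_nonzero[OF assms]] by simp

lemma of_nat_zero_mult:
  assumes "entire f" "\<exists>z. f z \<noteq> 0"
  shows "int (zero_mult f w) = zorder f w"
  unfolding zero_mult_def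
  using zorder_ge_0[OF entire_analytic[OF assms(1)] entire_frequently_nonzero[OF assms]] by simp

lemma zero_mult_eq_0_iff:
  assumes "entire f" "\<exists>z. f z \<noteq> 0"
  shows "zero_mult f w = 0 \<longleftrightarrow> f w \<noteq> 0"
  using zorder_eq_0_iff[OF entire_analytic[OF assms(1)] entire_frequently_nonzero[OF assms], of w]
    of_nat_zero_mult[OF assms, of w] by (metis of_nat_eq_0_iff)

lemma entire_mult_nonzero:
  assumes "entire f" "\<exists>z. f z \<noteq> 0" "entire g" "\<exists>z. g z \<noteq> 0"
  shows "\<exists>z. f z * g z \<noteq> 0"
proof -
  have "eventually (\<lambda>z. f z * g z \<noteq> 0) (at 0)"
    using entire_eventually_nonzero[OF assms(1,2)] entire_eventually_nonzero[OF assms(3,4)]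
    by eventually_elim simp
  then show ?thesis
    using eventually_happens' at_neq_bot by blast
qed

lemma entire_mult: "entire f \<Longrightarrow> entire g \<Longrightarrow> entire (\<lambda>z. f z * g z)"
  unfolding entire_def by (intro holomorphic_intros)

lemma entire_prod: "(\<And>i. i \<in> I \<Longrightarrow> entire (f i)) \<Longrightarrow> entire (\<lambda>z. \<Prod>i\<in>I. f i z)"
  unfolding entire_def by (intro holomorphic_intros)

lemma entire_prod_nonzero:
  assumes "finite I" "\<And>i. i \<in> I \<Longrightarrow> entire (f i)" "\<And>i. i \<in> I \<Longrightarrow> \<exists>z. f i z \<noteq> 0"
  shows "\<exists>z. (\<Prod>i\<in>I. f i z) \<noteq> 0"
  using assms
proof (induction I)
  case (insert i I)
  have "\<exists>z. f i z * (\<Prod>i\<in>I. f i z) \<noteq> 0"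
    using insert by (intro entire_mult_nonzero entire_prod) auto
  then show ?case using insert by simp
qed auto

lemma zero_mult_mult:
  assumes "entire f" "\<exists>z. f z \<noteq> 0" "entire g" "\<exists>z. g z \<noteq> 0"
  shows "zero_mult (\<lambda>z. f z * g z) w = zero_mult f w + zero_mult g w"
proof -
  have "zorder (\<lambda>z. f z * g z) w = zorder f w + zorder g w"
    using entire_eventually_nonzero[OF entire_mult[OF assms(1,3)] entire_mult_nonzero[OF assms]]
    by (intro zorder_times_analytic entire_analytic assms)
  then show ?thesis
    using of_nat_zero_mult[OF assms(1,2), of w] of_nat_zero_mult[OF assms(3,4), of w]
    unfolding zero_mult_def by linarith
qed

lemma zero_mult_prod:
  assumes "finite I" "\<And>i. i \<in> I \<Longrightarrow> entire (f i)" "\<And>i. i \<in> I \<Longrightarrow> \<exists>z. f i z \<noteq> 0"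
  shows "zero_mult (\<lambda>z. \<Prod>i\<in>I. f i z) w = (\<Sum>i\<in>I. zero_mult (f i) w)"
  using assms
proof (induction I)
  case empty
  then show ?case by (simp add: zero_mult_def)
next
  case (insert i I)
  have "zero_mult (\<lambda>z. f i z * (\<Prod>i\<in>I. f i z)) w
      = zero_mult (f i) w + zero_mult (\<lambda>z. \<Prod>i\<in>I. f i z) w"
    using insert by (intro zero_mult_mult entire_prod entire_prod_nonzero) auto
  then show ?case using insert by simp
qed

lemma zero_mult_linear_power: "zero_mult (\<lambda>z. (z - a) ^ n) a = n"
proof -
  have "zorder (\<lambda>z. (z - a) ^ n) a = int n"
    by (rule zorder_eqI[of UNIV _ "\<lambda>_. 1"]) auto
  then show ?thesis by (simp add: zero_mult_def)
qed

lemma zero_mult_geI: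
  assumes "entire g" "\<And>z. f z = (z - w) ^ n * g z" "\<exists>z. f z \<noteq> 0"
  shows "n \<le> zero_mult f w"
proof -
  obtain z0 where "f z0 \<noteq> 0" using assms(3) by blast
  then have z0: "(z0 - w) ^ n * g z0 \<noteq> 0" unfolding assms(2) .
  have "zero_mult (\<lambda>z. (z - w) ^ n * g z) w = zero_mult (\<lambda>z. (z - w) ^ n) w + zero_mult g w"
  proof (rule zero_mult_mult)
    show "entire (\<lambda>z. (z - w) ^ n)" unfolding entire_def by (intro holomorphic_intros)
    show "\<exists>z. (z - w) ^ n \<noteq> 0" "\<exists>z. g z \<noteq> 0"
      using z0 by (metis mult_zero_left, metis mult_zero_right)
  qed fact
  moreover have "f = (\<lambda>z. (z - w) ^ n * g z)" using assms(2) by auto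
  ultimately show ?thesis by (simp add: zero_mult_linear_power)
qed

lemma entire_finite_zeros:
  assumes "entire f" "\<exists>z. f z \<noteq> 0"
  shows "finite {w. cmod w \<le> r \<and> f w = 0}"
proof -
  have "\<not> f constant_on UNIV \<or> (\<forall>z. f z \<noteq> 0)"
    using assms(2) unfolding constant_on_def by auto
  then show ?thesis
  proof
    assume "\<not> f constant_on UNIV"
    then have "finite {z \<in> cball 0 r. f z = 0}"
      using assms by (intro holomorphic_compact_finite_zeros[where S=UNIV]) (auto simp: entire_def)
    then show ?thesis by (simp add: mem_cball)
  qed simp
qed

text \<open>The quotient by (z - a)^n has a removable singularity at a, where
  \<open>zor_poly\<close> supplies the value. The exponent is 0 if a is not a zero.\<close>

lemma entire_factor_zero:
  assumes "entire g" "\<exists>z. g z \<noteq> 0"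
  obtains h where "entire h" "\<And>z. g z = (z - a) ^ zero_mult g a * h z" "h a \<noteq> 0"
proof -
  define n where "n = zero_mult g a"
  have "(if g a = 0 then 0 < zorder g a else zorder g a = 0) \<and> (\<exists>r>0. cball a r \<subseteq> UNIV \<and>
     zor_poly g a holomorphic_on cball a r \<and>
     (\<forall>w\<in>cball a r. g w = zor_poly g a w * (w - a) ^ nat (zorder g a) \<and> zor_poly g a w \<noteq> 0))"
    using assms by (intro zorder_exist_zero) (auto simp: entire_def)
  then obtain r where r: "r > 0" "zor_poly g a holomorphic_on cball a r"
    and r': "\<forall>w\<in>cball a r. g w = zor_poly g a w * (w - a) ^ n \<and> zor_poly g a w \<noteq> 0"
    unfolding n_def zero_mult_def by blast
  define h where "h z = (if z = a then zor_poly g a a else g z / (z - a) ^ n)" for z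
  have "h holomorphic_on ball a r"
    using holomorphic_on_subset[OF r(2) ball_subset_cball]
    by (rule holomorphic_transform) (use r' in \<open>auto simp: h_def field_simps\<close>)
  moreover have "h holomorphic_on (- {a})"
  proof (rule holomorphic_transform[of "\<lambda>z. g z / (z - a) ^ n"])
    show "(\<lambda>z. g z / (z - a) ^ n) holomorphic_on - {a}"
      using assms(1) by (auto intro!: holomorphic_intros holomorphic_on_subset[of g UNIV]
        simp: entire_def)
  qed (auto simp: h_def)
  ultimately have "h holomorphic_on (ball a r \<union> - {a})"
    by (intro holomorphic_on_Un) auto
  moreover have "ball a r \<union> - {a} = UNIV" using r(1) by auto
  ultimately have "entire h" by (simp add: entire_def)
  moreover have "g z = (z - a) ^ n * h z" for z
    using r' r(1) by (auto simp: h_def)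
  moreover have "h a \<noteq> 0" using r(1) r' by (simp add: h_def)
  ultimately show thesis using that unfolding n_def by blast
qed

lemma entire_factor_zeros:
  assumes "entire g" "\<exists>z. g z \<noteq> 0" "finite S"
  obtains h where "entire h" "\<And>z. g z = (\<Prod>a\<in>S. (z - a) ^ zero_mult g a) * h z"
    "\<And>a. a \<in> S \<Longrightarrow> h a \<noteq> 0"
  using assms(3)
proof (induction S arbitrary: thesis)
  case empty
  then show ?case using assms(1) by simp
next
  case (insert a S)
  from insert.IH obtain h where h: "entire h"
    "\<And>z. g z = (\<Prod>a\<in>S. (z - a) ^ zero_mult g a) * h z" "\<And>a. a \<in> S \<Longrightarrow> h a \<noteq> 0" by blast
  define p where "p z = (\<Prod>a\<in>S. (z - a) ^ zero_mult g a)" for z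
  have p: "entire p" unfolding p_def entire_def by (intro holomorphic_intros)
  have pa: "p a \<noteq> 0" unfolding p_def using insert.hyps by auto
  have h_nz: "\<exists>z. h z \<noteq> 0" using assms(2) h(2) by auto
  have "g = (\<lambda>z. p z * h z)" using h(2) by (auto simp: p_def)
  then have "zero_mult g a = zero_mult p a + zero_mult h a"
    using zero_mult_mult[OF p _ h(1) h_nz] pa by auto
  moreover have "zero_mult p a = 0" using zero_mult_eq_0_iff[OF p] pa by blast
  \<comment> \<open>The next factor is split off from \<open>h\<close>, yet its exponent must be the
    multiplicity in \<open>g\<close>. The two agree because the factors already removed do not
    vanish at \<open>a\<close>.\<close>
  ultimately have eq: "zero_mult h a = zero_mult g a" by simp
  obtain k where k: "entire k" "\<And>z. h z = (z - a) ^ zero_mult h a * k z" "k a \<noteq> 0"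
    using entire_factor_zero[OF h(1) h_nz] by blast
  show ?case
  proof (rule insert.prems)
    show "entire k" by fact
    show "g z = (\<Prod>a\<in>insert a S. (z - a) ^ zero_mult g a) * k z" for z
    proof -
      have "g z = (\<Prod>a\<in>S. (z - a) ^ zero_mult g a) * ((z - a) ^ zero_mult g a * k z)"
        using h(2)[of z] k(2)[of z] unfolding eq by simp
      then show ?thesis using insert.hyps by (simp add: mult_ac)
    qed
    show "k b \<noteq> 0" if "b \<in> insert a S" for b
      using that k(3) h(3)[of b] k(2)[of b] by (cases "b = a") auto
  qed
qed

section \<open>Counting zeros in discs\<close>

definition zeros_in :: "(complex \<Rightarrow> complex) \<Rightarrow> real \<Rightarrow> complex set" where
  "zeros_in f r = {w. cmod w \<le> r \<and> f w = 0}"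

definition zero_count :: "(complex \<Rightarrow> complex) \<Rightarrow> real \<Rightarrow> nat" where
  "zero_count f r = (\<Sum>w\<in>zeros_in f r. zero_mult f w)"

lemma finite_zeros_in: "entire f \<Longrightarrow> \<exists>z. f z \<noteq> 0 \<Longrightarrow> finite (zeros_in f r)"
  unfolding zeros_in_def by (rule entire_finite_zeros)

text \<open>The maximum principle on a large circle divides G by (4R)^n, while at \<open>z0\<close>
  the removed factors are at most (2R)^n; the quotient leaves the gain 2^n. At z = z0 the inequality
  bounds the number n of zeros, and with 2^n dropped it bounds h / h(z0). The base point
  \<open>z0\<close> stands in for 0, which may be a zero.\<close>

lemma zero_free_part:
  assumes "entire g" "g z0 \<noteq> 0" "cmod z0 \<le> 1" "R \<ge> 1"
    and G: "\<And>z. cmod z \<le> 8 * R \<Longrightarrow> cmod (g z) \<le> G"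
  shows "\<exists>h. entire h \<and> (\<forall>z. g z = (\<Prod>a\<in>zeros_in g R. (z - a) ^ zero_mult g a) * h z) \<and>
    (\<forall>z. cmod z \<le> R \<longrightarrow> h z \<noteq> 0 \<and>
      cmod (h z) * 2 ^ zero_count g R * cmod (g z0) \<le> G * cmod (h z0))"
proof -
  let ?S = "zeros_in g R" and ?n = "zero_count g R"
  have nz: "\<exists>z. g z \<noteq> 0" using assms by blast
  obtain h where h: "entire h" "\<And>z. g z = (\<Prod>a\<in>?S. (z - a) ^ zero_mult g a) * h z"
    "\<And>a. a \<in> ?S \<Longrightarrow> h a \<noteq> 0"
    using entire_factor_zeros[OF assms(1) nz finite_zeros_in[OF assms(1) nz]] by blast
  have h_nz: "h z \<noteq> 0" if "cmod z \<le> R" for z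
    using h(2)[of z] h(3)[of z] that by (cases "g z = 0") (auto simp: zeros_in_def)
  have "cmod (h z) * 2 ^ ?n * cmod (g z0) \<le> G * cmod (h z0)" if z: "cmod z \<le> R" for z
  proof -
    \<comment> \<open>On this circle |w - a| is at least 7R - 1 - R, hence at least 4R, and |w|
      stays below 8R, where \<open>G\<close> is a bound.\<close>
    have bd: "cmod (h w) \<le> G / (4 * R) ^ ?n" if "w \<in> frontier (ball z0 (7 * R))" for w
    proof -
      have w: "cmod (w - z0) = 7 * R"
        using that assms(4) by (auto simp: dist_norm norm_minus_commute)
      have "4 * R \<le> cmod (w - a)" if "a \<in> ?S" for a
      proof -
        have "cmod a \<le> R" using that by (simp add: zeros_in_def)
        then show ?thesis using w assms(3,4) norm_triangle_ineq[of "w - a" "a - z0"]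
          norm_triangle_ineq4[of a z0] by simp
      qed
      then have "(\<Prod>a\<in>?S. (4 * R) ^ zero_mult g a) \<le> (\<Prod>a\<in>?S. cmod (w - a) ^ zero_mult g a)"
        using assms(4) by (intro prod_mono conjI power_mono) auto
      moreover have "(\<Prod>a\<in>?S. (4 * R) ^ zero_mult g a) = (4 * R) ^ ?n"
        by (simp add: zero_count_def power_sum)
      moreover have "cmod (g w) = (\<Prod>a\<in>?S. cmod (w - a) ^ zero_mult g a) * cmod (h w)"
        using h(2)[of w] by (simp add: norm_mult prod_norm[symmetric] norm_power)
      ultimately have le: "(4 * R) ^ ?n * cmod (h w) \<le> cmod (g w)"
        by (simp add: mult_right_mono)
      have "cmod w \<le> 8 * R" using w assms(3,4) norm_triangle_ineq[of "w - z0" z0] by simp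
      then have "(4 * R) ^ ?n * cmod (h w) \<le> G" using le G by force
      then show ?thesis using assms(4) by (simp add: field_simps)
    qed
    have "h holomorphic_on interior (ball z0 (7 * R))"
      using h(1) unfolding entire_def by (rule holomorphic_on_subset) simp
    moreover have "continuous_on (closure (ball z0 (7 * R))) h"
      using h(1) by (rule entire_continuous_on)
    moreover have "z \<in> ball z0 (7 * R)"
      using z assms(3,4) norm_triangle_ineq4[of z0 z] by (simp add: dist_norm)
    ultimately have "cmod (h z) \<le> G / (4 * R) ^ ?n"
      by (intro maximum_modulus_frontier[OF _ _ bounded_ball bd])
    then have A: "cmod (h z) * (4 * R) ^ ?n \<le> G"
      using assms(4) by (simp add: field_simps)
    have "cmod (z0 - a) \<le> 2 * R" if "a \<in> ?S" for a
    proof -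
      have "cmod a \<le> R" using that by (simp add: zeros_in_def)
      then show ?thesis using assms(3,4) norm_triangle_ineq4[of z0 a] by simp
    qed
    then have "(\<Prod>a\<in>?S. cmod (z0 - a) ^ zero_mult g a) \<le> (\<Prod>a\<in>?S. (2 * R) ^ zero_mult g a)"
      using assms(4) by (intro prod_mono conjI power_mono) auto
    moreover have "(\<Prod>a\<in>?S. (2 * R) ^ zero_mult g a) = (2 * R) ^ ?n"
      by (simp add: zero_count_def power_sum)
    moreover have "cmod (g z0) = (\<Prod>a\<in>?S. cmod (z0 - a) ^ zero_mult g a) * cmod (h z0)"
      using h(2)[of z0] by (simp add: norm_mult prod_norm[symmetric] norm_power)
    ultimately have B: "cmod (g z0) \<le> (2 * R) ^ ?n * cmod (h z0)"
      by (simp add: mult_right_mono)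
    have "cmod (h z) * 2 ^ ?n * cmod (g z0) \<le> cmod (h z) * 2 ^ ?n * ((2 * R) ^ ?n * cmod (h z0))"
      using B by (intro mult_left_mono) auto
    also have "\<dots> = cmod (h z) * (2 ^ ?n * (2 * R) ^ ?n) * cmod (h z0)"
      by (simp only: mult.assoc)
    also have "\<dots> = cmod (h z) * (4 * R) ^ ?n * cmod (h z0)"
      unfolding power_mult_distrib[symmetric] by simp
    also have "\<dots> \<le> G * cmod (h z0)"
      using A by (intro mult_right_mono) auto
    finally show ?thesis .
  qed
  then show ?thesis using h(1,2) h_nz by (intro exI[of _ h]) simp
qed

section \<open>Growth and the number of zeros\<close>

text \<open>Order at most s with finite type. The base 1 + |z| is at least 1, so that one constant
  also covers the points near 0.\<close>

definition growth_le :: "real \<Rightarrow> (complex \<Rightarrow> complex) \<Rightarrow> bool" where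
  "growth_le s f \<longleftrightarrow> (\<exists>A\<ge>0. \<forall>z. cmod (f z) \<le> exp (A * (1 + cmod z) powr s))"

lemma entire_fdiff:
  assumes "entire f"
  shows "entire (fdiff f)"
proof -
  have "(f \<circ> (\<lambda>z. z + 1)) holomorphic_on UNIV"
    using assms unfolding entire_def
    by (intro holomorphic_on_compose holomorphic_intros) (auto intro: holomorphic_on_subset)
  then show ?thesis
    using assms unfolding entire_def fdiff_def by (intro holomorphic_intros) (simp_all add: o_def)
qed

lemma entire_fdiff_funpow: "entire f \<Longrightarrow> entire ((fdiff ^^ n) f)"
  by (induction n) (auto intro: entire_fdiff)

text \<open>Needed because the quotient estimate is iterated and must apply to every difference of
  f. A shift by 1 at most doubles 1 + |z|.\<close>

lemma growth_le_fdiff: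
  assumes "0 < s" "growth_le s f"
  shows "growth_le s (fdiff f)"
proof -
  obtain A where A: "A \<ge> 0" "\<And>z. cmod (f z) \<le> exp (A * (1 + cmod z) powr s)"
    using assms(2) unfolding growth_le_def by blast
  define B where "B = A * 2 powr s"
  have B: "A \<le> B" "0 \<le> B"
    using A(1) assms(1) ge_one_powr_ge_zero[of 2 s] unfolding B_def by (auto simp:
        mult_le_cancel_left1)
  have "cmod (fdiff f z) \<le> exp ((B + 1) * (1 + cmod z) powr s)" for z
  proof -
    let ?X = "(1 + cmod z) powr s"
    have X: "1 \<le> ?X" using assms(1) by (intro ge_one_powr_ge_zero) auto
    have "(1 + cmod (z + 1)) powr s \<le> (2 * (1 + cmod z)) powr s"
    proof (rule powr_mono2)
      have "cmod (z + 1) \<le> cmod z + 1" using norm_triangle_ineq[of z 1] by simp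
      then show "1 + cmod (z + 1) \<le> 2 * (1 + cmod z)" by (smt (verit) norm_ge_zero)
    qed (use assms(1) in simp_all)
    also have "\<dots> = 2 powr s * ?X" by (rule powr_mult)
    finally have "(1 + cmod (z + 1)) powr s \<le> 2 powr s * ?X" .
    then have "A * (1 + cmod (z + 1)) powr s \<le> A * (2 powr s * ?X)"
      using A(1) by (rule mult_left_mono)
    then have "A * (1 + cmod (z + 1)) powr s \<le> B * ?X" by (simp add: B_def)
    then have 1: "cmod (f (z + 1)) \<le> exp (B * ?X)"
      using A(2)[of "z + 1"] by (meson exp_le_cancel_iff order_trans)
    have "A * ?X \<le> B * ?X" using B X by (intro mult_right_mono) auto
    then have 2: "cmod (f z) \<le> exp (B * ?X)"
      using A(2)[of z] by (meson exp_le_cancel_iff order_trans)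
    \<comment> \<open>The summand 1 in the constant \<open>B + 1\<close> pays for the factor 2 of
      the triangle inequality.\<close>
    have "2 \<le> exp ?X" using exp_ge_add_one_self[of ?X] X by linarith
    then have "2 * exp (B * ?X) \<le> exp ?X * exp (B * ?X)" by (intro mult_right_mono) auto
    moreover have "cmod (fdiff f z) \<le> cmod (f (z + 1)) + cmod (f z)"
      unfolding fdiff_def by (rule norm_triangle_ineq4)
    ultimately have "cmod (fdiff f z) \<le> exp ?X * exp (B * ?X)" using 1 2 by linarith
    then show ?thesis by (simp add: distrib_right exp_add mult.commute)
  qed
  then show ?thesis using B(2) unfolding growth_le_def by (intro exI[of _ "B + 1"]) auto
qed

lemma growth_le_fdiff_funpow: "0 < s \<Longrightarrow> growth_le s f \<Longrightarrow> growth_le s ((fdiff ^^ n) f)"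
  by (induction n) (auto intro: growth_le_fdiff)

section \<open>From the order of growth to an explicit bound\<close>

lemma norm_le_max_modulus:
  assumes "entire f"
  shows "cmod (f z) \<le> max_modulus f (cmod z)"
  unfolding max_modulus_def
proof (rule cSUP_upper)
  show "z \<in> sphere 0 (cmod z)" by simp
  have "compact ((\<lambda>z. cmod (f z)) ` sphere 0 (cmod z))"
    by (intro compact_continuous_image continuous_intros entire_continuous_on assms compact_sphere)
  then show "bdd_above ((\<lambda>z. cmod (f z)) ` sphere 0 (cmod z))"
    by (intro bounded_imp_bdd_above compact_imp_bounded)
qed

lemma log_plus_le_iff: "0 \<le> y \<Longrightarrow> log_plus x \<le> y \<longleftrightarrow> x \<le> exp y"
proof -
  assume y: "0 \<le> y"
  have "ln (max 1 x) \<le> ln (exp y) \<longleftrightarrow> max 1 x \<le> exp y"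
    by (rule ln_le_cancel_iff) auto
  then show ?thesis using y by (simp add: log_plus_def)
qed

lemma log_plus_nonneg: "0 \<le> log_plus x"
  unfolding log_plus_def by (simp add: ln_ge_zero)

text \<open>Beyond \<open>r1\<close> the limsup gives the bound with constant 1. On the remaining
  disc f is bounded by some b, and ln b goes into the constant because (1 + |z|)^s is at least
  1.\<close>

lemma growth_order_less_imp_growth_le:
  assumes "entire f" "growth_order f < ereal s" "0 < s"
  shows "growth_le s f"
proof -
  have "\<forall>\<^sub>F r in at_top. ereal (log_plus (log_plus (max_modulus f r)) / ln r) < ereal s"
    using assms(2) unfolding growth_order_def by (rule Limsup_lessD)
  then obtain r0 where r0: "\<And>r. r \<ge> r0 \<Longrightarrow> log_plus (log_plus (max_modulus f r)) / ln r < s"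
    unfolding eventually_at_top_linorder by auto
  define r1 where "r1 = max 2 r0"
  have big: "cmod (f z) \<le> exp ((1 + cmod z) powr s)" if z: "r1 \<le> cmod z" for z
  proof -
    let ?r = "cmod z"
    have r: "2 \<le> ?r" "r0 \<le> ?r" using z by (auto simp: r1_def)
    have "log_plus (log_plus (max_modulus f ?r)) \<le> s * ln ?r"
      using r0[OF r(2)] r(1) ln_gt_zero[of ?r] by (simp add: pos_divide_less_eq)
    then have "log_plus (max_modulus f ?r) \<le> exp (s * ln ?r)"
      using r assms(3) by (subst (asm) log_plus_le_iff) auto
    then have "max_modulus f ?r \<le> exp (exp (s * ln ?r))"
      by (subst (asm) log_plus_le_iff) auto
    then have "cmod (f z) \<le> exp (?r powr s)"
      using norm_le_max_modulus[OF assms(1), of z] r(1) by (auto simp: powr_def)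
    moreover have "?r powr s \<le> (1 + ?r) powr s" using assms(3) by (intro powr_mono2) auto
    ultimately show ?thesis by (meson exp_le_cancel_iff order_trans)
  qed
  have "compact (f ` cball 0 r1)"
    by (intro compact_continuous_image entire_continuous_on assms compact_cball)
  then obtain b where b: "\<And>z. cmod z \<le> r1 \<Longrightarrow> cmod (f z) \<le> b" "b > 0"
    using compact_imp_bounded bounded_pos by (metis image_eqI mem_cball_0)
  define A where "A = max 1 (ln b)"
  have "cmod (f z) \<le> exp (A * (1 + cmod z) powr s)" for z
  proof (cases "r1 \<le> cmod z")
    case True
    have "(1 + cmod z) powr s \<le> A * (1 + cmod z) powr s"
      by (simp add: A_def mult_le_cancel_right1)
    then show ?thesis using big[OF True] by (meson exp_le_cancel_iff order_trans)
  next
    case False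
    have "ln b \<le> A" "0 \<le> A" by (auto simp: A_def)
    moreover have "1 \<le> (1 + cmod z) powr s" using assms(3) by (intro ge_one_powr_ge_zero) auto
    ultimately have "ln b \<le> A * (1 + cmod z) powr s" by (metis mult_le_cancel_left1
        linorder_not_less order_trans mult_left_mono mult.right_neutral)
    then have "b \<le> exp (A * (1 + cmod z) powr s)" using b(2) by (metis exp_le_cancel_iff exp_ln)
    then show ?thesis using b(1)[of z] False by force
  qed
  then show ?thesis unfolding growth_le_def by (intro exI[of _ A]) (auto simp: A_def)
qed

text \<open>The radius 8R is the one on which \<open>zero_free_part\<close> asks for a bound; 1 + 8R
  <= 9R gives the constant.\<close>

lemma growth_le_cball:
  assumes "0 < s" "growth_le s g"
  obtains A where "A \<ge> 0" "\<And>z R. 1 \<le> R \<Longrightarrow> cmod z \<le> 8 * R \<Longrightarrow> cmod (g z) \<le> exp (A * R powr s)"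
proof -
  obtain A where A: "A \<ge> 0" "\<And>z. cmod (g z) \<le> exp (A * (1 + cmod z) powr s)"
    using assms(2) unfolding growth_le_def by blast
  have "cmod (g z) \<le> exp (A * 9 powr s * R powr s)" if "1 \<le> R" "cmod z \<le> 8 * R" for z R
  proof -
    have "(1 + cmod z) powr s \<le> (9 * R) powr s"
      using that assms(1) by (intro powr_mono2) auto
    then have "A * (1 + cmod z) powr s \<le> A * (9 * R) powr s" using A(1) by (rule mult_left_mono)
    also have "\<dots> = A * 9 powr s * R powr s" using that by (simp add: powr_mult)
    finally show ?thesis using A(2)[of z] by (meson exp_le_cancel_iff order_trans)
  qed
  then show thesis using A(1) by (intro that[of "A * 9 powr s"]) auto
qed

lemma entire_nonzero_near_0:
  assumes "entire g" "\<exists>z. g z \<noteq> 0"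
  obtains z0 where "g z0 \<noteq> 0" "cmod z0 \<le> 1"
proof -
  have "eventually (\<lambda>z. g z \<noteq> 0 \<and> z \<in> ball 0 1) (at 0)"
    by (intro eventually_conj entire_eventually_nonzero assms eventually_at_in_open') auto
  from eventually_happens'[OF at_neq_bot this] show thesis using that by force
qed

text \<open>\<open>zero_free_part\<close> at z = z0: h(z0) cancels and 2^n |g(z0)| is at most the
  bound for g, so taking logarithms bounds n.\<close>

lemma zero_count_growth:
  assumes "entire g" "\<exists>z. g z \<noteq> 0" "0 < s" "growth_le s g"
  obtains C where "C \<ge> 0" "\<And>R. 1 \<le> R \<Longrightarrow> real (zero_count g R) \<le> C * R powr s"
proof -
  obtain A where A: "A \<ge> 0"
    "\<And>z R. 1 \<le> R \<Longrightarrow> cmod z \<le> 8 * R \<Longrightarrow> cmod (g z) \<le> exp (A * R powr s)"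
    using growth_le_cball[OF assms(3,4)] by blast
  obtain z0 where z0: "g z0 \<noteq> 0" "cmod z0 \<le> 1"
    using entire_nonzero_near_0[OF assms(1,2)] by blast
  define C where "C = (A + \<bar>ln (cmod (g z0))\<bar>) / ln 2"
  have "real (zero_count g R) \<le> C * R powr s" if R: "1 \<le> R" for R
  proof -
    have "\<exists>h. \<forall>z. cmod z \<le> R \<longrightarrow> h z \<noteq> 0 \<and>
      cmod (h z) * 2 ^ zero_count g R * cmod (g z0) \<le> exp (A * R powr s) * cmod (h z0)"
      using zero_free_part[OF assms(1) z0 R A(2)[OF R]] by blast
    then obtain h where h: "\<And>z. cmod z \<le> R \<Longrightarrow> h z \<noteq> 0"
      "\<And>z. cmod z \<le> R \<Longrightarrow> cmod (h z) * 2 ^ zero_count g R * cmod (g z0) \<le> exp (A * R powr s) * cmod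
          (h z0)"
      by blast
    have "cmod z0 \<le> R" using z0 R by simp
    then have "2 ^ zero_count g R * cmod (g z0) \<le> exp (A * R powr s)"
      using h[of z0] by (simp add: mult.commute mult.left_commute)
    then have "ln (2 ^ zero_count g R * cmod (g z0)) \<le> A * R powr s"
      using z0(1) by (metis ln_exp ln_mono mult_pos_pos zero_less_norm_iff zero_less_numeral
          zero_less_power)
    then have "real (zero_count g R) * ln 2 \<le> A * R powr s - ln (cmod (g z0))"
      using z0(1) by (simp add: ln_mult ln_realpow)
    also have "\<dots> \<le> A * R powr s + \<bar>ln (cmod (g z0))\<bar> * R powr s"
    proof -
      have "1 \<le> R powr s" using R assms(3) by (intro ge_one_powr_ge_zero) auto
      then have "\<bar>ln (cmod (g z0))\<bar> * 1 \<le> \<bar>ln (cmod (g z0))\<bar> * R powr s"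
        by (intro mult_left_mono) auto
      then show ?thesis by linarith
    qed
    finally show ?thesis by (simp add: C_def field_simps)
  qed
  moreover have "C \<ge> 0" using A(1) by (simp add: C_def)
  ultimately show thesis using that by blast
qed

text \<open>The Borel-Caratheodory argument for the logarithm L of h / h(z0): Re L < M on the ball
  bounds |L| on half the radius, and then the Cauchy estimate bounds L' on a quarter of it. The mean
  value inequality gives l = L(w) - L(z).\<close>

lemma zero_free_ratio:
  assumes "h holomorphic_on ball z0 \<rho>" "0 < \<rho>" "0 < M"
    and nz: "\<And>z. z \<in> ball z0 \<rho> \<Longrightarrow> h z \<noteq> 0"
    and lt: "\<And>z. z \<in> ball z0 \<rho> \<Longrightarrow> cmod (h z) < exp M * cmod (h z0)"
    and zw: "z \<in> cball z0 (\<rho> / 4)" "w \<in> cball z0 (\<rho> / 4)"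
  obtains l where "h w = h z * exp l" "cmod l \<le> 8 * M / \<rho> * cmod (w - z)"
proof -
  obtain L0 where L0: "L0 holomorphic_on ball z0 \<rho>" "\<And>z. z \<in> ball z0 \<rho> \<Longrightarrow> h z = exp (L0 z)"
    using contractible_imp_holomorphic_log[OF assms(1) convex_imp_contractible[OF convex_ball] nz]
    by blast
  define L where "L z = L0 z - L0 z0" for z
  have L: "L holomorphic_on ball z0 \<rho>" unfolding L_def by (intro holomorphic_intros L0)
  have L_z0: "L z0 = 0" by (simp add: L_def)
  have hL: "h z = h z0 * exp (L z)" if "z \<in> ball z0 \<rho>" for z
    using L0(2)[OF that] L0(2)[of z0] assms(2) by (simp add: L_def exp_diff)
  have ReL: "Re (L z) < M" if "z \<in> ball z0 \<rho>" for z
  proof -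
    have "cmod (h z0) * exp (Re (L z)) < exp M * cmod (h z0)"
      using lt[OF that] hL[OF that] by (simp add: norm_mult norm_exp_eq_Re)
    moreover have "cmod (h z0) > 0" using nz[of z0] assms(2) by simp
    ultimately show ?thesis by (simp add: mult.commute)
  qed
  \<comment> \<open>The map $w \mapsto w / (2M - w)$ takes the half plane $\mathrm{Re}\, w < M$ into the unit
      disc.\<close>
  define F where "F \<zeta> = L (z0 + of_real \<rho> * \<zeta>) / (2 * of_real M - L (z0 + of_real \<rho> * \<zeta>))" for \<zeta>
  have in_ball: "z0 + of_real \<rho> * \<zeta> \<in> ball z0 \<rho>" if "cmod \<zeta> < 1" for \<zeta>
    using that assms(2) by (simp add: dist_norm norm_mult)
  \<comment> \<open>The half plane Re < M consists of the points that are closer to 0 than to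
    2M.\<close>
  have den: "cmod (L z) < cmod (2 * of_real M - L z)" if "z \<in> ball z0 \<rho>" for z
  proof -
    have "(cmod (L z))\<^sup>2 < (cmod (2 * of_real M - L z))\<^sup>2"
    proof -
      have "M * Re (L z) < M * M" using ReL[OF that] assms(3) by simp
      then show ?thesis unfolding cmod_power2 by (simp add: power2_eq_square algebra_simps)
    qed
    then show ?thesis using power2_less_imp_less norm_ge_zero by blast
  qed
  have "F holomorphic_on ball 0 1"
  proof -
    have "(\<lambda>\<zeta>. L (z0 + of_real \<rho> * \<zeta>)) holomorphic_on ball 0 1"
      by (rule holomorphic_on_compose_gen[OF _ L, unfolded o_def])
        (use in_ball in \<open>auto intro!: holomorphic_intros\<close>)
    moreover have "2 * of_real M - L (z0 + of_real \<rho> * \<zeta>) \<noteq> 0" if "\<zeta> \<in> ball 0 1" for \<zeta>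
      using den[OF in_ball[of \<zeta>]] that by auto
    ultimately show ?thesis unfolding F_def by (intro holomorphic_intros)
  qed
  moreover have "F 0 = 0" by (simp add: F_def L_z0)
  moreover have "cmod (F \<zeta>) < 1" if "cmod \<zeta> < 1" for \<zeta>
    using den[OF in_ball[OF that]] by (auto simp: F_def norm_divide divide_less_eq)
  ultimately have Schwarz: "cmod (F \<zeta>) \<le> cmod \<zeta>" if "cmod \<zeta> < 1" for \<zeta>
    using Schwarz_Lemma(1) that by blast
  \<comment> \<open>Here |F| <= 1/2, so 2|L| <= |2M - L| <= 2M + |L|.\<close>
  have L_bd: "cmod (L z) \<le> 2 * M" if z: "z \<in> cball z0 (\<rho> / 2)" for z
  proof -
    define \<zeta> where "\<zeta> = (z - z0) / of_real \<rho>"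
    have \<zeta>: "cmod \<zeta> \<le> 1 / 2"
      using z assms(2) by (simp add: \<zeta>_def norm_divide dist_norm norm_minus_commute field_simps)
    have z_eq: "z0 + of_real \<rho> * \<zeta> = z" using assms(2) by (simp add: \<zeta>_def)
    have zb: "z \<in> ball z0 \<rho>" using z assms(2) by simp
    have "cmod (L z) / cmod (2 * of_real M - L z) \<le> cmod \<zeta>"
      using Schwarz[of \<zeta>] \<zeta> by (simp add: F_def z_eq norm_divide)
    then have "cmod (L z) / cmod (2 * of_real M - L z) \<le> 1 / 2" using \<zeta> by linarith
    then have "2 * cmod (L z) \<le> cmod (2 * of_real M - L z)"
      using den[OF zb] norm_ge_zero[of "L z"]
      by (subst (asm) pos_divide_le_eq) (linarith, simp)
    moreover have "cmod (2 * of_real M - L z) \<le> 2 * M + cmod (L z)"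
      using norm_triangle_ineq4[of "2 * of_real M" "L z"] assms(3) by (simp add: norm_mult)
    ultimately show ?thesis by linarith
  qed
  have deriv_bd: "cmod (deriv L z) \<le> 8 * M / \<rho>" if z: "z \<in> cball z0 (\<rho> / 4)" for z
  proof -
    have sub: "cball z (\<rho> / 4) \<subseteq> cball z0 (\<rho> / 2)"
    proof
      fix x assume "x \<in> cball z (\<rho> / 4)"
      then show "x \<in> cball z0 (\<rho> / 2)"
        using z dist_triangle[of z0 x z] by simp
    qed
    then have sub': "cball z (\<rho> / 4) \<subseteq> ball z0 \<rho>" using assms(2) by fastforce
    \<comment> \<open>Circles of radius rho/4 about z stay in the half-radius ball, where |L| <= 2M;
      the quotient is 8M/rho.\<close>
    have "cmod ((deriv ^^ 1) L z) \<le> fact 1 * (2 * M) / (\<rho> / 4) ^ 1"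
    proof (rule Cauchy_inequality)
      show "L holomorphic_on ball z (\<rho> / 4)"
        using L by (rule holomorphic_on_subset) (use sub' ball_subset_cball in blast)
      show "continuous_on (cball z (\<rho> / 4)) L"
        using L sub' holomorphic_on_imp_continuous_on continuous_on_subset by blast
      show "cmod (L x) \<le> 2 * M" if "cmod (z - x) = \<rho> / 4" for x
      proof -
        have "x \<in> cball z (\<rho> / 4)" using that by (simp add: dist_norm)
        then show ?thesis using sub L_bd by blast
      qed
    qed (use assms(2) in simp)
    then show ?thesis by simp
  qed
  have "cmod (L w - L z) \<le> 8 * M / \<rho> * cmod (w - z)"
  proof (rule field_differentiable_bound[OF convex_cball _ deriv_bd])
    fix x assume "x \<in> cball z0 (\<rho> / 4)"
    then have "x \<in> ball z0 \<rho>" using assms(2) by simp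
    then show "(L has_field_derivative deriv L x) (at x within cball z0 (\<rho> / 4))"
      using L by (metis has_field_derivative_at_within holomorphic_derivI open_ball)
  qed (use zw in auto)
  moreover have "h w = h z * exp (L w - L z)"
  proof -
    have "z \<in> ball z0 \<rho>" "w \<in> ball z0 \<rho>" using zw assms(2) by auto
    then show ?thesis using hL[of z] hL[of w] by (simp add: exp_diff)
  qed
  ultimately show thesis using that by blast
qed

section \<open>Difference quotients off small sets\<close>

lemma finite_log_measure_iff:
  "finite_log_measure E \<longleftrightarrow> E \<subseteq> {1..} \<and> E \<in> sets lebesgue \<and>
     emeasure (density lebesgue (\<lambda>r. ennreal (1 / r))) E < \<infinity>"
proof -
  have "(\<lambda>r::real. ennreal (1 / r)) \<in> borel_measurable lebesgue"
    by (intro measurable_completion) measurable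
  then show ?thesis unfolding finite_log_measure_def by (auto simp: emeasure_density)
qed

lemma finite_log_measure_Un:
  assumes "finite_log_measure A" "finite_log_measure B"
  shows "finite_log_measure (A \<union> B)"
proof -
  let ?M = "density lebesgue (\<lambda>r::real. ennreal (1 / r))"
  have "emeasure ?M (A \<union> B) \<le> emeasure ?M A + emeasure ?M B"
    using assms by (intro emeasure_subadditive) (auto simp: finite_log_measure_iff)
  also have "\<dots> < \<infinity>" using assms by (auto simp: finite_log_measure_iff)
  finally show ?thesis using assms by (auto simp: finite_log_measure_iff)
qed

lemma finite_log_measure_null:
  assumes "A \<in> null_sets lebesgue" "A \<subseteq> {1..}"
  shows "finite_log_measure A"
  using assms nn_integral_null_set[OF assms(1), of "\<lambda>r. ennreal (1 / r)"]
  unfolding finite_log_measure_def by (simp add: null_setsD2)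

lemma finite_log_measure_empty: "finite_log_measure {}"
  by (rule finite_log_measure_null) auto

lemma finite_log_measure_UN:
  "finite I \<Longrightarrow> (\<And>i. i \<in> I \<Longrightarrow> finite_log_measure (E i)) \<Longrightarrow> finite_log_measure (\<Union>i\<in>I. E i)"
  by (induction I rule: finite_induct) (auto intro: finite_log_measure_Un finite_log_measure_empty)

text \<open>For the radii of circles that pass through a zero.\<close>

lemma finite_log_measure_countable:
  assumes "countable A" "A \<subseteq> {1..}"
  shows "finite_log_measure A"
proof (rule finite_log_measure_null)
  show "A \<in> null_sets lebesgue"
    using countable_imp_null_set_lborel[OF assms(1)] by (rule null_sets_completionI)
qed fact

text \<open>Lets estimates that are valid for large r be stated for all r > 1 off an exceptional
  set.\<close>

lemma finite_log_measure_Icc: "finite_log_measure {1..b}"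
proof -
  have "(\<integral>\<^sup>+ r\<in>{1..b}. ennreal (1 / r) \<partial>lebesgue) \<le> (\<integral>\<^sup>+ r. indicator {1..b} r \<partial>lebesgue)"
    by (intro nn_integral_mono) (auto simp: indicator_def)
  also have "\<dots> = emeasure lebesgue {1..b}" by (intro nn_integral_indicator) auto
  also have "\<dots> < \<infinity>" by (cases "1 \<le> b") auto
  finally show ?thesis unfolding finite_log_measure_def by auto
qed

lemma finite_log_measure_UN_summable:
  fixes E :: "nat \<Rightarrow> real set"
  assumes "\<And>k. E k \<subseteq> {1..}" "\<And>k. E k \<in> sets lebesgue" "summable c" "\<And>k. 0 \<le> c k"
    and le: "\<And>k. (\<integral>\<^sup>+ r\<in>E k. ennreal (1 / r) \<partial>lebesgue) \<le> ennreal (c k)"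
  shows "finite_log_measure (\<Union>k. E k)"
proof -
  let ?M = "density lebesgue (\<lambda>r::real. ennreal (1 / r))"
  have meas: "(\<lambda>r::real. ennreal (1 / r)) \<in> borel_measurable lebesgue"
    by (intro measurable_completion) measurable
  have "emeasure ?M (\<Union>k. E k) \<le> (\<Sum>k. emeasure ?M (E k))"
    using assms(2) by (intro emeasure_subadditive_countably) auto
  also have "\<dots> \<le> (\<Sum>k. ennreal (c k))"
    using le assms(2) meas by (intro suminf_le summableI) (auto simp: emeasure_density)
  also have "\<dots> = ennreal (\<Sum>k. c k)"
    using assms(3,4) by (intro suminf_ennreal2) auto
  also have "\<dots> < \<infinity>" by simp
  finally show ?thesis using assms(1,2) by (auto simp: finite_log_measure_iff)
qed

text \<open>Measuring the distance from 1 by exp x - 1 makes x additive under products, since (e^x -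
  1) e^y + (e^y - 1) = e^(x+y) - 1.\<close>

lemma norm_mult_diff_one_le:
  fixes X Y :: complex
  assumes "cmod (X - 1) \<le> exp x - 1" "cmod (Y - 1) \<le> exp y - 1"
  shows "cmod (X * Y - 1) \<le> exp (x + y) - 1"
proof -
  have "cmod Y \<le> exp y" using norm_triangle_ineq[of "Y - 1" 1] assms(2) by simp
  moreover have "0 \<le> exp x - 1" using norm_ge_zero assms(1) by (rule order_trans)
  ultimately have "cmod (X - 1) * cmod Y \<le> (exp x - 1) * exp y"
    using assms(1) by (intro mult_mono) auto
  moreover have "X * Y - 1 = (X - 1) * Y + (Y - 1)" by (simp add: algebra_simps)
  then have "cmod (X * Y - 1) \<le> cmod (X - 1) * cmod Y + cmod (Y - 1)"
    by (metis norm_mult norm_triangle_ineq)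
  ultimately show ?thesis using assms(2) by (simp add: exp_add algebra_simps)
qed

lemma norm_exp_diff_one_le: "cmod (exp l - 1) \<le> exp (cmod l) - 1"
proof -
  have "(\<lambda>n. l ^ n /\<^sub>R fact n) sums exp l" by (rule exp_converges)
  from sums_split_initial_segment[OF this, of 1]
  have 1: "(\<lambda>n. l ^ Suc n /\<^sub>R fact (Suc n)) sums (exp l - 1)" by simp
  have "(\<lambda>n. cmod l ^ n /\<^sub>R fact n) sums exp (cmod l)" by (rule exp_converges)
  from sums_split_initial_segment[OF this, of 1]
  have 2: "(\<lambda>n. cmod l ^ Suc n /\<^sub>R fact (Suc n)) sums (exp (cmod l) - 1)" by simp
  show ?thesis
    using 1 2 by (rule norm_sums_le) (simp add: norm_mult norm_power norm_divide)
qed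

lemma norm_prod_diff_one_le:
  fixes b :: "'a \<Rightarrow> complex"
  assumes "finite S"
  shows "cmod ((\<Prod>a\<in>S. (1 + b a) ^ n a) - 1) \<le> exp (\<Sum>a\<in>S. real (n a) * cmod (b a)) - 1"
proof -
  have pow: "cmod ((1 + c) ^ m - 1) \<le> exp (real m * cmod c) - 1" for c m
  proof (induction m)
    case (Suc m)
    have "cmod ((1 + c) - 1) \<le> exp (cmod c) - 1"
      using exp_ge_add_one_self[of "cmod c"] unfolding add_diff_cancel_left' by linarith
    from norm_mult_diff_one_le[OF this Suc.IH] show ?case by (simp add: algebra_simps)
  qed simp
  show ?thesis using assms
  proof (induction S)
    case (insert a S)
    from norm_mult_diff_one_le[OF pow[of "b a" "n a"] insert.IH] insert.hyps show ?case by simp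
  qed simp
qed

text \<open>
  The summands are $1/\bigl|r - |a|\bigr|$ up to a factor 2 as long as
  $\bigl|r - |a|\bigr| \ge 1$, but they are bounded and have an elementary primitive.
\<close>

definition zero_proximity :: "(complex \<Rightarrow> complex) \<Rightarrow> real \<Rightarrow> real \<Rightarrow> real" where
  "zero_proximity g R r = (\<Sum>a\<in>zeros_in g R. real (zero_mult g a) / sqrt ((r - cmod a)\<^sup>2 + 1))"

text \<open>With the zeros a of modulus at most 32x split off, g(z+1)/g(z) is the product of the
  factors 1 + 1/(z - a), taken with multiplicity, times h(z+1)/h(z). The first part is controlled by
  the proximity, the second by \<open>zero_free_ratio\<close>, and both distances from 1 are
  combined in the exponent.\<close>

lemma fdiff_le_zero_proximity:
  assumes "entire g" "\<exists>z. g z \<noteq> 0" "0 < s" "growth_le s g"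
  shows "\<exists>B\<ge>0. \<forall>x\<ge>1. \<forall>z. x \<le> cmod z \<longrightarrow> cmod z \<le> 2 * x \<longrightarrow>
    zero_proximity g (32 * x) (cmod z) \<le> 1 / 2 \<longrightarrow>
    cmod (fdiff g z) \<le> (exp (2 * zero_proximity g (32 * x) (cmod z) + B * x powr (s - 1)) - 1) *
        cmod (g z)"
proof -
  obtain A where A: "A \<ge> 0"
    "\<And>z R. 1 \<le> R \<Longrightarrow> cmod z \<le> 8 * R \<Longrightarrow> cmod (g z) \<le> exp (A * R powr s)"
    using growth_le_cball[OF assms(3,4)] by blast
  obtain z0 where z0: "g z0 \<noteq> 0" "cmod z0 \<le> 1"
    using entire_nonzero_near_0[OF assms(1,2)] by blast
  \<comment> \<open>The logarithm pays for the division by |g(z0)|; the 1 makes the comparison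
    strict, as \<open>zero_free_ratio\<close> demands, and keeps M positive.\<close>
  define D where "D = \<bar>ln (cmod (g z0))\<bar> + 1"
  \<comment> \<open>From 8M/rho with M <= (A 32^s + D) x^s and rho >= x.\<close>
  define B where "B = 8 * (A * 32 powr s + D)"
  have "D \<ge> 1" by (simp add: D_def)
  have "B \<ge> 0" using A(1) \<open>D \<ge> 1\<close> by (simp add: B_def)
  have "cmod (fdiff g z) \<le> (exp (2 * zero_proximity g (32 * x) (cmod z) + B * x powr (s - 1)) - 1)
      * cmod (g z)"
    if x: "x \<ge> 1" and z: "x \<le> cmod z" "cmod z \<le> 2 * x"
      and prox: "zero_proximity g (32 * x) (cmod z) \<le> 1 / 2" for x z
  proof -
    \<comment> \<open>With R = 32x the radius R - 1 is at least 31x, so that z and z + 1, at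
      distance at most 2x + 2 <= 4x from \<open>z0\<close>, lie within a quarter of it.\<close>
    define R where "R = 32 * x"
    have R: "1 \<le> R" using x by (simp add: R_def)
    let ?S = "zeros_in g R"
    have fin: "finite ?S" using assms(1,2) by (rule finite_zeros_in)
    define M where "M = A * R powr s + D"
    define \<rho> where "\<rho> = R - 1"
    have "0 < M" using A(1) \<open>D \<ge> 1\<close> by (simp add: M_def add_nonneg_pos)
    have \<rho>: "31 * x \<le> \<rho>" "0 < \<rho>" using x by (auto simp: \<rho>_def R_def)
    obtain h where h: "entire h" "\<And>z. g z = (\<Prod>a\<in>?S. (z - a) ^ zero_mult g a) * h z"
      and h': "\<forall>z. cmod z \<le> R \<longrightarrow> h z \<noteq> 0 \<and>
        cmod (h z) * 2 ^ zero_count g R * cmod (g z0) \<le> exp (A * R powr s) * cmod (h z0)"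
      using zero_free_part[OF assms(1) z0 R A(2)[OF R]] by blast
    have in_R: "cmod w \<le> R" if "w \<in> ball z0 \<rho>" for w
      using that z0(2) norm_triangle_ineq[of "w - z0" z0]
      by (simp add: \<rho>_def dist_norm norm_minus_commute)
    have h_lt: "cmod (h w) < exp M * cmod (h z0)" if "w \<in> ball z0 \<rho>" for w
    proof -
      have "cmod (h w) * 1 * cmod (g z0) \<le> cmod (h w) * 2 ^ zero_count g R * cmod (g z0)"
        by (intro mult_right_mono mult_left_mono) auto
      also have "\<dots> \<le> exp (A * R powr s) * cmod (h z0)" using h' in_R[OF that] by blast
      also have "exp (A * R powr s) * cmod (h z0) < exp (M + ln (cmod (g z0))) * cmod (h z0)"
      proof (rule mult_strict_right_mono)
        show "exp (A * R powr s) < exp (M + ln (cmod (g z0)))" by (simp add: M_def D_def)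
        have "h z0 \<noteq> 0" using h' z0(2) R by force
        then show "0 < cmod (h z0)" by simp
      qed
      also have "\<dots> = exp M * cmod (h z0) * cmod (g z0)" using z0(1) by (simp add: exp_add)
      finally show ?thesis using z0(1) by simp
    qed
    obtain l where l: "h (z + 1) = h z * exp l" "cmod l \<le> 8 * M / \<rho> * cmod (z + 1 - z)"
    proof (rule zero_free_ratio[of h z0 \<rho> M z "z + 1"])
      show "h holomorphic_on ball z0 \<rho>"
        using h(1) unfolding entire_def by (rule holomorphic_on_subset) simp
      show "h w \<noteq> 0" if "w \<in> ball z0 \<rho>" for w using h' in_R[OF that] by blast
      have "cmod (z - z0) \<le> \<rho> / 4"
        using norm_triangle_ineq4[of z z0] z x \<rho>(1) z0(2) by simp
      then show "z \<in> cball z0 (\<rho> / 4)" by (simp add: dist_norm norm_minus_commute)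
      have "cmod (z + 1 - z0) \<le> \<rho> / 4"
        using norm_triangle_ineq4[of "z + 1" z0] norm_triangle_ineq[of z 1] z x \<rho>(1) z0(2) by simp
      then show "z + 1 \<in> cball z0 (\<rho> / 4)" by (simp add: dist_norm norm_minus_commute)
    qed (use \<open>0 < M\<close> \<rho>(2) h_lt in blast)+
    have l_le: "cmod l \<le> B * x powr (s - 1)"
    proof -
      have "1 \<le> x powr s" using x assms(3) by (intro ge_one_powr_ge_zero) auto
      then have "D * 1 \<le> D * x powr s" using \<open>D \<ge> 1\<close> by (intro mult_left_mono) auto
      then have "8 * M \<le> B * x powr s"
        by (simp add: M_def R_def B_def powr_mult algebra_simps)
      then have "8 * M / \<rho> \<le> B * x powr s / x"
        using \<rho> x \<open>0 < M\<close> by (intro frac_le) auto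
      also have "\<dots> = B * x powr (s - 1)" using x by (simp add: powr_diff)
      finally show ?thesis using l(2) by simp
    qed
    \<comment> \<open>Each single summand of the proximity is at most 1/2, so the square root is at
      least 2 and t^2 >= 3 for t = |z| - |a|. Thus z is not a zero, and sqrt(t^2 + 1) <= 2|t| <= 2|z
      - a|.\<close>
    have far: "z \<noteq> a \<and> 1 / cmod (z - a) \<le> 2 / sqrt ((cmod z - cmod a)\<^sup>2 + 1)" if a: "a \<in> ?S" for a
    proof -
      let ?t = "cmod z - cmod a"
      have "1 \<le> zero_mult g a"
        using zero_mult_eq_0_iff[OF assms(1,2), of a] a by (auto simp: zeros_in_def)
      then have "1 / sqrt (?t\<^sup>2 + 1) \<le> real (zero_mult g a) / sqrt (?t\<^sup>2 + 1)"
        by (intro divide_right_mono) auto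
      also have "\<dots> \<le> zero_proximity g R (cmod z)"
        unfolding zero_proximity_def using fin a by (intro member_le_sum) auto
      also have "\<dots> \<le> 1 / 2" using prox by (simp add: R_def)
      finally have "2 \<le> sqrt (?t\<^sup>2 + 1)"
        by (simp add: divide_le_eq add_nonneg_pos)
      then have "2\<^sup>2 \<le> (sqrt (?t\<^sup>2 + 1))\<^sup>2" by (rule power_mono) simp
      then have t: "3 \<le> ?t\<^sup>2" by simp
      have le: "\<bar>?t\<bar> \<le> cmod (z - a)" by (rule norm_triangle_ineq3)
      have "?t \<noteq> 0" using t by auto
      then have "0 < \<bar>?t\<bar>" by simp
      have "sqrt (?t\<^sup>2 + 1) \<le> sqrt (4 * ?t\<^sup>2)" using t by (intro real_sqrt_le_mono) simp
      also have "\<dots> = 2 * \<bar>?t\<bar>" by (simp add: real_sqrt_mult)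
      also have "\<dots> \<le> 2 * cmod (z - a)" using le by (rule mult_left_mono) simp
      finally have "sqrt (?t\<^sup>2 + 1) \<le> 2 * cmod (z - a)" .
      moreover have "0 < cmod (z - a)" using \<open>0 < \<bar>?t\<bar>\<close> le by (rule less_le_trans)
      moreover have "0 < sqrt (?t\<^sup>2 + 1)" by (simp add: add_nonneg_pos)
      ultimately show ?thesis by (auto simp: field_simps)
    qed
    define Q where "Q = (\<Prod>a\<in>?S. (1 + 1 / (z - a)) ^ zero_mult g a)"
    have "cmod (Q - 1) \<le> exp (\<Sum>a\<in>?S. real (zero_mult g a) * cmod (1 / (z - a))) - 1"
      unfolding Q_def using fin by (rule norm_prod_diff_one_le)
    from norm_mult_diff_one_le[OF this norm_exp_diff_one_le]
    have "cmod (Q * exp l - 1) \<le> exp ((\<Sum>a\<in>?S. real (zero_mult g a) * cmod (1 / (z - a))) + cmod l)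
        - 1" .
    also have "(\<Sum>a\<in>?S. real (zero_mult g a) * cmod (1 / (z - a)))
        \<le> (\<Sum>a\<in>?S. 2 * (real (zero_mult g a) / sqrt ((cmod z - cmod a)\<^sup>2 + 1)))"
    proof (rule sum_mono)
      fix a assume "a \<in> ?S"
      then have "real (zero_mult g a) * (1 / cmod (z - a))
          \<le> real (zero_mult g a) * (2 / sqrt ((cmod z - cmod a)\<^sup>2 + 1))"
        using far by (intro mult_left_mono) auto
      then show "real (zero_mult g a) * cmod (1 / (z - a))
          \<le> 2 * (real (zero_mult g a) / sqrt ((cmod z - cmod a)\<^sup>2 + 1))"
        by (simp add: norm_divide mult.commute)
    qed
    also have "\<dots> = 2 * zero_proximity g R (cmod z)"
      by (simp add: zero_proximity_def sum_distrib_left)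
    finally have Qbd: "cmod (Q * exp l - 1) \<le> exp (2 * zero_proximity g R (cmod z) + B * x powr (s
        - 1)) - 1"
      using l_le by (smt (verit) exp_le_cancel_iff)
    have "(\<Prod>a\<in>?S. (z + 1 - a) ^ zero_mult g a) = (\<Prod>a\<in>?S. (z - a) ^ zero_mult g a) * Q"
      unfolding Q_def prod.distrib[symmetric]
    proof (rule prod.cong[OF refl])
      fix a assume "a \<in> ?S"
      then have "z + 1 - a = (z - a) * (1 + 1 / (z - a))" using far by (simp add: field_simps)
      then show "(z + 1 - a) ^ zero_mult g a
          = (z - a) ^ zero_mult g a * (1 + 1 / (z - a)) ^ zero_mult g a"
        by (simp only: power_mult_distrib)
    qed
    then have "g (z + 1) = g z * (Q * exp l)"
      using h(2)[of "z + 1"] h(2)[of z] l(1) by simp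
    then have "fdiff g z = (Q * exp l - 1) * g z" by (simp add: fdiff_def algebra_simps)
    then show ?thesis using Qbd by (simp add: norm_mult R_def mult_right_mono)
  qed
  then show ?thesis using \<open>B \<ge> 0\<close> by blast
qed

section \<open>The exceptional radii\<close>

lemma zero_proximity_measurable [measurable]: "zero_proximity g R \<in> borel_measurable borel"
  unfolding zero_proximity_def by measurable

lemma zero_proximity_nonneg: "0 \<le> zero_proximity g R r"
  unfolding zero_proximity_def by (intro sum_nonneg divide_nonneg_nonneg) auto

lemma arsinh_le_ln: "0 \<le> (y::real) \<Longrightarrow> arsinh y \<le> ln (1 + 2 * y)"
proof -
  assume y: "0 \<le> y"
  have "sqrt (y\<^sup>2 + 1) \<le> y + 1"
    using y by (intro real_le_lsqrt) (auto simp: power2_sum)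
  then show ?thesis using y arsinh_real_aux[of y] unfolding arsinh_real_def
    by (subst ln_le_cancel_iff) auto
qed

text \<open>The primitive is a sum of arsinh (r - |a|). As both 2x - |a| and |a| - x are at most 32x
  and arsinh is odd, each zero contributes at most 2 arsinh (32x).\<close>

lemma zero_proximity_integral:
  assumes "entire g" "\<exists>z. g z \<noteq> 0" "1 \<le> x"
  shows "(\<integral>\<^sup>+ r\<in>{x..2 * x}. ennreal (zero_proximity g (32 * x) r) \<partial>lebesgue)
    \<le> ennreal (real (zero_count g (32 * x)) * (2 * ln (1 + 64 * x)))"
proof -
  let ?S = "zeros_in g (32 * x)"
  define P where "P r = (\<Sum>a\<in>?S. real (zero_mult g a) * arsinh (r - cmod a))" for r
  have "(\<integral>\<^sup>+ r\<in>{x..2 * x}. ennreal (zero_proximity g (32 * x) r) \<partial>lebesgue)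
      = (\<integral>\<^sup>+ r\<in>{x..2 * x}. ennreal (zero_proximity g (32 * x) r) \<partial>lborel)"
    by (rule nn_integral_completion)
  also have "\<dots> = ennreal (P (2 * x) - P x)"
  proof (rule nn_integral_FTC_Icc)
    fix r
    show "(P has_real_derivative zero_proximity g (32 * x) r) (at r)"
      unfolding P_def zero_proximity_def
    proof (rule DERIV_sum)
      fix a
      have "((\<lambda>r. arsinh (r - cmod a)) has_real_derivative 1 / sqrt ((r - cmod a)\<^sup>2 + 1) * 1)
          (at r)"
        by (rule DERIV_chain'[OF _ arsinh_real_has_field_derivative])
          (auto intro!: derivative_eq_intros)
      from DERIV_cmult[OF this, of "real (zero_mult g a)"]
      show "((\<lambda>r. real (zero_mult g a) * arsinh (r - cmod a)) has_real_derivative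
          real (zero_mult g a) / sqrt ((r - cmod a)\<^sup>2 + 1)) (at r)"
        by simp
    qed
  qed (use assms(3) zero_proximity_nonneg in \<open>auto\<close>)
  also have "P (2 * x) - P x \<le> real (zero_count g (32 * x)) * (2 * ln (1 + 64 * x))"
  proof -
    have "P (2 * x) - P x
        = (\<Sum>a\<in>?S. real (zero_mult g a) * (arsinh (2 * x - cmod a) - arsinh (x - cmod a)))"
      by (simp add: P_def sum_subtractf right_diff_distrib)
    also have "\<dots> \<le> (\<Sum>a\<in>?S. real (zero_mult g a) * (2 * ln (1 + 64 * x)))"
    proof (intro sum_mono mult_left_mono)
      fix a assume "a \<in> ?S"
      then have a: "cmod a \<le> 32 * x" by (simp add: zeros_in_def)
      have "arsinh (2 * x - cmod a) \<le> arsinh (32 * x)"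
      proof -
        have "\<not> 32 * x < 2 * x - cmod a" using norm_ge_zero[of a] assms(3) by linarith
        then show ?thesis using arsinh_less_iff_real linorder_not_less by blast
      qed
      moreover have "arsinh (cmod a - x) \<le> arsinh (32 * x)"
      proof -
        have "\<not> 32 * x < cmod a - x" using a assms(3) by linarith
        then show ?thesis using arsinh_less_iff_real linorder_not_less by blast
      qed
      moreover have "arsinh (x - cmod a) = - arsinh (cmod a - x)"
        using arsinh_minus_real[of "cmod a - x"] by simp
      moreover have "arsinh (32 * x) \<le> ln (1 + 64 * x)"
        using arsinh_le_ln[of "32 * x"] assms(3) by simp
      ultimately show "arsinh (2 * x - cmod a) - arsinh (x - cmod a) \<le> 2 * ln (1 + 64 * x)"
        by linarith
    qed simp
    also have "\<dots> = real (zero_count g (32 * x)) * (2 * ln (1 + 64 * x))"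
      by (simp add: zero_count_def sum_distrib_right)
    finally show ?thesis .
  qed
  finally show ?thesis by (simp add: ennreal_leI)
qed

text \<open>Chebyshev's inequality on the dyadic block at x = 2^k bounds the logarithmic measure by
  a constant times x^(s-t) ln x. Since s < t, this is summable over k.\<close>

lemma large_zero_proximity_finite_log_measure:
  assumes "entire g" "\<exists>z. g z \<noteq> 0" "0 < s" "growth_le s g" "s < t"
  shows "finite_log_measure (\<Union>k. {r \<in> {2 ^ k..2 * 2 ^ k}.
    zero_proximity g (32 * 2 ^ k) r > (2 ^ k) powr (t - 1)})" (is "finite_log_measure (\<Union>k. ?E k)")
proof -
  obtain C where C: "C \<ge> 0" "\<And>R. 1 \<le> R \<Longrightarrow> real (zero_count g R) \<le> C * R powr s"
    using zero_count_growth[OF assms(1-4)] by blast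
  define q where "q = 2 powr (s - t)"
  have q: "0 < q" "q < 1" using assms(5) by (auto simp: q_def powr_less_one)
  \<comment> \<open>The 14 comes from 2 ln(1 + 64x) <= 2(k + 7) ln 2 <= 14(k + 1), and 32^s from
    counting zeros up to 32x. The series is the derivative of a geometric one.\<close>
  define c where "c k = 14 * C * 32 powr s * (real (Suc k) * q ^ k)" for k
  show ?thesis
  proof (rule finite_log_measure_UN_summable[where c = c])
    show "summable c"
      using geometric_deriv_sums[of q] q unfolding c_def
      by (intro summable_mult) (auto simp: sums_iff)
    show "0 \<le> c k" for k using C(1) q(1) by (simp add: c_def)
    have pow1: "1 \<le> (2::real) ^ k" for k :: nat by (rule one_le_power) simp
    show "?E k \<subseteq> {1..}" for k
    proof
      fix r assume "r \<in> ?E k"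
      then have "2 ^ k \<le> r" by simp
      then show "r \<in> {1..}" using pow1[of k] by (simp add: order_trans[of 1 "2 ^ k" r])
    qed
    show "?E k \<in> sets lebesgue" for k
    proof -
      have "?E k \<in> sets borel" by measurable
      then show ?thesis by simp
    qed
    show "(\<integral>\<^sup>+ r\<in>?E k. ennreal (1 / r) \<partial>lebesgue) \<le> ennreal (c k)" for k
    proof -
      define x :: real where "x = 2 ^ k"
      have x: "1 \<le> x" using pow1 by (simp add: x_def)
      \<comment> \<open>The threshold in Chebyshev's inequality: on \<open>?E k\<close> the
        proximity exceeds \<theta>, while 1/r <= 1/x.\<close>
      define \<theta> where "\<theta> = x powr (t - 1)"
      have \<theta>: "\<theta> > 0" using x by (simp add: \<theta>_def)
      have "(\<integral>\<^sup>+ r\<in>?E k. ennreal (1 / r) \<partial>lebesgue)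
          \<le> (\<integral>\<^sup>+ r. ennreal (1 / (x * \<theta>)) * (ennreal (zero_proximity g (32 * x) r) * indicator
              {x..2 * x} r) \<partial>lebesgue)"
      proof (rule nn_integral_mono)
        fix r :: real
        show "ennreal (1 / r) * indicator (?E k) r
          \<le> ennreal (1 / (x * \<theta>)) * (ennreal (zero_proximity g (32 * x) r) * indicator {x..2 * x}
              r)"
        proof (cases "r \<in> ?E k")
          case True
          then have r: "r \<in> {x..2 * x}" "\<theta> < zero_proximity g (32 * x) r"
            by (auto simp: x_def \<theta>_def)
          have "1 / r \<le> 1 / x" using r x by (intro divide_left_mono) auto
          also have "\<dots> = 1 / (x * \<theta>) * \<theta>" using \<theta> by simp
          also have "\<dots> \<le> 1 / (x * \<theta>) * zero_proximity g (32 * x) r"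
            using r(2) \<theta> x by (intro mult_left_mono) auto
          finally have "ennreal (1 / r) \<le> ennreal (1 / (x * \<theta>) * zero_proximity g (32 * x) r)"
            by (rule ennreal_leI)
          then show ?thesis using r(1) True \<theta> x zero_proximity_nonneg[of g "32 * x" r]
            by (simp add: ennreal_mult del: times_divide_eq_left)
        qed simp
      qed
      also have "\<dots> = ennreal (1 / (x * \<theta>)) * (\<integral>\<^sup>+ r\<in>{x..2 * x}. ennreal (zero_proximity g (32 * x)
          r) \<partial>lebesgue)"
        by (intro nn_integral_cmult measurable_completion) measurable
      also have "\<dots> \<le> ennreal (1 / (x * \<theta>)) * ennreal (real (zero_count g (32 * x)) * (2 * ln (1 +
          64 * x)))"
        by (intro mult_left_mono zero_proximity_integral assms x) simp
      also have "\<dots> = ennreal (1 / (x * \<theta>) * (real (zero_count g (32 * x)) * (2 * ln (1 + 64 * x))))"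
        using x \<theta> by (intro ennreal_mult[symmetric]) auto
      also have "\<dots> \<le> ennreal (c k)"
      proof (rule ennreal_leI)
        have "2 ^ (k + 7) = 128 * x" by (simp add: x_def power_add)
        then have "ln (1 + 64 * x) \<le> ln (2 ^ (k + 7))"
          using x by (subst ln_le_cancel_iff) simp_all
        also have "\<dots> = real (k + 7) * ln 2" by (rule ln_realpow)
        also have "\<dots> \<le> real (k + 7) * 1" using ln_2_less_1 by (intro mult_left_mono) auto
        also have "\<dots> \<le> 7 * real (Suc k)" by simp
        finally have ln: "2 * ln (1 + 64 * x) \<le> 14 * real (Suc k)" by simp
        have n: "real (zero_count g (32 * x)) \<le> C * 32 powr s * x powr s"
          using C(2)[of "32 * x"] x by (simp add: powr_mult)
        have "real (zero_count g (32 * x)) * (2 * ln (1 + 64 * x))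
            \<le> (C * 32 powr s * x powr s) * (14 * real (Suc k))"
          using n ln x C(1) by (intro mult_mono n ln) auto
        then have "1 / (x * \<theta>) * (real (zero_count g (32 * x)) * (2 * ln (1 + 64 * x)))
            \<le> 1 / (x * \<theta>) * ((C * 32 powr s * x powr s) * (14 * real (Suc k)))"
          using x \<theta> by (intro mult_left_mono) auto
        also have "\<dots> = 14 * C * 32 powr s * (real (Suc k) * (x powr s / (x * \<theta>)))"
          by simp
        also have "x powr s / (x * \<theta>) = q ^ k"
        proof -
          have "x * \<theta> = x powr t"
            using x unfolding \<theta>_def by (simp add: powr_diff)
          then have "x powr s / (x * \<theta>) = x powr (s - t)" using x by (simp add: powr_diff)
          also have "\<dots> = (2 powr real k) powr (s - t)" by (simp add: x_def powr_realpow)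
          also have "\<dots> = q powr real k"
            by (simp add: q_def powr_powr mult.commute)
          also have "\<dots> = q ^ k" using q(1) by (simp add: powr_realpow)
          finally show ?thesis .
        qed
        finally show "1 / (x * \<theta>) * (real (zero_count g (32 * x)) * (2 * ln (1 + 64 * x))) \<le> c k"
          by (simp add: c_def)
      qed
      finally show ?thesis .
    qed
  qed
qed

lemma dyadic_bracket:
  assumes "1 \<le> (r::real)"
  obtains k where "2 ^ k \<le> r" "r < 2 * 2 ^ k"
proof -
  define k where "k = nat \<lfloor>log 2 r\<rfloor>"
  have 0: "0 \<le> log 2 r" using assms by (simp add: zero_le_log_cancel_iff)
  then have "real k \<le> log 2 r" "log 2 r < real k + 1"
    unfolding k_def by (auto simp: of_nat_nat floor_correct)
  then have "2 powr real k \<le> r" "r < 2 powr (real k + 1)"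
    using assms by (auto simp: le_log_iff log_less_iff)
  then show thesis using that[of k] by (simp add: powr_add powr_realpow)
qed

text \<open>An exponent t strictly between s and u splits the loss: the gap t - s makes the
  exceptional radii summable, and the gap u - t absorbs the constants for large r.\<close>

lemma fdiff_quotient_small:
  assumes "entire g" "0 < s" "growth_le s g" "s < u" "u < 1"
  obtains E where "finite_log_measure E"
    "\<And>z. 1 \<le> cmod z \<Longrightarrow> cmod z \<notin> E \<Longrightarrow> cmod (fdiff g z) \<le> cmod z powr (u - 1) * cmod (g z)"
proof (cases "\<exists>z. g z \<noteq> 0")
  \<comment> \<open>This case occurs: high differences of a polynomial vanish identically.\<close>
  case False
  then show ?thesis using that[of "{}"] by (auto simp: fdiff_def finite_log_measure_empty)
next
  case True
  define t where "t = (s + u) / 2"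
  have t: "s < t" "t < u" using assms(4) by (auto simp: t_def)
  obtain B where B: "B \<ge> 0"
    and Bbd: "\<forall>x\<ge>1. \<forall>z. x \<le> cmod z \<longrightarrow> cmod z \<le> 2 * x \<longrightarrow>
    zero_proximity g (32 * x) (cmod z) \<le> 1 / 2 \<longrightarrow>
    cmod (fdiff g z) \<le> (exp (2 * zero_proximity g (32 * x) (cmod z) + B * x powr (s - 1)) - 1) *
        cmod (g z)"
    using fdiff_le_zero_proximity[OF assms(1) True assms(2,3)] by blast
  \<comment> \<open>The factor 2 is from exp y <= 1 + 2y, the factor 2 + B from proximity and
    zero-free part together, and 2^(1-t) from the passage from x to r/2. Beyond \<open>r1\<close>
    one has D <= r^(u-t).\<close>
  define D where "D = 2 * (2 + B) * 2 powr (1 - t)"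
  have D: "D > 0" using B by (simp add: D_def)
  define r1 where "r1 = D powr (1 / (u - t))"
  define E where "E = {1..r1} \<union> (\<Union>k. {r \<in> {2 ^ k..2 * 2 ^ k}.
    zero_proximity g (32 * 2 ^ k) r > (2 ^ k) powr (t - 1)})"
  have "finite_log_measure E"
    unfolding E_def
    by (intro finite_log_measure_Un finite_log_measure_Icc
        large_zero_proximity_finite_log_measure[OF assms(1) True assms(2,3) t(1)])
  moreover have "cmod (fdiff g z) \<le> cmod z powr (u - 1) * cmod (g z)"
    if z: "1 \<le> cmod z" "cmod z \<notin> E" for z
  proof -
    define r where "r = cmod z"
    have r: "1 \<le> r" "r1 < r" using z by (auto simp: r_def E_def)
    obtain k where k: "2 ^ k \<le> r" "r < 2 * 2 ^ k" using dyadic_bracket[OF r(1)] by blast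
    define x :: real where "x = 2 ^ k"
    have x: "1 \<le> x" by (simp add: x_def)
    let ?p = "zero_proximity g (32 * x) r"
    have p: "?p \<le> x powr (t - 1)"
      using z(2) k by (force simp: E_def r_def x_def)
    define y where "y = 2 * ?p + B * x powr (s - 1)"
    have "y \<le> (2 + B) * x powr (t - 1)"
    proof -
      have "x powr (s - 1) \<le> x powr (t - 1)" using x t(1) by (intro powr_mono) auto
      then have "B * x powr (s - 1) \<le> B * x powr (t - 1)" using B by (rule mult_left_mono)
      then show ?thesis using p by (simp add: y_def algebra_simps)
    qed
    \<comment> \<open>The exponent t - 1 is negative and r/2 < x.\<close>
    also have "\<dots> \<le> (2 + B) * (r / 2) powr (t - 1)"
      using k x t assms(5) B by (intro mult_left_mono powr_mono2') (auto simp: x_def)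
    also have "(r / 2) powr (t - 1) = 2 powr (1 - t) * r powr (t - 1)"
    proof -
      have "(r / 2) powr (t - 1) = r powr (t - 1) / 2 powr (t - 1)"
        by (rule powr_divide)
      also have "\<dots> = r powr (t - 1) * 2 powr (- (t - 1))" by (simp only: powr_minus_divide) simp
      finally show ?thesis by (simp add: mult.commute)
    qed
    finally have "y \<le> (2 + B) * (2 powr (1 - t) * r powr (t - 1))" .
    then have "2 * y \<le> 2 * ((2 + B) * (2 powr (1 - t) * r powr (t - 1)))"
      by (intro mult_left_mono) auto
    then have y_le: "2 * y \<le> D * r powr (t - 1)" by (simp only: D_def mult.assoc)
    have "D = r1 powr (u - t)" using t D by (simp add: r1_def powr_powr)
    also have "\<dots> \<le> r powr (u - t)" using r t by (intro powr_mono2) (auto simp: r1_def)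
    finally have "D * r powr (t - 1) \<le> r powr (u - t) * r powr (t - 1)" by (intro mult_right_mono)
        auto
    also have "\<dots> = r powr (u - 1)" by (simp add: powr_add[symmetric])
    finally have y2: "2 * y \<le> r powr (u - 1)" using y_le by linarith
    also have "\<dots> \<le> r powr 0" using r(1) assms(5) by (intro powr_mono) auto
    finally have "y \<le> 1 / 2" using r by simp
    have "0 \<le> ?p" by (rule zero_proximity_nonneg)
    moreover have "0 \<le> B * x powr (s - 1)" using B by simp
    ultimately have "0 \<le> y" "?p \<le> 1 / 2" using \<open>y \<le> 1 / 2\<close> by (auto simp: y_def)
    then have "cmod (fdiff g z) \<le> (exp y - 1) * cmod (g z)"
      using Bbd x k by (auto simp: y_def r_def x_def)
    moreover have "exp y \<le> 1 + 2 * y"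
      using exp_bound_lemma[of y] \<open>0 \<le> y\<close> \<open>y \<le> 1 / 2\<close> by simp
    ultimately have "cmod (fdiff g z) \<le> (2 * y) * cmod (g z)"
      by (smt (verit) mult_right_mono norm_ge_zero)
    also have "\<dots> \<le> r powr (u - 1) * cmod (g z)" using y2 by (intro mult_right_mono) auto
    finally show ?thesis by (simp add: r_def)
  qed
  ultimately show thesis using that by blast
qed

text \<open>Each difference up to order n - 1 has its own exceptional set; off their finite union
  the one-step quotients multiply.\<close>

lemma fdiff_funpow_quotient_small:
  assumes "entire f" "0 < s" "growth_le s f" "s < u" "u < 1"
  obtains E where "finite_log_measure E"
    "\<And>z i. 1 \<le> cmod z \<Longrightarrow> cmod z \<notin> E \<Longrightarrow> i < n \<Longrightarrow>
      cmod ((fdiff ^^ i) f z) \<le> cmod z powr (real i * (u - 1)) * cmod (f z)"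
proof -
  have "\<exists>E. finite_log_measure E \<and> (\<forall>z. 1 \<le> cmod z \<longrightarrow> cmod z \<notin> E \<longrightarrow>
      cmod (fdiff ((fdiff ^^ i) f) z) \<le> cmod z powr (u - 1) * cmod ((fdiff ^^ i) f z))" for i
    using fdiff_quotient_small[OF entire_fdiff_funpow[OF assms(1)] assms(2)
        growth_le_fdiff_funpow[OF assms(2,3)] assms(4,5)] by metis
  then obtain E where E: "\<And>i. finite_log_measure (E i)" "\<And>i z. 1 \<le> cmod z \<Longrightarrow> cmod z \<notin> E i \<Longrightarrow>
      cmod (fdiff ((fdiff ^^ i) f) z) \<le> cmod z powr (u - 1) * cmod ((fdiff ^^ i) f z)"
    by metis
  show thesis
  proof (rule that)
    show "finite_log_measure (\<Union>i\<in>{..<n}. E i)" by (intro finite_log_measure_UN E) simp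
    fix z i assume z: "1 \<le> cmod z" "cmod z \<notin> (\<Union>i\<in>{..<n}. E i)" and "i < n"
    then show "cmod ((fdiff ^^ i) f z) \<le> cmod z powr (real i * (u - 1)) * cmod (f z)"
    proof (induction i)
      case 0
      then show ?case by auto
    next
      case (Suc i)
      have "cmod ((fdiff ^^ Suc i) f z) \<le> cmod z powr (u - 1) * cmod ((fdiff ^^ i) f z)"
        using E(2)[of z i] Suc.prems by auto
      also have "\<dots> \<le> cmod z powr (u - 1) * (cmod z powr (real i * (u - 1)) * cmod (f z))"
        using Suc by (intro mult_left_mono) auto
      also have "\<dots> = cmod z powr (real (Suc i) * (u - 1)) * cmod (f z)"
        by (simp add: powr_add[symmetric] algebra_simps)
      finally show ?case .
    qed
  qed
qed

section \<open>Consecutive zeros\<close>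

text \<open>If all differences vanished at w, then f would vanish at w, w + 1, w + 2, and so on.
  That is at least n zeros in a disc of radius about n, against the bound O(n^s) with s < 1.\<close>

lemma zero_imp_zero_of_length:
  assumes "entire f" "\<exists>z. f z \<noteq> 0" "growth_le s f" "0 < s" "s < 1" "f w = 0"
  shows "\<exists>n. zero_of_length f w n"
proof -
  have "\<exists>k. (fdiff ^^ k) f w \<noteq> 0"
  proof (rule ccontr)
    assume "\<nexists>k. (fdiff ^^ k) f w \<noteq> 0"
    then have all0: "(fdiff ^^ k) f w = 0" for k by blast
    \<comment> \<open>All orders k are treated at once, because one shift expresses the value of
      order k by those of orders k and k + 1.\<close>
    have "(fdiff ^^ k) f (w + of_nat j) = 0" for j k
    proof (induction j arbitrary: k)
      case 0
      then show ?case using all0 by simp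
    next
      case (Suc j)
      have "fdiff ((fdiff ^^ k) f) (w + of_nat j) = 0" using Suc[of "Suc k"] by simp
      then have "(fdiff ^^ k) f (w + of_nat j + 1) - (fdiff ^^ k) f (w + of_nat j) = 0"
        by (simp only: fdiff_def)
      then show ?case using Suc[of k] by (simp add: add.assoc add.commute[of 1])
    qed
    from this[of 0] have zero: "f (w + of_nat j) = 0" for j by simp
    obtain C where C: "C \<ge> 0" "\<And>R. 1 \<le> R \<Longrightarrow> real (zero_count f R) \<le> C * R powr s"
      using zero_count_growth[OF assms(1,2,4,3)] by blast
    define b where "b = 1 + cmod w"
    have "real n \<le> C * (b + real n) powr s" for n
    proof -
      have "card ((\<lambda>j. w + of_nat j) ` {..<n}) \<le> card (zeros_in f (b + real n))"
      proof (rule card_mono)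
        show "finite (zeros_in f (b + real n))" using assms(1,2) by (rule finite_zeros_in)
        show "(\<lambda>j. w + of_nat j) ` {..<n} \<subseteq> zeros_in f (b + real n)"
        proof safe
          fix j assume "j < n"
          then have "cmod (w + of_nat j) \<le> b + real n"
            using norm_triangle_ineq[of w "of_nat j"] by (simp add: b_def)
          then show "w + of_nat j \<in> zeros_in f (b + real n)" by (simp add: zeros_in_def zero)
        qed
      qed
      also have "card ((\<lambda>j. w + of_nat j) ` {..<n}) = n"
        by (subst card_image) (auto simp: inj_on_def)
      also have "card (zeros_in f (b + real n)) = (\<Sum>a\<in>zeros_in f (b + real n). 1)" by simp
      also have "\<dots> \<le> zero_count f (b + real n)"
        unfolding zero_count_def
      proof (rule sum_mono)
        fix a assume "a \<in> zeros_in f (b + real n)"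
        then show "1 \<le> zero_mult f a"
          using zero_mult_eq_0_iff[OF assms(1,2), of a] by (auto simp: zeros_in_def)
      qed
      finally have "real n \<le> real (zero_count f (b + real n))" by simp
      also have "\<dots> \<le> C * (b + real n) powr s" by (rule C(2)) (simp add: b_def)
      finally show ?thesis .
    qed
    moreover have "eventually (\<lambda>n. C * (b + real n) powr s < real n) sequentially"
    proof -
      have lim0: "((\<lambda>n. C * (b + real n) powr s / (b + real n)) \<longlongrightarrow> 0) sequentially"
      proof -
        have lim: "filterlim (\<lambda>n. b + real n) at_top sequentially"
          by (rule filterlim_tendsto_add_at_top[OF tendsto_const filterlim_real_sequentially])
        have "((\<lambda>n. C * (b + real n) powr (s - 1)) \<longlongrightarrow> C * 0) sequentially"
          using assms(5) by (intro tendsto_mult tendsto_const tendsto_neg_powr lim) auto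
        moreover have "C * (b + real n) powr (s - 1) = C * (b + real n) powr s / (b + real n)" for n
          by (simp add: powr_diff b_def)
        ultimately show ?thesis by simp
      qed
      have lim1: "((\<lambda>n. real n / (b + real n)) \<longlongrightarrow> 1) sequentially"
      proof -
        have lim: "filterlim (\<lambda>n. b + real n) at_infinity sequentially"
          by (rule filterlim_at_top_imp_at_infinity, rule filterlim_tendsto_add_at_top[OF
              tendsto_const filterlim_real_sequentially])
        have "((\<lambda>n. 1 - b / (b + real n)) \<longlongrightarrow> 1 - 0) sequentially"
          by (intro tendsto_diff tendsto_const tendsto_divide_0[OF tendsto_const lim])
        moreover have "1 - b / (b + real n) = real n / (b + real n)" for n
          by (simp add: field_simps b_def add_pos_nonneg add_nonneg_eq_0_iff)
        ultimately show ?thesis by simp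
      qed
      have "eventually (\<lambda>n. C * (b + real n) powr s / (b + real n) < 1 / 2) sequentially"
        by (rule order_tendstoD(2)[OF lim0]) simp
      moreover have "eventually (\<lambda>n. 1 / 2 < real n / (b + real n)) sequentially"
        by (rule order_tendstoD(1)[OF lim1]) simp
      ultimately show ?thesis
      proof eventually_elim
        case (elim n)
        then have elim: "C * (b + real n) powr s / (b + real n) < real n / (b + real n)" by linarith
        have "0 < b + real n" by (simp add: b_def add_pos_nonneg)
        then show ?case using elim by (simp add: divide_less_cancel)
      qed
    qed
    ultimately have "eventually (\<lambda>n::nat. False) sequentially"
      by (simp add: not_less[symmetric])
    then show False by simp
  qed
  then obtain n where "(fdiff ^^ n) f w \<noteq> 0" "\<forall>k<n. (fdiff ^^ k) f w = 0"
    using exists_least_iff[of "\<lambda>k. (fdiff ^^ k) f w \<noteq> 0"] by auto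
  moreover from this have "1 \<le> n" using assms(6) by (cases n) auto
  ultimately show ?thesis unfolding zero_of_length_def by blast
qed

text \<open>Zeros at w and w + 1 would give a common shifting divisor with m1 = n1 = 1, since (z -
  w)(z - w - 1) is the falling factorial of length 2 at w. The lengths m' and n' must exist for
  these choices to be admissible, which is where the growth is used.\<close>

lemma rel_shifting_prime_no_consecutive_zeros:
  assumes "entire f" "\<exists>z. f z \<noteq> 0" "growth_le s f" "entire g" "\<exists>z. g z \<noteq> 0" "growth_le s g"
    "0 < s" "s < 1" and prime: "rel_shifting_prime f g" and f0: "f w = 0"
  shows "g (w + 1) \<noteq> 0"
proof
  assume g0: "g (w + 1) = 0"
  obtain m' where m': "zero_of_length f w m'"
    using zero_imp_zero_of_length[OF assms(1-3,7,8) f0] by blast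
  obtain n' where n': "zero_of_length g (w + 1) n'"
    using zero_imp_zero_of_length[OF assms(4-8) g0] by blast
  have linear_factor: "\<exists>F. entire F \<and> (\<forall>z. p z = (z - a) * F z)"
    if p: "entire p" "\<exists>z. p z \<noteq> 0" and pa: "p a = 0" for p a
  proof -
    obtain h where h: "entire h" "\<And>z. p z = (z - a) ^ zero_mult p a * h z"
      using entire_factor_zero[OF p] by metis
    obtain j where j: "zero_mult p a = Suc j"
      using zero_mult_eq_0_iff[OF p] pa not0_implies_Suc by blast
    have "entire (\<lambda>z. (z - a) ^ j * h z)"
      using h(1) unfolding entire_def by (intro holomorphic_intros)
    then show ?thesis
      using h(2) j by (intro exI[of _ "\<lambda>z. (z - a) ^ j * h z"]) (simp add: mult.assoc)
  qed
  obtain F where F: "entire F" "\<forall>z. f z = (z - w) * F z"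
    using linear_factor[OF assms(1,2) f0] by blast
  obtain G where G: "entire G" "\<forall>z. g z = (z - (w + 1)) * G z"
    using linear_factor[OF assms(4,5) g0] by blast
  have ff1: "falling_fact x 1 = x" for x by (simp add: falling_fact_def)
  have ff2: "falling_fact x (1 + 1) = x * (x - 1)" for x
    by (simp add: falling_fact_def lessThan_Suc mult.commute)
  have Ff: "\<forall>z. f z = falling_fact (z - w) 1 * F z" unfolding ff1 by (rule F(2))
  have Gg: "\<forall>z. g z = falling_fact (z - (w + 1)) 1 * G z" unfolding ff1 by (rule G(2))
  have "\<forall>z. f z * g z = falling_fact (z - w) (1 + 1) * F z * G z"
  proof
    fix z
    have "f z * g z = ((z - w) * F z) * ((z - (w + 1)) * G z)"
      using F(2) G(2) by metis
    also have "\<dots> = falling_fact (z - w) (1 + 1) * F z * G z"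
      unfolding ff2 by (simp add: diff_diff_eq mult_ac)
    finally show "f z * g z = falling_fact (z - w) (1 + 1) * F z * G z" .
  qed
  moreover have "1 \<le> m'" "1 \<le> n'" using m' n' by (auto simp: zero_of_length_def)
  ultimately have "common_shifting_divisor f g w"
    unfolding common_shifting_divisor_def using m' n' F(1) G(1) Ff Gg
    by (intro exI[of _ w] exI[of _ "w + 1"] exI[of _ m'] exI[of _ n'] exI[of _ 1] exI[of _ F]
        exI[of _ G] conjI) (assumption | rule disjI1 refl order_refl)+
  then show False using prime unfolding rel_shifting_prime_def by blast
qed

text \<open>
  With $b$ the multiplicity of a zero, the first sum on the right bounds the zeros of the Casoratian
  from below, and the second one is $\overline{n}_\Delta$.
\<close>

lemma sum_run_lengths:
  fixes b :: "complex \<Rightarrow> nat"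
  assumes "finite S" "\<And>w. w \<notin> S \<Longrightarrow> b w = 0"
  shows "(\<Sum>w\<in>S. b w) \<le> (\<Sum>w\<in>S. Min ((\<lambda>i. b (w + of_nat i)) ` {..l})) + l * (\<Sum>w\<in>S. b w - b (w - 1))"
proof (induction l)
  case 0
  have "{..0::nat} = {0}" by auto
  then show ?case by simp
next
  case (Suc l)
  define \<beta> where "\<beta> l w = Min ((\<lambda>i. b (w + of_nat i)) ` {..l})" for l :: nat and w
  \<comment> \<open>The sum is shifted so that w + 1 runs through \<open>S\<close>. Points of
    \<open>S'\<close> outside \<open>S\<close> contribute nothing to the minima, as b vanishes
    there.\<close>
  define S' where "S' = (\<lambda>w. w - 1) ` S"
  have S': "finite S'" "S = (\<lambda>w. w + 1) ` S'" using assms(1) by (auto simp: S'_def image_image)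
  have inj: "inj_on (\<lambda>w::complex. w + 1) S'" by (simp add: inj_on_def)
  have \<beta>_Suc: "\<beta> (Suc l) w = min (b w) (\<beta> l (w + 1))" for w
  proof -
    have "(\<lambda>i. b (w + of_nat i)) ` {..Suc l} = insert (b w) ((\<lambda>i. b (w + 1 + of_nat i)) ` {..l})"
      unfolding atMost_Suc_eq_insert_0 by (simp add: image_image add.assoc)
    then show ?thesis unfolding \<beta>_def by (simp add: Min_insert)
  qed
  have "(\<Sum>w\<in>S. \<beta> l w) = (\<Sum>w\<in>S'. \<beta> l (w + 1))"
    by (subst S'(2)) (simp add: sum.reindex[OF inj])
  also have "\<dots> \<le> (\<Sum>w\<in>S'. \<beta> (Suc l) w + (b (w + 1) - b w))"
  proof (rule sum_mono)
    fix w
    \<comment> \<open>Prepending w to a window replaces its minimum by the minimum with b w. The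
      loss is at most b(w+1) - b(w), truncated at 0, because the old minimum is at most
      b(w+1).\<close>
    have "\<beta> l (w + 1) \<le> b (w + 1)"
      unfolding \<beta>_def by (rule Min_le) (auto intro!: image_eqI[of _ _ 0])
    then show "\<beta> l (w + 1) \<le> \<beta> (Suc l) w + (b (w + 1) - b w)" unfolding \<beta>_Suc by linarith
  qed
  also have "\<dots> = (\<Sum>w\<in>S'. \<beta> (Suc l) w) + (\<Sum>w\<in>S'. b (w + 1) - b w)" by (rule sum.distrib)
  also have "(\<Sum>w\<in>S'. b (w + 1) - b w) = (\<Sum>w\<in>S. b w - b (w - 1))"
    by (subst S'(2)) (simp add: sum.reindex[OF inj])
  also have "(\<Sum>w\<in>S'. \<beta> (Suc l) w) \<le> (\<Sum>w\<in>S. \<beta> (Suc l) w)"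
  proof -
    have "(\<Sum>w\<in>S'. \<beta> (Suc l) w) \<le> (\<Sum>w\<in>S' \<union> S. \<beta> (Suc l) w)"
      using S' assms(1) by (intro sum_mono2) auto
    also have "\<dots> = (\<Sum>w\<in>S. \<beta> (Suc l) w)"
      using S' assms by (intro sum.mono_neutral_right) (auto simp: \<beta>_Suc)
    finally show ?thesis .
  qed
  finally show ?case using Suc.IH unfolding \<beta>_def by simp
qed

section \<open>Casoratians\<close>

text \<open>Rows of shifts F_j(z + i) would have the same determinant by row operations, but with
  differences row i carries the i-th power of the small quotient.\<close>

definition casorati :: "nat \<Rightarrow> (nat \<Rightarrow> complex \<Rightarrow> complex) \<Rightarrow> complex \<Rightarrow> complex mat" where
  "casorati n F z = mat n n (\<lambda>(i, j). (fdiff ^^ i) (F j) z)"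

definition casoratian :: "nat \<Rightarrow> (nat \<Rightarrow> complex \<Rightarrow> complex) \<Rightarrow> complex \<Rightarrow> complex" where
  "casoratian n F z = Determinant.det (casorati n F z)"

lemma casorati_carrier [simp]: "casorati n F z \<in> carrier_mat n n"
  by (simp add: casorati_def)

lemma permutes_less:
  fixes p :: "nat \<Rightarrow> nat"
  assumes "p permutes {0..<n}" "i < n"
  shows "p i < n"
  using permutes_in_image[OF assms(1), of i] assms(2) by simp

lemma entire_det:
  assumes "\<And>i j. i < n \<Longrightarrow> j < n \<Longrightarrow> entire (\<lambda>z. M z i j)"
  shows "entire (\<lambda>z. Determinant.det (mat n n (\<lambda>(i, j). M z i j)))"
proof -
  have "Determinant.det (mat n n (\<lambda>(i, j). M z i j))
      = (\<Sum>p | p permutes {0..<n}. signof p * (\<Prod>i = 0..<n. M z i (p i)))" for z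
    by (subst det_def'[of _ n]) (auto intro!: sum.cong prod.cong simp: permutes_less)
  moreover have "entire (\<lambda>z. \<Sum>p | p permutes {0..<n}. signof p * (\<Prod>i = 0..<n. M z i (p i)))"
    using assms unfolding entire_def by (intro holomorphic_intros) (auto simp: permutes_less)
  ultimately show ?thesis by simp
qed

lemma entire_casoratian:
  assumes "\<And>j. j < n \<Longrightarrow> entire (F j)"
  shows "entire (casoratian n F)"
  unfolding casoratian_def[abs_def] casorati_def
  using assms by (intro entire_det entire_fdiff_funpow)

text \<open>Every Leibniz term takes one entry from each row, which collects all \<kappa> i, and one
  from each column, which collects all F j.\<close>

lemma norm_casoratian_le:
  assumes "\<And>i. i < n \<Longrightarrow> 0 \<le> \<kappa> i"
    and le: "\<And>i j. i < n \<Longrightarrow> j < n \<Longrightarrow> cmod ((fdiff ^^ i) (F j) z) \<le> \<kappa> i * cmod (F j z)"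
  shows "cmod (casoratian n F z) \<le> fact n * ((\<Prod>i<n. \<kappa> i) * (\<Prod>j<n. cmod (F j z)))"
proof -
  let ?P = "{p. p permutes {0..<n}}"
  have "casoratian n F z = (\<Sum>p\<in>?P. signof p * (\<Prod>i = 0..<n. (fdiff ^^ i) (F (p i)) z))"
    unfolding casoratian_def
    by (subst det_def'[OF casorati_carrier])
      (auto intro!: sum.cong prod.cong simp: permutes_less casorati_def)
  also have "cmod \<dots> \<le> (\<Sum>p\<in>?P. cmod (signof p * (\<Prod>i = 0..<n. (fdiff ^^ i) (F (p i)) z)))"
    by (rule norm_sum)
  also have "\<dots> \<le> (\<Sum>p\<in>?P. (\<Prod>i<n. \<kappa> i) * (\<Prod>j<n. cmod (F j z)))"
  proof (rule sum_mono)
    fix p assume "p \<in> ?P"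
    then have p: "p permutes {0..<n}" by simp
    have "cmod (signof p * (\<Prod>i = 0..<n. (fdiff ^^ i) (F (p i)) z))
        = (\<Prod>i = 0..<n. cmod ((fdiff ^^ i) (F (p i)) z))"
      by (simp add: norm_mult prod_norm sign_def)
    also have "\<dots> \<le> (\<Prod>i = 0..<n. \<kappa> i * cmod (F (p i) z))"
      using le p by (intro prod_mono) (auto simp: permutes_less)
    also have "\<dots> = (\<Prod>i = 0..<n. \<kappa> i) * (\<Prod>i = 0..<n. cmod (F (p i) z))"
      by (rule prod.distrib)
    also have "(\<Prod>i = 0..<n. cmod (F (p i) z)) = (\<Prod>i = 0..<n. cmod (F i z))"
      using prod.permute[OF p, of "\<lambda>j. cmod (F j z)"] by (simp add: o_def)
    finally show "cmod (signof p * (\<Prod>i = 0..<n. (fdiff ^^ i) (F (p i)) z))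
        \<le> (\<Prod>i<n. \<kappa> i) * (\<Prod>j<n. cmod (F j z))"
      by (simp add: atLeast0LessThan)
  qed
  also have "\<dots> = fact n * ((\<Prod>i<n. \<kappa> i) * (\<Prod>j<n. cmod (F j z)))"
    by (simp add: card_permutations)
  finally show ?thesis .
qed

lemma fdiff_funpow_sum:
  "(fdiff ^^ i) (\<lambda>z. \<Sum>j\<in>J. F j z) z = (\<Sum>j\<in>J. (fdiff ^^ i) (F j) z)"
proof (induction i arbitrary: z)
  case (Suc i)
  then show ?case by (simp add: fdiff_def[of "(fdiff ^^ i) _"] sum_subtractf)
qed simp

text \<open>The new column is the matrix times the all-ones vector, so by the lemma behind Cramer's
  rule the determinant is multiplied by a coordinate of that vector, which is 1.\<close>

lemma casoratian_replace_by_sum: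
  assumes "k < n"
  shows "casoratian n (F(k := (\<lambda>z. \<Sum>j<n. F j z))) z = casoratian n F z"
proof -
  let ?A = "casorati n F z" and ?x = "vec n (\<lambda>_. 1)"
  have "replace_col ?A (?A *\<^sub>v ?x) k = casorati n (F(k := (\<lambda>z. \<Sum>j<n. F j z))) z"
    by (rule eq_matI)
      (auto simp: replace_col_def casorati_def scalar_prod_def fdiff_funpow_sum atLeast0LessThan)
  moreover have "Determinant.det (replace_col ?A (?A *\<^sub>v ?x) k) = Matrix.vec_index ?x k *
      Determinant.det ?A"
    using assms by (intro cramer_lemma_mat) auto
  ultimately show ?thesis using assms by (simp add: casoratian_def)
qed

text \<open>Divisibility instead of a multiplicity: it makes sense for the zero function, which
  differences may become, and it is preserved by subtraction.\<close>

definition divisible_at :: "nat \<Rightarrow> complex \<Rightarrow> (complex \<Rightarrow> complex) \<Rightarrow> bool" where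
  "divisible_at N w g \<longleftrightarrow> (\<exists>H. entire H \<and> (\<forall>z. g z = (z - w) ^ N * H z))"

lemma divisible_at_diff:
  assumes "divisible_at N w f" "divisible_at N w g"
  shows "divisible_at N w (\<lambda>z. f z - g z)"
proof -
  obtain H K where "entire H" "\<forall>z. f z = (z - w) ^ N * H z" "entire K" "\<forall>z. g z = (z - w) ^ N * K z"
    using assms unfolding divisible_at_def by blast
  then show ?thesis unfolding divisible_at_def
    by (intro exI[of _ "\<lambda>z. H z - K z"])
      (auto simp: entire_def right_diff_distrib intro!: holomorphic_intros)
qed

text \<open>The i-th difference is a linear combination of the shifts by 0, ..., i.\<close>

lemma divisible_at_fdiff_funpow:
  assumes "\<And>j. j \<le> i \<Longrightarrow> divisible_at N w (\<lambda>z. g (z + of_nat j))"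
  shows "divisible_at N w ((fdiff ^^ i) g)"
  using assms
proof (induction i arbitrary: g)
  case 0
  then show ?case using 0[of 0] by simp
next
  case (Suc i)
  have "divisible_at N w (\<lambda>z. fdiff g (z + of_nat j))" if "j \<le> i" for j
  proof -
    have "divisible_at N w (\<lambda>z. g (z + of_nat (Suc j)) - g (z + of_nat j))"
      using that by (intro divisible_at_diff Suc.prems) auto
    then show ?thesis by (simp add: fdiff_def add_ac)
  qed
  then have "divisible_at N w ((fdiff ^^ i) (fdiff g))" by (rule Suc.IH)
  then show ?case by (simp add: funpow_swap1)
qed

lemma divisible_at_shift:
  assumes "entire g" "\<exists>z. g z \<noteq> 0" "N \<le> zero_mult g (w + c)"
  shows "divisible_at N w (\<lambda>z. g (z + c))"
proof -
  obtain h where h: "entire h" "\<And>z. g z = (z - (w + c)) ^ zero_mult g (w + c) * h z"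
    using entire_factor_zero[OF assms(1,2)] by metis
  let ?H = "\<lambda>z. (z - w) ^ (zero_mult g (w + c) - N) * h (z + c)"
  have "(h \<circ> (\<lambda>z. z + c)) holomorphic_on UNIV"
    using h(1) unfolding entire_def
    by (intro holomorphic_on_compose holomorphic_intros) (auto intro: holomorphic_on_subset)
  then have "entire ?H" unfolding entire_def o_def by (intro holomorphic_intros)
  moreover have "g (z + c) = (z - w) ^ N * ?H z" for z
  proof -
    have "g (z + c) = (z - w) ^ zero_mult g (w + c) * h (z + c)"
      using h(2)[of "z + c"] by simp
    also have "(z - w) ^ zero_mult g (w + c) = (z - w) ^ N * (z - w) ^ (zero_mult g (w + c) - N)"
      using assms(3) by (simp add: power_add[symmetric])
    finally show ?thesis by (simp only: mult.assoc)
  qed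
  ultimately show ?thesis unfolding divisible_at_def by blast
qed

lemma det_factor_column:
  assumes "k < n"
  shows "Determinant.det (mat n n (\<lambda>(i, j). if j = k then c * H i else A i j))
    = (c :: complex) * Determinant.det (mat n n (\<lambda>(i, j). if j = k then H i else A i j))"
proof -
  have expand: "Determinant.det (mat n n (\<lambda>(i, j). if j = k then h i else A i j))
      = (\<Sum>p | p permutes {0..<n}. signof p * (h (p k) * (\<Prod>j\<in>{..<n} - {k}. A (p j) j)))" for h
  proof -
    have "(\<Prod>j<n. mat n n (\<lambda>(i, j). if j = k then h i else A i j) $$ (p j, j))
        = h (p k) * (\<Prod>j\<in>{..<n} - {k}. A (p j) j)" if "p permutes {0..<n}" for p
    proof -
      have "(\<Prod>j<n. mat n n (\<lambda>(i, j). if j = k then h i else A i j) $$ (p j, j))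
          = (\<Prod>j<n. if j = k then h (p j) else A (p j) j)"
        using that by (intro prod.cong) (auto simp: permutes_less)
      also have "\<dots> = h (p k) * (\<Prod>j\<in>{..<n} - {k}. if j = k then h (p j) else A (p j) j)"
        using assms by (subst prod.remove[of _ k]) auto
      also have "(\<Prod>j\<in>{..<n} - {k}. if j = k then h (p j) else A (p j) j) = (\<Prod>j\<in>{..<n} - {k}. A (p
          j) j)"
        by (intro prod.cong) auto
      finally show ?thesis .
    qed
    then show ?thesis by (subst det_col[of _ n]) auto
  qed
  show ?thesis unfolding expand by (simp add: sum_distrib_left mult_ac)
qed

text \<open>The entries of column k involve only the shifts of F k by less than n, all divisible by
  (z - w)^N, so that this power comes out of the determinant.\<close>

lemma zero_mult_casoratian_ge:
  assumes "\<And>j. j < n \<Longrightarrow> entire (F j)" "k < n" "\<exists>z. F k z \<noteq> 0" "\<exists>z. casoratian n F z \<noteq> 0"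
    and N: "\<And>i. i < n \<Longrightarrow> N \<le> zero_mult (F k) (w + of_nat i)"
  shows "N \<le> zero_mult (casoratian n F) w"
proof -
  have "divisible_at N w ((fdiff ^^ i) (F k))" if "i < n" for i
    using that assms by (intro divisible_at_fdiff_funpow divisible_at_shift) auto
  then obtain H where H: "\<And>i. i < n \<Longrightarrow> entire (H i)"
    "\<And>i z. i < n \<Longrightarrow> (fdiff ^^ i) (F k) z = (z - w) ^ N * H i z"
    unfolding divisible_at_def by metis
  define D where "D z = Determinant.det (mat n n (\<lambda>(i, j). if j = k then H i z else (fdiff ^^ i)
      (F j) z))" for z
  have "entire D" unfolding D_def
  proof (rule entire_det)
    fix i j assume "i < n" "j < n"
    then show "entire (\<lambda>z. if j = k then H i z else (fdiff ^^ i) (F j) z)"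
      using H(1) entire_fdiff_funpow assms(1) by (cases "j = k") auto
  qed
  moreover have "casoratian n F z = (z - w) ^ N * D z" for z
  proof -
    have "casorati n F z = mat n n (\<lambda>(i, j). if j = k then (z - w) ^ N * H i z else (fdiff ^^ i)
        (F j) z)"
      unfolding casorati_def using H(2) by (intro eq_matI) auto
    then show ?thesis unfolding casoratian_def D_def by (simp only: det_factor_column[OF assms(2)])
  qed
  ultimately show ?thesis using assms(4) by (rule zero_mult_geI)
qed

section \<open>A vanishing Casoratian forces linear dependence over the periodic functions\<close>

lemma mat_delete_casorati:
  "mat_delete (casorati (Suc l) F z) l l = casorati l F z"
  by (rule eq_matI) (auto simp: mat_delete_def casorati_def)

lemma entire_cofactor_casorati:
  assumes "\<And>j. j \<le> l \<Longrightarrow> entire (F j)"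
  shows "entire (\<lambda>z. cofactor (casorati (Suc l) F z) l i)"
proof -
  have "mat_delete (casorati (Suc l) F z) l i
      = mat l l (\<lambda>(i', j'). (fdiff ^^ i') (F (if j' < i then j' else Suc j')) z)" for z
    by (rule eq_matI) (auto simp: mat_delete_def casorati_def)
  moreover have "entire (\<lambda>z. Determinant.det
      (mat l l (\<lambda>(i', j'). (fdiff ^^ i') (F (if j' < i then j' else Suc j')) z)))"
    using assms by (intro entire_det entire_fdiff_funpow) auto
  ultimately show ?thesis
    unfolding cofactor_def entire_def by (auto intro!: holomorphic_intros)
qed

text \<open>Entry (j, l) of A adj(A) = det(A) I = 0: the cofactors of the last row annihilate every
  row.\<close>

lemma cofactor_relation:
  assumes "casoratian (Suc l) F z = 0" "j \<le> l"
  shows "(\<Sum>i\<le>l. cofactor (casorati (Suc l) F z) l i * (fdiff ^^ j) (F i) z) = 0"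
proof -
  let ?A = "casorati (Suc l) F z"
  have "(?A * adj_mat ?A) $$ (j, l) = (Determinant.det ?A \<cdot>\<^sub>m 1\<^sub>m (Suc l)) $$ (j, l)"
    using adj_mat(2)[OF casorati_carrier] by simp
  moreover have "Determinant.det ?A = 0" using assms(1) by (simp add: casoratian_def)
  ultimately have "(?A * adj_mat ?A) $$ (j, l) = 0" using assms(2) by simp
  moreover have "(?A * adj_mat ?A) $$ (j, l)
      = (\<Sum>i<Suc l. (fdiff ^^ j) (F i) z * cofactor ?A l i)"
    using assms(2) by (simp add: adj_mat_def scalar_prod_def casorati_def atLeast0LessThan)
  ultimately show ?thesis by (simp add: lessThan_Suc_atMost mult.commute)
qed

lemma casorati_kernel_trivial:
  assumes "casoratian l F z \<noteq> 0" "\<And>j. j < l \<Longrightarrow> (\<Sum>i<l. x i * (fdiff ^^ j) (F i) z) = 0" "i < l"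
  shows "x i = 0"
proof -
  let ?A = "casorati l F z" and ?x = "Matrix.vec l x"
  have "?A *\<^sub>v ?x = 0\<^sub>v l"
    by (rule eq_vecI) (use assms(2) in \<open>auto simp: casorati_def scalar_prod_def atLeast0LessThan
        mult.commute\<close>)
  moreover have "?x \<in> carrier_vec l" by simp
  ultimately have "?x = 0\<^sub>v l"
    using det_0_iff_vec_prod_zero[OF casorati_carrier, of l F z] assms(1)
    unfolding casoratian_def by blast
  then have "Matrix.vec_index ?x i = Matrix.vec_index (0\<^sub>v l) i" by simp
  then show ?thesis using assms(3) by simp
qed

lemma fdiff_funpow_shift: "(fdiff ^^ j) f (z + 1) = (fdiff ^^ Suc j) f z + (fdiff ^^ j) f z"
  by (simp add: fdiff_def[of "(fdiff ^^ j) f"])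

text \<open>The quotients at z and those at z + 1 both satisfy the relations of orders below l at z
  + 1: for z this uses the relations up to order l at z and the shift rule. Both end with coordinate
  1, so their difference lies in the kernel of the smaller Casorati matrix at z + 1, which is
  invertible.\<close>

lemma cofactor_quotient_periodic:
  assumes zero: "\<And>z. casoratian (Suc l) F z = 0"
    and nz: "casoratian l F z \<noteq> 0" "casoratian l F (z + 1) \<noteq> 0" and "i \<le> l"
  shows "cofactor (casorati (Suc l) F (z + 1)) l i / casoratian l F (z + 1)
    = cofactor (casorati (Suc l) F z) l i / casoratian l F z"
proof -
  define p where "p i z = cofactor (casorati (Suc l) F z) l i / casoratian l F z" for i z
  have rel: "(\<Sum>i\<le>l. p i z * (fdiff ^^ j) (F i) z) = 0" if "j \<le> l" for j z
  proof -
    have "(\<Sum>i\<le>l. p i z * (fdiff ^^ j) (F i) z)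
        = (\<Sum>i\<le>l. cofactor (casorati (Suc l) F z) l i * (fdiff ^^ j) (F i) z) / casoratian l F z"
      by (simp add: p_def sum_divide_distrib)
    then show ?thesis using cofactor_relation[OF zero that] by simp
  qed
  have last: "p l z = 1" if "casoratian l F z \<noteq> 0" for z
    using that by (simp add: p_def cofactor_def mat_delete_casorati casoratian_def)
  define x where "x i = p i (z + 1) - p i z" for i
  have x_last: "x l = 0" using last nz by (simp add: x_def)
  have "(\<Sum>i<l. x i * (fdiff ^^ j) (F i) (z + 1)) = 0" if j: "j < l" for j
  proof -
    have "(\<Sum>i\<le>l. p i z * (fdiff ^^ j) (F i) (z + 1))
        = (\<Sum>i\<le>l. p i z * (fdiff ^^ Suc j) (F i) z) + (\<Sum>i\<le>l. p i z * (fdiff ^^ j) (F i) z)"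
      unfolding fdiff_funpow_shift by (simp only: distrib_left sum.distrib)
    also have "\<dots> = 0" using rel[of "Suc j" z] rel[of j z] j by simp
    finally have "(\<Sum>i\<le>l. x i * (fdiff ^^ j) (F i) (z + 1)) = 0"
      using rel[of j "z + 1"] j by (simp add: x_def left_diff_distrib sum_subtractf)
    then show ?thesis by (simp add: x_last lessThan_Suc_atMost[symmetric])
  qed
  then have "x i = 0" if "i < l" for i
    using casorati_kernel_trivial[OF nz(2)] that by blast
  then have "x i = 0" using x_last \<open>i \<le> l\<close> by (cases "i = l") auto
  then show ?thesis by (simp add: x_def p_def)
qed

lemma entire_shift: "entire f \<Longrightarrow> entire (\<lambda>z. f (c + z))"
proof -
  assume "entire f"
  then have "(f \<circ> (\<lambda>z. c + z)) holomorphic_on UNIV" unfolding entire_def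
    by (intro holomorphic_on_compose holomorphic_intros) (auto intro: holomorphic_on_subset)
  then show ?thesis by (simp add: entire_def o_def)
qed

lemma casoratian_nonzero:
  assumes ent: "\<And>j. j < m \<Longrightarrow> entire (F j)" and indep: "lin_indep_over_periodic {..<m} F"
  shows "\<exists>z. casoratian m F z \<noteq> 0"
proof (rule ccontr)
  assume "\<nexists>z. casoratian m F z \<noteq> 0"
  then have "\<forall>z. casoratian m F z = 0" by blast
  \<comment> \<open>For the least $k$ with vanishing Casoratian, the cofactors of its last row, normalised by the
    last of them, form the only solution of a linear system that is invariant under the shift.\<close>
  define k where "k = (LEAST k. \<forall>z. casoratian k F z = 0)"
  from \<open>\<forall>z. casoratian m F z = 0\<close> have k: "\<forall>z. casoratian k F z = 0" "k \<le> m"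
    unfolding k_def by (rule LeastI, rule Least_le)
  have k_min: "\<not> (\<forall>z. casoratian i F z = 0)" if "i < k" for i
    using that unfolding k_def by (rule not_less_Least)
  \<comment> \<open>The empty determinant is 1, so the least k is a successor and its predecessor
    has a nonvanishing Casoratian.\<close>
  have "casoratian 0 F z = 1" for z
    unfolding casoratian_def using det_dim_zero[OF casorati_carrier] .
  then have "k \<noteq> 0" using k(1) by (metis zero_neq_one)
  then obtain l where l: "k = Suc l" using not0_implies_Suc by blast
  have zero: "casoratian (Suc l) F z = 0" for z using k(1) l by simp
  obtain z0 where z0: "casoratian l F z0 \<noteq> 0" using k_min[of l] l by blast
  define q where "q = casoratian l F"
  define c where "c i z = cofactor (casorati (Suc l) F z) l i" for i z
  have q: "entire q" "\<exists>z. q z \<noteq> 0"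
  proof -
    show "entire q" unfolding q_def by (rule entire_casoratian) (use ent k(2) l in simp)
    show "\<exists>z. q z \<noteq> 0" using z0 unfolding q_def by (rule exI)
  qed
  have c: "entire (c i)" for i
    unfolding c_def using ent k(2) l by (intro entire_cofactor_casorati) auto
  \<comment> \<open>Coefficients must be canonical versions, hence \<open>remove_sings\<close>; the
    functions beyond index l get coefficient 0.\<close>
  define p where "p i = (if i \<le> l then remove_sings (\<lambda>z. c i z / q z) else (\<lambda>_. 0))" for i
  have mero: "(\<lambda>z. c i z / q z) meromorphic_on UNIV" for i
    using entire_analytic[OF c] entire_analytic[OF q(1)]
    by (intro meromorphic_intros analytic_on_imp_meromorphic_on)
  have "periodic_meromorphic (p i)" for i
  proof (cases "i \<le> l")
    case False
    then show ?thesis by (auto simp: periodic_meromorphic_def p_def)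
  next
    case True
    have "remove_sings (\<lambda>z. c i z / q z) (z + 1) = remove_sings (\<lambda>z. c i z / q z) z" for z
    proof -
      \<comment> \<open>Periodicity of the quotients needs q nonzero at both points. This holds in
        punctured neighbourhoods, and these determine the values of
        \<open>remove_sings\<close>.\<close>
      have near: "\<forall>\<^sub>F w in at 0. q (a + w) \<noteq> 0" for a
      proof (rule entire_eventually_nonzero)
        show "entire (\<lambda>w. q (a + w))" using q(1) by (rule entire_shift)
        show "\<exists>w. q (a + w) \<noteq> 0" using z0 by (intro exI[of _ "z0 - a"]) (simp add: q_def)
      qed
      from near[of z] near[of "z + 1"]
      have "\<forall>\<^sub>F w in at 0. c i (z + 1 + w) / q (z + 1 + w) = c i (z + w) / q (z + w)"
      proof eventually_elim
        case (elim w)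
        then show ?case
          using cofactor_quotient_periodic[of l F "z + w" i] zero True
          by (simp add: c_def q_def add_ac)
      qed
      then have "remove_sings (\<lambda>w. c i (z + 1 + w) / q (z + 1 + w)) 0
          = remove_sings (\<lambda>w. c i (z + w) / q (z + w)) 0"
        by (rule remove_sings_cong) simp
      then show ?thesis
        using remove_sings_shift_0[of "\<lambda>z. c i z / q z" "z + 1"]
          remove_sings_shift_0[of "\<lambda>z. c i z / q z" z] by simp
    qed
    then show ?thesis
      using True remove_sings_nicely_meromorphic[OF mero] by (auto simp: periodic_meromorphic_def
          p_def)
  qed
  moreover have "\<forall>\<^sub>\<approx>z\<in>UNIV. (\<Sum>i<m. p i z * F i z) = 0"
  proof -
    have "\<forall>\<^sub>\<approx>z\<in>UNIV. \<forall>i\<in>{..l}. remove_sings (\<lambda>z. c i z / q z) z = c i z / q z"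
      by (intro eventually_ball_finite ballI eventually_remove_sings_eq mero) simp
    then show ?thesis
    proof eventually_elim
      case (elim z)
      have "(\<Sum>i<m. p i z * F i z) = (\<Sum>i\<le>l. p i z * F i z)"
        using k(2) l by (intro sum.mono_neutral_right) (auto simp: p_def)
      also have "\<dots> = (\<Sum>i\<le>l. c i z * F i z / q z)" using elim by (intro sum.cong) (auto simp: p_def)
      also have "\<dots> = (\<Sum>i\<le>l. c i z * F i z) / q z" by (simp add: sum_divide_distrib)
      also have "(\<Sum>i\<le>l. c i z * F i z) = 0"
        using cofactor_relation[of l F z 0] zero by (simp add: c_def)
      finally show ?case by simp
    qed
  qed
  ultimately have "\<forall>i\<in>{..<m}. \<forall>z. p i z = 0"
    using indep[unfolded lin_indep_over_periodic_def, THEN spec, of p] by blast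
  then have "p l z0 = 0" using k(2) l by simp
  \<comment> \<open>The corner cofactor is the smaller Casoratian itself, so the dependence found is
    not trivial.\<close>
  moreover have "p l z0 = 1"
  proof -
    have "c l = q"
      by (auto simp: c_def q_def cofactor_def mat_delete_casorati casoratian_def fun_eq_iff)
    then have "\<forall>\<^sub>F z in at z0. c l z / q z = 1"
      using entire_eventually_nonzero[OF q] by (auto elim: eventually_mono)
    then have "remove_sings (\<lambda>z. c l z / q z) z0 = remove_sings (\<lambda>_. 1) z0"
      by (rule remove_sings_cong) simp
    then show ?thesis by (simp add: p_def)
  qed
  ultimately show False by simp
qed

section \<open>The Jensen formula\<close>

text \<open>The mean value property of the harmonic function ln |h| = Re L, obtained from the Cauchy
  integral formula for L.\<close>

lemma has_integral_ln_norm_circle: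
  assumes "h holomorphic_on ball 0 \<rho>" "\<And>z. z \<in> ball 0 \<rho> \<Longrightarrow> h z \<noteq> 0" "0 < r" "r < \<rho>"
  shows "((\<lambda>\<theta>. ln (cmod (h (rcis r \<theta>)))) has_integral (2 * pi * ln (cmod (h 0)))) {0..2 * pi}"
proof -
  obtain L where L: "L holomorphic_on ball 0 \<rho>" "\<And>z. z \<in> ball 0 \<rho> \<Longrightarrow> h z = exp (L z)"
    using contractible_imp_holomorphic_log[OF assms(1) convex_imp_contractible[OF convex_ball]
        assms(2)]
    by blast
  have ln_h: "ln (cmod (h z)) = Re (L z)" if "z \<in> ball 0 \<rho>" for z
    using L(2)[OF that] by (simp add: norm_exp_eq_Re)
  have "((\<lambda>u. L u / (u - 0)) has_contour_integral (2 * of_real pi * \<i> * L 0)) (circlepath 0 r)"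
  proof (rule Cauchy_integral_circlepath)
    show "continuous_on (cball 0 r) L"
      using assms(4) by (intro continuous_on_subset[OF holomorphic_on_imp_continuous_on[OF L(1)]])
          auto
    show "L holomorphic_on ball 0 r" using L(1) by (rule holomorphic_on_subset) (use assms(4) in
        auto)
    show "cmod (0 - 0) < r" using assms(3) by simp
  qed
  then have "((\<lambda>t. L (rcis r t) / rcis r t * of_real r * \<i> * cis t) has_integral (2 * of_real pi *
      \<i> * L 0)) {0..2 * pi}"
    by (simp add: circlepath_def has_contour_integral_part_circlepath_iff rcis_def)
  then have "((\<lambda>t. \<i> * L (rcis r t)) has_integral (2 * of_real pi * \<i> * L 0)) {0..2 * pi}"
    using assms(3) by (simp add: rcis_def mult_ac)
  from has_integral_linear[OF this bounded_linear_compose[OF bounded_linear_Im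
      bounded_linear_ident]]
  have "((\<lambda>t. Re (L (rcis r t))) has_integral (2 * pi * Re (L 0))) {0..2 * pi}"
    by (simp add: o_def)
  moreover have "Re (L (rcis r t)) = ln (cmod (h (rcis r t)))" for t
    using assms(3,4) by (intro ln_h[symmetric]) simp
  moreover have "Re (L 0) = ln (cmod (h 0))" using assms(3,4) by (intro ln_h[symmetric]) simp
  ultimately show ?thesis by simp
qed

text \<open>On the circle |z| = r the modulus of z - a equals that of r - conj(a) z / r. The latter
  has no zero in the closed disc and takes the value r at 0.\<close>

lemma has_integral_ln_norm_linear_circle:
  assumes "cmod a < r"
  shows "((\<lambda>\<theta>. ln (cmod (rcis r \<theta> - a))) has_integral (2 * pi * ln r)) {0..2 * pi}"
proof -
  have r: "0 < r" using assms norm_ge_zero[of a] by linarith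
  define h where "h z = of_real r - cnj a * z / of_real r" for z
  \<comment> \<open>A radius with r < \<rho> and |a| \<rho> < r^2, written so that a = 0 is
    included.\<close>
  define \<rho> where "\<rho> = 2 * r\<^sup>2 / (cmod a + r)"
  have "((\<lambda>\<theta>. ln (cmod (h (rcis r \<theta>)))) has_integral (2 * pi * ln (cmod (h 0)))) {0..2 * pi}"
  proof (rule has_integral_ln_norm_circle[where \<rho> = \<rho>])
    show "h holomorphic_on ball 0 \<rho>" unfolding h_def using r by (auto intro!: holomorphic_intros)
    show "r < \<rho>" using assms r by (simp add: \<rho>_def pos_less_divide_eq add_nonneg_pos
        power2_eq_square)
    show "h z \<noteq> 0" if "z \<in> ball 0 \<rho>" for z
    proof
      assume "h z = 0"
      then have "cnj a * z = (of_real r)\<^sup>2" using r by (simp add: h_def field_simps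
          power2_eq_square)
      then have "cmod (cnj a * z) = r\<^sup>2" by (simp add: norm_power)
      then have "r\<^sup>2 = cmod a * cmod z" by (simp add: norm_mult)
      also have "\<dots> \<le> cmod a * \<rho>" using that by (intro mult_left_mono) auto
      also have "\<dots> = r\<^sup>2 * (2 * cmod a / (cmod a + r))" by (simp add: \<rho>_def)
      also have "\<dots> < r\<^sup>2 * 1"
        using assms r by (intro mult_strict_left_mono) (auto simp: pos_divide_less_eq
            add_nonneg_pos)
      finally show False by simp
    qed
  qed fact
  moreover have "cmod (h (rcis r \<theta>)) = cmod (rcis r \<theta> - a)" for \<theta>
  proof -
    have "cmod (h (rcis r \<theta>)) = cmod (of_real r - cnj a * cis \<theta>)"
      using r by (simp add: h_def rcis_def)
    also have "\<dots> = cmod (cnj (of_real r - cnj a * cis \<theta>))" by (simp only: complex_mod_cnj)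
    also have "\<dots> = cmod (cis \<theta> * (of_real r - a * cis (- \<theta>)))"
      by (simp add: norm_mult cis_cnj)
    also have "cis \<theta> * (of_real r - a * cis (- \<theta>)) = rcis r \<theta> - a"
      by (simp add: rcis_def algebra_simps cis_mult)
    finally show ?thesis .
  qed
  ultimately show ?thesis using r by (simp add: h_def)
qed

lemma has_integral_ln_norm_factored_circle:
  assumes "finite S" "entire h" "\<And>z. F z = (\<Prod>a\<in>S. (z - a) ^ n a) * h z"
    and S: "\<And>a. a \<in> S \<Longrightarrow> cmod a < r" and nz: "\<And>z. cmod z \<le> r \<Longrightarrow> h z \<noteq> 0" and "0 < r"
  shows "((\<lambda>\<theta>. ln (cmod (F (rcis r \<theta>)))) has_integral
    (2 * pi * (ln (cmod (h 0)) + (\<Sum>a\<in>S. real (n a) * ln r)))) {0..2 * pi}"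
proof -
  \<comment> \<open>The mean value property is stated on a larger open disc; by compactness
    \<open>h\<close> stays zero-free a little beyond radius r.\<close>
  have "open {z. h z \<noteq> 0}"
    using entire_continuous_on[OF assms(2), of UNIV] by (intro open_Collect_neq continuous_intros)
  then obtain e where e: "e > 0" "(\<Union>x\<in>cball 0 r. ball x e) \<subseteq> {z. h z \<noteq> 0}"
    using nz by (elim compact_subset_open_imp_ball_epsilon_subset[OF compact_cball]) auto
  have nz': "h z \<noteq> 0" if "z \<in> ball 0 (r + e)" for z
  proof (cases "cmod z \<le> r")
    case False
    \<comment> \<open>The radial projection of z to the circle of radius r, at distance |z| - r <
      e.\<close>
    define x where "x = of_real (r / cmod z) * z"
    have "cmod x = r" using False assms(6) by (auto simp: x_def norm_mult norm_divide)
    have "z \<noteq> 0" using False assms(6) by auto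
    have "x - z = of_real (r / cmod z - 1) * z" by (simp add: x_def algebra_simps)
    then have "cmod (x - z) = \<bar>r / cmod z - 1\<bar> * cmod z" by (simp only: norm_mult norm_of_real)
    also have "\<dots> = (1 - r / cmod z) * cmod z" using False \<open>z \<noteq> 0\<close> by (simp add: field_simps)
    also have "\<dots> = cmod z - r" using \<open>z \<noteq> 0\<close> by (simp add: field_simps)
    finally have "z \<in> ball x e" using that by (simp add: dist_norm)
    moreover have "x \<in> cball 0 r" using \<open>cmod x = r\<close> by simp
    ultimately show ?thesis using e(2) by blast
  qed (use nz in blast)
  have "((\<lambda>\<theta>. ln (cmod (h (rcis r \<theta>)))) has_integral (2 * pi * ln (cmod (h 0)))) {0..2 * pi}"
    using assms(2,6) e(1) nz'
    by (intro has_integral_ln_norm_circle[where \<rho> = "r + e"])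
      (auto simp: entire_def intro: holomorphic_on_subset)
  moreover have "((\<lambda>\<theta>. \<Sum>a\<in>S. real (n a) * ln (cmod (rcis r \<theta> - a))) has_integral
      (\<Sum>a\<in>S. real (n a) * (2 * pi * ln r))) {0..2 * pi}"
    by (intro has_integral_sum assms(1) has_integral_mult_right has_integral_ln_norm_linear_circle
        S)
  ultimately have "((\<lambda>\<theta>. ln (cmod (h (rcis r \<theta>))) + (\<Sum>a\<in>S. real (n a) * ln (cmod (rcis r \<theta> - a))))
      has_integral (2 * pi * ln (cmod (h 0)) + (\<Sum>a\<in>S. real (n a) * (2 * pi * ln r)))) {0..2 * pi}"
    by (rule has_integral_add)
  moreover have "ln (cmod (F (rcis r \<theta>)))
      = ln (cmod (h (rcis r \<theta>))) + (\<Sum>a\<in>S. real (n a) * ln (cmod (rcis r \<theta> - a)))" for \<theta>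
  proof -
    have ne: "rcis r \<theta> - a \<noteq> 0" if "a \<in> S" for a using S[OF that] assms(6) by auto
    have "ln (cmod (\<Prod>a\<in>S. (rcis r \<theta> - a) ^ n a)) = (\<Sum>a\<in>S. ln (cmod (rcis r \<theta> - a) ^ n a))"
      unfolding prod_norm[symmetric] norm_power[symmetric] using ne assms(1)
      by (intro ln_prod) auto
    also have "\<dots> = (\<Sum>a\<in>S. real (n a) * ln (cmod (rcis r \<theta> - a)))"
      using ne by (intro sum.cong ln_realpow) auto
    finally have "ln (cmod (\<Prod>a\<in>S. (rcis r \<theta> - a) ^ n a)) = \<dots>" .
    moreover have "(\<Prod>a\<in>S. (rcis r \<theta> - a) ^ n a) \<noteq> 0" using ne assms(1) by simp
    moreover have "h (rcis r \<theta>) \<noteq> 0" using assms(6) by (intro nz) simp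
    ultimately show ?thesis by (simp add: assms(3) norm_mult ln_mult)
  qed
  moreover have "2 * pi * ln (cmod (h 0)) + (\<Sum>a\<in>S. real (n a) * (2 * pi * ln r))
      = 2 * pi * (ln (cmod (h 0)) + (\<Sum>a\<in>S. real (n a) * ln r))"
    by (simp add: sum_distrib_left distrib_left mult_ac)
  ultimately show ?thesis by simp
qed

text \<open>A zero a adds 1/t from max(1, |a|) on; zeros in the unit disc count from the
  start.\<close>

lemma has_integral_zero_count:
  assumes "entire F" "\<exists>z. F z \<noteq> 0" "1 \<le> r"
  shows "((\<lambda>t. real (zero_count F t) / t) has_integral
    (\<Sum>a\<in>zeros_in F r. real (zero_mult F a) * (ln r - ln (max 1 (cmod a))))) {1..r}"
proof -
  have fin: "finite (zeros_in F t)" for t using assms(1,2) by (rule finite_zeros_in)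
  have one: "((\<lambda>t. if max 1 (cmod a) \<le> t then 1 / t else 0) has_integral (ln r - ln (max 1 (cmod
      a)))) {1..r}"
    if "a \<in> zeros_in F r" for a
  proof -
    define c where "c = max 1 (cmod a)"
    have c: "1 \<le> c" "c \<le> r" using that assms(3) by (auto simp: c_def zeros_in_def)
    have "((\<lambda>t. 1 / t) has_integral (ln r - ln c)) {c..r}"
    proof (rule fundamental_theorem_of_calculus[OF c(2)])
      fix t assume "t \<in> {c..r}"
      then have "(ln has_real_derivative 1 / t) (at t within {c..r})"
        using c by (auto intro!: derivative_eq_intros)
      then show "(ln has_vector_derivative 1 / t) (at t within {c..r})"
        by (simp add: has_real_derivative_iff_has_vector_derivative)
    qed
    then have "((\<lambda>t. if t \<in> {c..r} then 1 / t else 0) has_integral (ln r - ln c)) {1..r}"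
      using c by (subst has_integral_restrict) auto
    then show ?thesis unfolding c_def[symmetric] by (rule has_integral_eq[rotated]) auto
  qed
  have "((\<lambda>t. \<Sum>a\<in>zeros_in F r. real (zero_mult F a) * (if max 1 (cmod a) \<le> t then 1 / t else 0))
      has_integral
      (\<Sum>a\<in>zeros_in F r. real (zero_mult F a) * (ln r - ln (max 1 (cmod a))))) {1..r}"
    by (intro has_integral_sum fin has_integral_mult_right one)
  then show ?thesis
  proof (rule has_integral_eq[rotated])
    fix t assume t: "t \<in> {1..r}"
    have "(\<Sum>a\<in>zeros_in F r. real (zero_mult F a) * (if max 1 (cmod a) \<le> t then 1 / t else 0))
        = (\<Sum>a\<in>zeros_in F t. real (zero_mult F a) * (if max 1 (cmod a) \<le> t then 1 / t else 0))"
      using t by (intro sum.mono_neutral_right fin) (auto simp: zeros_in_def)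
    also have "\<dots> = (\<Sum>a\<in>zeros_in F t. real (zero_mult F a) * (1 / t))"
      using t by (intro sum.cong) (auto simp: zeros_in_def)
    also have "\<dots> = real (zero_count F t) / t" by (simp add: zero_count_def sum_divide_distrib)
    finally show "(\<Sum>a\<in>zeros_in F r. real (zero_mult F a) * (if max 1 (cmod a) \<le> t then 1 / t else
        0))
        = real (zero_count F t) / t" .
  qed
qed

text \<open>Integrating from 1 avoids the singularity of 1/t and any special role of a zero at 0.
  The constant is ln |h1(0)|, where \<open>h1\<close> is F with its zeros in the closed unit disc
  split off; it does not depend on r.\<close>

lemma Jensen_formula:
  assumes F: "entire F" "\<exists>z. F z \<noteq> 0"
  shows "\<exists>K. \<forall>r\<ge>1. (\<forall>z. cmod z = r \<longrightarrow> F z \<noteq> 0) \<longrightarrow>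
    ((\<lambda>\<theta>. ln (cmod (F (rcis r \<theta>)))) has_integral
      (2 * pi * (K + integral {1..r} (\<lambda>t. real (zero_count F t) / t)))) {0..2 * pi}"
proof -
  have fin: "finite (zeros_in F t)" for t using F by (rule finite_zeros_in)
  let ?S1 = "zeros_in F 1"
  obtain h1 where h1: "entire h1" "\<And>z. F z = (\<Prod>a\<in>?S1. (z - a) ^ zero_mult F a) * h1 z"
    "\<And>a. a \<in> ?S1 \<Longrightarrow> h1 a \<noteq> 0"
    using entire_factor_zeros[OF F fin] by metis
  have h1_nz: "\<exists>z. h1 z \<noteq> 0" using F(2) h1(2) by auto
  define Q where "Q z = (\<Prod>a\<in>?S1. (z - a) ^ zero_mult F a)" for z
  have Q: "entire Q" unfolding Q_def entire_def by (intro holomorphic_intros)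
  have Q_nz: "\<exists>z. Q z \<noteq> 0" using F(2) h1(2) by (auto simp: Q_def)
  have "((\<lambda>\<theta>. ln (cmod (F (rcis r \<theta>)))) has_integral
      (2 * pi * (ln (cmod (h1 0)) + integral {1..r} (\<lambda>t. real (zero_count F t) / t)))) {0..2 * pi}"
    if r: "1 \<le> r" and circ: "\<forall>z. cmod z = r \<longrightarrow> F z \<noteq> 0" for r
  proof -
    let ?S = "zeros_in F r"
    define D where "D = ?S - ?S1"
    have sub: "?S1 \<subseteq> ?S" using r by (auto simp: zeros_in_def)
    have eq: "zero_mult h1 a = zero_mult F a" if "a \<in> D" for a
    proof -
      have "F = (\<lambda>z. Q z * h1 z)" using h1(2) by (auto simp: Q_def)
      then have "zero_mult F a = zero_mult Q a + zero_mult h1 a"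
        using zero_mult_mult[OF Q Q_nz h1(1) h1_nz] by simp
      moreover have "Q a \<noteq> 0" using that fin[of 1] by (auto simp: Q_def D_def)
      then have "zero_mult Q a = 0" using zero_mult_eq_0_iff[OF Q Q_nz] by blast
      ultimately show ?thesis by simp
    qed
    obtain h where h: "entire h" "\<And>z. h1 z = (\<Prod>a\<in>D. (z - a) ^ zero_mult h1 a) * h z"
      "\<And>a. a \<in> D \<Longrightarrow> h a \<noteq> 0"
      using entire_factor_zeros[OF h1(1) h1_nz, of D] fin[of r] unfolding D_def by (metis
          finite_Diff)
    have h': "h1 z = (\<Prod>a\<in>D. (z - a) ^ zero_mult F a) * h z" for z
      using h(2)[of z] eq by (simp cong: prod.cong)
    have F_eq: "F z = (\<Prod>a\<in>?S. (z - a) ^ zero_mult F a) * h z" for z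
    proof -
      have "(\<Prod>a\<in>?S. (z - a) ^ zero_mult F a)
          = (\<Prod>a\<in>D. (z - a) ^ zero_mult F a) * (\<Prod>a\<in>?S1. (z - a) ^ zero_mult F a)"
        unfolding D_def by (rule prod.subset_diff[OF sub fin])
      then show ?thesis using h1(2)[of z] h'[of z] by simp
    qed
    have nz: "h z \<noteq> 0" if "cmod z \<le> r" for z
    proof
      assume hz: "h z = 0"
      then have "F z = 0" "h1 z = 0" using F_eq[of z] h'[of z] by auto
      then have "z \<in> ?S" using that by (simp add: zeros_in_def)
      then show False using h1(3)[of z] h(3)[of z] \<open>h1 z = 0\<close> hz by (auto simp: D_def)
    qed
    have S_lt: "cmod a < r" if "a \<in> ?S" for a
      using that circ by (force simp: zeros_in_def order_less_le)
    have "((\<lambda>\<theta>. ln (cmod (F (rcis r \<theta>)))) has_integral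
      (2 * pi * (ln (cmod (h 0)) + (\<Sum>a\<in>?S. real (zero_mult F a) * ln r)))) {0..2 * pi}"
      using r by (intro has_integral_ln_norm_factored_circle[OF fin h(1) F_eq S_lt nz]) auto
    \<comment> \<open>Trades the r-dependent value of h at 0 for the fixed constant; the terms ln
      |a| are those missing in the integral of the zero count.\<close>
    moreover have "ln (cmod (h1 0)) = (\<Sum>a\<in>D. real (zero_mult F a) * ln (cmod a)) + ln (cmod (h 0))"
    proof -
      have D0: "a \<noteq> 0" if "a \<in> D" for a using that by (auto simp: D_def zeros_in_def)
      have "finite D" using fin by (simp add: D_def)
      have "cmod (h1 0) = (\<Prod>a\<in>D. cmod a ^ zero_mult F a) * cmod (h 0)"
        using h'[of 0] by (simp add: norm_mult prod_norm[symmetric] norm_power)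
      moreover have "(\<Prod>a\<in>D. cmod a ^ zero_mult F a) > 0" using D0 by (intro prod_pos) simp
      moreover have "h 0 \<noteq> 0" using nz[of 0] r by simp
      ultimately have "ln (cmod (h1 0)) = ln (\<Prod>a\<in>D. cmod a ^ zero_mult F a) + ln (cmod (h 0))"
        by (simp add: ln_mult)
      also have "ln (\<Prod>a\<in>D. cmod a ^ zero_mult F a) = (\<Sum>a\<in>D. ln (cmod a ^ zero_mult F a))"
        using D0 \<open>finite D\<close> by (intro ln_prod) auto
      also have "\<dots> = (\<Sum>a\<in>D. real (zero_mult F a) * ln (cmod a))"
        using D0 by (intro sum.cong ln_realpow) auto
      finally show ?thesis .
    qed
    moreover have "integral {1..r} (\<lambda>t. real (zero_count F t) / t)
        = (\<Sum>a\<in>?S. real (zero_mult F a) * ln r) - (\<Sum>a\<in>D. real (zero_mult F a) * ln (cmod a))"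
    proof -
      have "integral {1..r} (\<lambda>t. real (zero_count F t) / t)
          = (\<Sum>a\<in>?S. real (zero_mult F a) * (ln r - ln (max 1 (cmod a))))"
        using has_integral_zero_count[OF F r] by (rule integral_unique)
      also have "\<dots> = (\<Sum>a\<in>?S. real (zero_mult F a) * ln r) - (\<Sum>a\<in>?S. real (zero_mult F a) * ln (max
          1 (cmod a)))"
        by (simp add: right_diff_distrib sum_subtractf)
      also have "(\<Sum>a\<in>?S. real (zero_mult F a) * ln (max 1 (cmod a)))
          = (\<Sum>a\<in>D. real (zero_mult F a) * ln (max 1 (cmod a)))"
        by (rule sum.mono_neutral_right[OF fin]) (auto simp: D_def zeros_in_def max_def)
      also have "\<dots> = (\<Sum>a\<in>D. real (zero_mult F a) * ln (cmod a))"
        by (intro sum.cong) (auto simp: D_def zeros_in_def max_def)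
      finally show ?thesis .
    qed
    ultimately show ?thesis by simp
  qed
  then show ?thesis by blast
qed

section \<open>The difference counting function\<close>

lemma nbar_diff_eq:
  assumes "entire F" "\<exists>z. F z \<noteq> 0"
  shows "nbar_diff r F = (\<Sum>w\<in>zeros_in F r. zero_mult F w -
    min (zero_mult F w) (if cmod (w - 1) \<le> r then zero_mult F (w - 1) else 0))"
proof -
  have "{w. cmod w \<le> r \<and> zero_mult F w \<noteq> 0} = zeros_in F r"
    using zero_mult_eq_0_iff[OF assms] by (auto simp: zeros_in_def)
  then show ?thesis by (simp add: nbar_diff_def)
qed

text \<open>An index set that does not depend on t exhibits the function of t as a finite sum of
  step functions.\<close>

lemma nbar_diff_eq_superset:
  assumes F: "entire F" "\<exists>z. F z \<noteq> 0" and "t \<le> r"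
  shows "nbar_diff t F = (\<Sum>w\<in>zeros_in F r. if cmod w \<le> t then zero_mult F w -
    min (zero_mult F w) (if cmod (w - 1) \<le> t then zero_mult F (w - 1) else 0) else 0)"
proof -
  have "(\<Sum>w\<in>zeros_in F r. if cmod w \<le> t then zero_mult F w -
      min (zero_mult F w) (if cmod (w - 1) \<le> t then zero_mult F (w - 1) else 0) else 0)
    = (\<Sum>w\<in>zeros_in F t. if cmod w \<le> t then zero_mult F w -
      min (zero_mult F w) (if cmod (w - 1) \<le> t then zero_mult F (w - 1) else 0) else 0)"
    using finite_zeros_in[OF F] \<open>t \<le> r\<close> by (intro sum.mono_neutral_right) (auto simp: zeros_in_def)
  also have "\<dots> = nbar_diff t F"
    unfolding nbar_diff_eq[OF F] by (intro sum.cong) (auto simp: zeros_in_def)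
  finally show ?thesis ..
qed

lemma nbar_diff_le_zero_count:
  assumes F: "entire F" "\<exists>z. F z \<noteq> 0" and "t \<le> r"
  shows "nbar_diff t F \<le> zero_count F r"
  unfolding nbar_diff_eq_superset[OF assms] zero_count_def by (rule sum_mono) simp

lemma nbar_diff_eq_near_0:
  assumes F: "entire F" "\<exists>z. F z \<noteq> 0"
  obtains \<epsilon> where "0 < \<epsilon>" "\<And>t. 0 \<le> t \<Longrightarrow> t < \<epsilon> \<Longrightarrow> nbar_diff t F = nbar_diff 0 F"
proof -
  \<comment> \<open>The 1 covers the case of no further zeros and keeps the point -1 outside the
    disc, so that the zero at 0 has no predecessor.\<close>
  define \<epsilon> where "\<epsilon> = Min (insert 1 (cmod ` (zeros_in F 1 - {0})))"
  have fin: "finite (insert 1 (cmod ` (zeros_in F 1 - {0})))"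
    using finite_zeros_in[OF F] by simp
  have "0 < \<epsilon>" unfolding \<epsilon>_def using fin by (subst Min_gr_iff) auto
  moreover have "nbar_diff t F = nbar_diff 0 F" if t: "0 \<le> t" "t < \<epsilon>" for t
  proof -
    have "\<epsilon> \<le> 1" unfolding \<epsilon>_def using fin by (intro Min_le) auto
    have w0: "w = 0" if "w \<in> zeros_in F t" for w
    proof (rule ccontr)
      assume "w \<noteq> 0"
      then have "w \<in> zeros_in F 1 - {0}" using that t \<open>\<epsilon> \<le> 1\<close> by (auto simp: zeros_in_def)
      then have "\<epsilon> \<le> cmod w" unfolding \<epsilon>_def using fin by (intro Min_le) auto
      then show False using that t by (simp add: zeros_in_def)
    qed
    have "zeros_in F t = zeros_in F 0"
      using w0 t by (auto simp: zeros_in_def)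
    moreover have "\<not> cmod (w - 1) \<le> t \<and> \<not> cmod (w - 1) \<le> 0" if "w \<in> zeros_in F t" for w
      using w0[OF that] t \<open>\<epsilon> \<le> 1\<close> by simp
    ultimately show ?thesis unfolding nbar_diff_eq[OF F] by (auto intro!: sum.cong)
  qed
  ultimately show thesis using that by blast
qed

lemma step_measurable:
  "(\<lambda>t::real. if a \<le> t then if b \<le> t then x else y else (z::real)) \<in> borel_measurable borel"
  by measurable

text \<open>The integrand is measurable and bounded: it is 0 below the first positive modulus of a
  zero or an earlier \<epsilon>, and from \<epsilon> on the division by t costs at most
  1/\<epsilon>.\<close>

lemma nbar_diff_integrable:
  assumes F: "entire F" "\<exists>z. F z \<noteq> 0"
  shows "(\<lambda>t. (real (nbar_diff t F) - real (nbar_diff 0 F)) / t) integrable_on {0..r}"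
proof -
  define n where "n t = (\<Sum>w\<in>zeros_in F r. if cmod w \<le> t then if cmod (w - 1) \<le> t
    then real (zero_mult F w - zero_mult F (w - 1)) else real (zero_mult F w) else 0)" for t
  obtain \<epsilon> where \<epsilon>: "0 < \<epsilon>" "\<And>t. 0 \<le> t \<Longrightarrow> t < \<epsilon> \<Longrightarrow> nbar_diff t F = nbar_diff 0 F"
    using nbar_diff_eq_near_0[OF F] by metis
  have n: "n t = real (nbar_diff t F)" if "t \<in> {0..r}" for t
  proof -
    have "nbar_diff t F = (\<Sum>w\<in>zeros_in F r. if cmod w \<le> t then if cmod (w - 1) \<le> t
        then zero_mult F w - zero_mult F (w - 1) else zero_mult F w else 0)"
    proof -
      have "t \<le> r" using that by simp
      show ?thesis unfolding nbar_diff_eq_superset[OF F \<open>t \<le> r\<close>]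
      proof (rule sum.cong[OF refl])
        fix w
        show "(if cmod w \<le> t then zero_mult F w -
            min (zero_mult F w) (if cmod (w - 1) \<le> t then zero_mult F (w - 1) else 0) else 0)
          = (if cmod w \<le> t then if cmod (w - 1) \<le> t
            then zero_mult F w - zero_mult F (w - 1) else zero_mult F w else 0)"
          by (cases "cmod w \<le> t"; cases "cmod (w - 1) \<le> t"; simp)
      qed
    qed
    then show ?thesis unfolding n_def by (auto intro!: sum.cong)
  qed
  have "(\<lambda>t. (n t - real (nbar_diff 0 F)) / t) integrable_on {0..r}"
  proof (rule measurable_bounded_by_integrable_imp_integrable)
    have "n \<in> borel_measurable borel"
      unfolding n_def by (intro borel_measurable_sum step_measurable)
    then have "(\<lambda>t. (n t - real (nbar_diff 0 F)) / t) \<in> borel_measurable lborel"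
      by (intro borel_measurable_divide borel_measurable_diff borel_measurable_const) simp_all
    then show "(\<lambda>t. (n t - real (nbar_diff 0 F)) / t) \<in> borel_measurable (lebesgue_on {0..r})"
      by (intro measurable_restrict_space1 measurable_completion)
    show "(\<lambda>t. real (zero_count F r) / \<epsilon>) integrable_on {0..r}" by (rule integrable_const_ivl)
    show "norm ((n t - real (nbar_diff 0 F)) / t) \<le> real (zero_count F r) / \<epsilon>" if t: "t \<in> {0..r}"
        for t
    proof (cases "t < \<epsilon>")
      case True
      then show ?thesis using t \<epsilon>(1) \<epsilon>(2)[of t] n[OF t] by simp
    next
      case False
      have "n t \<le> real (zero_count F r)" "real (nbar_diff 0 F) \<le> real (zero_count F r)"
        using n[OF t] nbar_diff_le_zero_count[OF F, of t r] nbar_diff_le_zero_count[OF F, of 0 r]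
            t by auto
      moreover have "0 \<le> n t" using n[OF t] by simp
      ultimately have "\<bar>n t - real (nbar_diff 0 F)\<bar> \<le> real (zero_count F r)" by simp
      then have "\<bar>n t - real (nbar_diff 0 F)\<bar> / t \<le> real (zero_count F r) / \<epsilon>"
        using False \<epsilon>(1) by (intro frac_le) auto
      then show ?thesis using t by simp
    qed
  qed simp
  then show ?thesis by (rule integrable_eq) (simp add: n)
qed

text \<open>Moves the part over {0..1} into a constant, so that the counting function is compared
  with the Jensen formula on the same interval. The term with ln r is the integral of
  nbar(0)/t.\<close>

lemma Nbar_diff_split:
  assumes F: "entire F" "\<exists>z. F z \<noteq> 0" and "1 \<le> r"
  shows "((\<lambda>t. real (nbar_diff t F) / t) has_integral (Nbar_diff r F - Nbar_diff 1 F)) {1..r}"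
proof -
  let ?g = "\<lambda>t. (real (nbar_diff t F) - real (nbar_diff 0 F)) / t" and ?n0 = "real (nbar_diff 0 F)"
  have "integral {0..1} ?g + integral {1..r} ?g = integral {0..r} ?g"
    using \<open>1 \<le> r\<close> by (intro Henstock_Kurzweil_Integration.integral_combine nbar_diff_integrable[OF
        F]) auto
  then have eq: "Nbar_diff r F - Nbar_diff 1 F = integral {1..r} ?g + ?n0 * ln r"
    by (simp add: Nbar_diff_def)
  have "?g integrable_on {1..r}"
    using nbar_diff_integrable[OF F, of r] by (rule integrable_on_subinterval) auto
  then have "(?g has_integral integral {1..r} ?g) {1..r}" by (rule integrable_integral)
  moreover have "((\<lambda>t. ?n0 * (1 / t)) has_integral (?n0 * (ln r - ln 1))) {1..r}"
  proof (intro has_integral_mult_right fundamental_theorem_of_calculus[OF \<open>1 \<le> r\<close>])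
    fix t assume "t \<in> {1..r}"
    then have "(ln has_real_derivative 1 / t) (at t within {1..r})"
      by (auto intro!: derivative_eq_intros)
    then show "(ln has_vector_derivative 1 / t) (at t within {1..r})"
      by (simp add: has_real_derivative_iff_has_vector_derivative)
  qed
  ultimately have "((\<lambda>t. ?g t + ?n0 * (1 / t)) has_integral (integral {1..r} ?g + ?n0 * (ln r - ln
      1))) {1..r}"
    by (rule has_integral_add)
  then show ?thesis unfolding eq by (simp add: diff_divide_distrib)
qed

lemma Nbar_diff_sum:
  assumes "finite J" "\<And>j. j \<in> J \<Longrightarrow> entire (f j)" "\<And>j. j \<in> J \<Longrightarrow> \<exists>z. f j z \<noteq> 0"
    and "\<And>t. nbar_diff t P = (\<Sum>j\<in>J. nbar_diff t (f j))"
  shows "Nbar_diff r P = (\<Sum>j\<in>J. Nbar_diff r (f j))"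
proof -
  have "integral {0..r} (\<lambda>t. (real (nbar_diff t P) - real (nbar_diff 0 P)) / t)
      = integral {0..r} (\<lambda>t. \<Sum>j\<in>J. (real (nbar_diff t (f j)) - real (nbar_diff 0 (f j))) / t)"
    by (simp add: assms(4) sum_subtractf[symmetric] sum_divide_distrib)
  also have "\<dots> = (\<Sum>j\<in>J. integral {0..r} (\<lambda>t. (real (nbar_diff t (f j)) - real (nbar_diff 0 (f j)))
      / t))"
    using assms(1-3) by (intro integral_sum nbar_diff_integrable) auto
  finally show ?thesis
    by (simp add: Nbar_diff_def assms(4) sum.distrib sum_distrib_right)
qed

text \<open>Truncated subtraction is not additive. Separation rescues it: if a_j is nonzero at w,
  then every other a_i vanishes at w - 1.\<close>

lemma nbar_diff_prod:
  assumes J: "finite J" "\<And>j. j \<in> J \<Longrightarrow> entire (f j)" "\<And>j. j \<in> J \<Longrightarrow> \<exists>z. f j z \<noteq> 0"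
    and sep: "\<And>i j w. i \<in> J \<Longrightarrow> j \<in> J \<Longrightarrow> i \<noteq> j \<Longrightarrow> f i w = 0 \<Longrightarrow> f j (w + 1) \<noteq> 0"
  shows "nbar_diff t (\<lambda>z. \<Prod>j\<in>J. f j z) = (\<Sum>j\<in>J. nbar_diff t (f j))"
proof -
  let ?P = "\<lambda>z. \<Prod>j\<in>J. f j z"
  have P: "entire ?P" "\<exists>z. ?P z \<noteq> 0"
  proof -
    show "entire ?P" by (rule entire_prod[OF J(2)])
    show "\<exists>z. ?P z \<noteq> 0" by (rule entire_prod_nonzero[OF J])
  qed
  have mult_P: "zero_mult ?P w = (\<Sum>j\<in>J. zero_mult (f j) w)" for w
    using J by (rule zero_mult_prod)
  define a where "a j w = (if cmod w \<le> t then zero_mult (f j) w else 0)" for j w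
  have summand: "(\<Sum>j\<in>J. a j w) - (\<Sum>j\<in>J. a j (w - 1)) = (\<Sum>j\<in>J. a j w - a j (w - 1))" for w
  proof -
    have no: "a i (w - 1) = 0" if "i \<in> J" "j \<in> J" "i \<noteq> j" "a j w \<noteq> 0" for i j
    proof -
      have "f j (w - 1 + 1) = 0"
        using that zero_mult_eq_0_iff[OF J(2,3), of j w] by (simp add: a_def split: if_splits)
      then have "f i (w - 1) \<noteq> 0" using sep[of i j "w - 1"] that by blast
      then show ?thesis using zero_mult_eq_0_iff[OF J(2,3), of i "w - 1"] that by (simp add: a_def)
    qed
    show ?thesis
    proof (cases "\<exists>j\<in>J. a j w \<noteq> 0")
      case False
      then show ?thesis by simp
    next
      case True
      then obtain j where j: "j \<in> J" "a j w \<noteq> 0" by blast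
      have "(\<Sum>i\<in>J. a i (w - 1)) = a j (w - 1)"
        using no j J(1) by (subst sum.remove[of _ j]) auto
      moreover have "(\<Sum>i\<in>J. a i w) = a j w + (\<Sum>i\<in>J - {j}. a i w)"
        by (rule sum.remove[OF J(1) j(1)])
      moreover have "(\<Sum>i\<in>J. a i w - a i (w - 1)) = (a j w - a j (w - 1)) + (\<Sum>i\<in>J - {j}. a i w - a
          i (w - 1))"
        by (rule sum.remove[OF J(1) j(1)])
      moreover have "(\<Sum>i\<in>J - {j}. a i w - a i (w - 1)) = (\<Sum>i\<in>J - {j}. a i w)"
        using no j by (intro sum.cong) auto
      \<comment> \<open>If a second function also vanishes at w, then a_j itself is 0 at w - 1, so
        common zeros do no harm.\<close>
      moreover have "a j (w - 1) \<le> a j w \<or> (\<forall>i\<in>J - {j}. a i w = 0)"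
        using no j by (metis DiffE insertI1 le0)
      ultimately show ?thesis by (auto simp: sum.neutral)
    qed
  qed
  have min_diff: "x - min x y = x - y" for x y :: nat by simp
  have sub: "zeros_in (f j) t \<subseteq> zeros_in ?P t" if "j \<in> J" for j
    using that J(1) by (auto simp: zeros_in_def intro: prod_zero)
  have "nbar_diff t ?P = (\<Sum>w\<in>zeros_in ?P t. (\<Sum>j\<in>J. a j w) - (\<Sum>j\<in>J. a j (w - 1)))"
    unfolding nbar_diff_eq[OF P] min_diff
    by (intro sum.cong) (auto simp: a_def mult_P zeros_in_def)
  also have "\<dots> = (\<Sum>j\<in>J. \<Sum>w\<in>zeros_in ?P t. a j w - a j (w - 1))"
    unfolding summand by (rule sum.swap)
  also have "\<dots> = (\<Sum>j\<in>J. nbar_diff t (f j))"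
  proof (rule sum.cong[OF refl])
    fix j assume j: "j \<in> J"
    have "(\<Sum>w\<in>zeros_in ?P t. a j w - a j (w - 1)) = (\<Sum>w\<in>zeros_in (f j) t. a j w - a j (w - 1))"
    proof (rule sum.mono_neutral_right[OF finite_zeros_in[OF P] sub[OF j]], rule ballI)
      fix w assume "w \<in> zeros_in ?P t - zeros_in (f j) t"
      then have "f j w \<noteq> 0" by (auto simp: zeros_in_def)
      then show "a j w - a j (w - 1) = 0"
        using zero_mult_eq_0_iff[OF J(2,3)[OF j], of w] by (simp add: a_def)
    qed
    also have "\<dots> = nbar_diff t (f j)"
      unfolding nbar_diff_eq[OF J(2,3)[OF j]] min_diff
      by (intro sum.cong) (auto simp: a_def zeros_in_def)
    finally show "(\<Sum>w\<in>zeros_in ?P t. a j w - a j (w - 1)) = nbar_diff t (f j)" .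
  qed
  finally show ?thesis .
qed

text \<open>The hypothesis says that C vanishes at w at least to the minimal order of P on the l + 1
  points w, ..., w + l, which are the windows of \<open>sum_run_lengths\<close>.\<close>

lemma zero_count_le_nbar_diff:
  assumes P: "entire P" "\<exists>z. P z \<noteq> 0" and C: "entire C" "\<exists>z. C z \<noteq> 0"
    and ge: "\<And>w N. (\<And>i. i \<le> l \<Longrightarrow> N \<le> zero_mult P (w + of_nat i)) \<Longrightarrow> N \<le> zero_mult C w"
  shows "zero_count P t \<le> zero_count C t + l * nbar_diff t P"
proof -
  let ?S = "zeros_in P t"
  \<comment> \<open>The cutoff at the disc reproduces the convention that a predecessor outside it
    counts as 0. It only lowers the minima, so \<open>ge\<close> still applies.\<close>
  define b where "b w = (if cmod w \<le> t then zero_mult P w else 0)" for w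
  have fin: "finite ?S" using P by (rule finite_zeros_in)
  have "zero_count P t = (\<Sum>w\<in>?S. b w)"
    unfolding zero_count_def by (intro sum.cong) (auto simp: b_def zeros_in_def)
  also have "\<dots> \<le> (\<Sum>w\<in>?S. Min ((\<lambda>i. b (w + of_nat i)) ` {..l})) + l * (\<Sum>w\<in>?S. b w - b (w - 1))"
    using fin zero_mult_eq_0_iff[OF P] by (intro sum_run_lengths) (auto simp: b_def zeros_in_def)
  also have "(\<Sum>w\<in>?S. b w - b (w - 1)) = nbar_diff t P"
    unfolding nbar_diff_eq[OF P] by (intro sum.cong) (auto simp: b_def zeros_in_def)
  also have "(\<Sum>w\<in>?S. Min ((\<lambda>i. b (w + of_nat i)) ` {..l})) \<le> (\<Sum>w\<in>?S. zero_mult C w)"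
  proof (intro sum_mono ge)
    fix w i assume "i \<le> l"
    then have "Min ((\<lambda>i. b (w + of_nat i)) ` {..l}) \<le> b (w + of_nat i)" by (intro Min_le) auto
    also have "\<dots> \<le> zero_mult P (w + of_nat i)" by (simp add: b_def)
    finally show "Min ((\<lambda>i. b (w + of_nat i)) ` {..l}) \<le> zero_mult P (w + of_nat i)" .
  qed
  also have "(\<Sum>w\<in>?S. zero_mult C w) = (\<Sum>w\<in>?S \<inter> zeros_in C t. zero_mult C w)"
    using fin zero_mult_eq_0_iff[OF C] by (intro sum.mono_neutral_right) (auto simp: zeros_in_def)
  also have "\<dots> \<le> zero_count C t"
    unfolding zero_count_def using finite_zeros_in[OF C] by (intro sum_mono2) auto
  finally show ?thesis by simp
qed

section \<open>The main estimate\<close>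

lemma growth_order_nonneg: "0 \<le> growth_order f"
  unfolding growth_order_def
proof (rule le_Limsup)
  show "\<forall>\<^sub>F r in at_top. 0 \<le> ereal (log_plus (log_plus (max_modulus f r)) / ln r)"
    using eventually_ge_at_top[of 1]
  proof eventually_elim
    case (elim r)
    then have "0 \<le> log_plus (log_plus (max_modulus f r)) / ln r"
      by (intro divide_nonneg_nonneg log_plus_nonneg) auto
    then show ?case by simp
  qed
qed simp

lemma lin_indep_over_periodic_reindex:
  assumes "lin_indep_over_periodic {1..m} f"
  shows "lin_indep_over_periodic {..<m} (\<lambda>j. f (Suc j))"
  unfolding lin_indep_over_periodic_def
proof (intro allI impI ballI)
  fix p :: "nat \<Rightarrow> complex \<Rightarrow> complex" and i z
  assume p: "(\<forall>i\<in>{..<m}. periodic_meromorphic (p i)) \<and> (\<forall>\<^sub>\<approx>z\<in>UNIV. (\<Sum>i<m. p i z * f (Suc i) z) = 0)"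
    and i: "i \<in> {..<m}"
  have "(\<Sum>j = 1..m. p (j - 1) z * f j z) = (\<Sum>i<m. p i z * f (Suc i) z)" for z
    by (simp add: sum.atLeast1_atMost_eq)
  then have "(\<forall>j\<in>{1..m}. periodic_meromorphic (p (j - 1))) \<and>
      (\<forall>\<^sub>\<approx>z\<in>UNIV. (\<Sum>j = 1..m. p (j - 1) z * f j z) = 0)"
    using p by auto
  then have "\<forall>j\<in>{1..m}. \<forall>z. p (j - 1) z = 0"
    using assms[unfolded lin_indep_over_periodic_def, THEN spec, of "\<lambda>j. p (j - 1)"] by blast
  moreover have "Suc i \<in> {1..m}" using i by simp
  ultimately have "p (Suc i - 1) z = 0" by blast
  then show "p i z = 0" by simp
qed

text \<open>Used with a singleton for f_j, j <= m, and with the whole index set for f_{m+1}.\<close>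

lemma lin_indep_over_periodic_nonzero:
  assumes "lin_indep_over_periodic I f" "finite I" "K \<subseteq> I" "K \<noteq> {}"
  shows "\<exists>z. (\<Sum>i\<in>K. f i z) \<noteq> 0"
proof (rule ccontr)
  assume "\<nexists>z. (\<Sum>i\<in>K. f i z) \<noteq> 0"
  then have zero: "(\<Sum>i\<in>K. f i z) = 0" for z by blast
  define p :: "_ \<Rightarrow> complex \<Rightarrow> complex" where "p i = (\<lambda>_. if i \<in> K then 1 else 0)" for i
  have "(\<Sum>i\<in>I. p i z * f i z) = (\<Sum>i\<in>K. f i z)" for z
    using assms(2,3) by (intro sum.mono_neutral_cong_right) (auto simp: p_def)
  then have "\<forall>\<^sub>\<approx>z\<in>UNIV. (\<Sum>i\<in>I. p i z * f i z) = 0" using zero by simp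
  moreover have "\<forall>i\<in>I. periodic_meromorphic (p i)"
    by (auto simp: periodic_meromorphic_def p_def)
  ultimately have "\<forall>i\<in>I. \<forall>z. p i z = 0"
    using assms(1)[unfolded lin_indep_over_periodic_def, THEN spec, of p] by blast
  moreover obtain i where "i \<in> K" using assms(4) by blast
  ultimately have "p i 0 = 0" using assms(3) by blast
  then show False using \<open>i \<in> K\<close> by (simp add: p_def)
qed

lemma casoratian_replace:
  assumes sum: "\<And>z. (\<Sum>j = 1..m. f j z) = f (m + 1) z" and "k < m"
  shows "casoratian m ((\<lambda>j. f (Suc j))(k := f (m + 1))) z = casoratian m (\<lambda>j. f (Suc j)) z"
proof -
  have "f (m + 1) = (\<lambda>z. \<Sum>j<m. f (Suc j) z)"
    using sum by (auto simp: sum.atLeast1_atMost_eq)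
  then show ?thesis using casoratian_replace_by_sum[OF \<open>k < m\<close>, of "\<lambda>j. f (Suc j)" z] by simp
qed

lemma max_norm_casoratian_le:
  assumes sum: "\<And>z. (\<Sum>j = 1..m. f j z) = f (m + 1) z"
    and \<kappa>: "\<And>i. i < m \<Longrightarrow> 0 \<le> \<kappa> i"
    and le: "\<And>i j. i < m \<Longrightarrow> j \<in> {1..m + 1} \<Longrightarrow> cmod ((fdiff ^^ i) (f j) z) \<le> \<kappa> i * cmod (f j z)"
  shows "max_norm {1..m + 1} f z * cmod (casoratian m (\<lambda>j. f (Suc j)) z)
    \<le> fact m * (\<Prod>i<m. \<kappa> i) * cmod (\<Prod>j = 1..m + 1. f j z)"
proof -
  define F where "F j = f (Suc j)" for j
  have "max_norm {1..m + 1} f z \<in> (\<lambda>j. cmod (f j z)) ` {1..m + 1}"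
    unfolding max_norm_def by (intro Max_in) auto
  then obtain k where k: "k \<in> {1..m + 1}" "max_norm {1..m + 1} f z = cmod (f k z)" by blast
  have "(\<Prod>j = 1..m + 1. f j z) = (\<Prod>j = 1..m. f j z) * f (m + 1) z" by simp
  also have "(\<Prod>j = 1..m. f j z) = (\<Prod>j<m. F j z)"
    unfolding F_def by (rule prod.reindex_bij_witness[of _ Suc "\<lambda>j. j - 1"]) auto
  finally have all: "cmod (\<Prod>j = 1..m + 1. f j z) = (\<Prod>j<m. cmod (F j z)) * cmod (f (m + 1) z)"
    by (simp only: norm_mult prod_norm)
  \<comment> \<open>The columns \<open>G\<close> are all the functions except f k, so that f k times
    their product is P.\<close>
  obtain G where G: "casoratian m G z = casoratian m F z" "\<And>j. j < m \<Longrightarrow> G j \<in> f ` {1..m + 1}"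
    "cmod (f k z) * (\<Prod>j<m. cmod (G j z)) = cmod (\<Prod>j = 1..m + 1. f j z)"
  proof (cases "k = m + 1")
    case True
    show ?thesis
    proof (rule that[of F])
      show "cmod (f k z) * (\<Prod>j<m. cmod (F j z)) = cmod (\<Prod>j = 1..m + 1. f j z)"
        unfolding all True by (rule mult.commute)
    qed (auto simp: F_def)
  next
    case False
    then obtain k' where k': "k = Suc k'" "k' < m" using k(1) by (cases k) auto
    show ?thesis
    proof (rule that[of "F(k' := f (m + 1))"])
      show "casoratian m (F(k' := f (m + 1))) z = casoratian m F z"
        unfolding F_def using sum k'(2) by (rule casoratian_replace)
      have "(\<Prod>j<m. cmod ((F(k' := f (m + 1))) j z))
          = cmod (f (m + 1) z) * (\<Prod>j\<in>{..<m} - {k'}. cmod ((F(k' := f (m + 1))) j z))"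
        using k'(2) by (subst prod.remove[of _ k']) auto
      also have "(\<Prod>j\<in>{..<m} - {k'}. cmod ((F(k' := f (m + 1))) j z)) = (\<Prod>j\<in>{..<m} - {k'}. cmod (F
          j z))"
        by (intro prod.cong) auto
      finally have 1: "(\<Prod>j<m. cmod ((F(k' := f (m + 1))) j z))
          = cmod (f (m + 1) z) * (\<Prod>j\<in>{..<m} - {k'}. cmod (F j z))" .
      have 2: "(\<Prod>j<m. cmod (F j z)) = cmod (F k' z) * (\<Prod>j\<in>{..<m} - {k'}. cmod (F j z))"
        using k'(2) by (intro prod.remove) auto
      show "cmod (f k z) * (\<Prod>j<m. cmod ((F(k' := f (m + 1))) j z)) = cmod (\<Prod>j = 1..m + 1. f j z)"
        unfolding all 1 2 by (simp add: F_def k'(1))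
    qed (auto simp: F_def)
  qed
  have "cmod (casoratian m G z) \<le> fact m * ((\<Prod>i<m. \<kappa> i) * (\<Prod>j<m. cmod (G j z)))"
  proof (rule norm_casoratian_le[OF \<kappa>])
    fix i j assume "i < m" "j < m"
    then obtain l where "l \<in> {1..m + 1}" "G j = f l" using G(2) by blast
    then show "cmod ((fdiff ^^ i) (G j) z) \<le> \<kappa> i * cmod (G j z)" using le[OF \<open>i < m\<close>] by simp
  qed
  then have "cmod (f k z) * cmod (casoratian m G z)
      \<le> cmod (f k z) * (fact m * ((\<Prod>i<m. \<kappa> i) * (\<Prod>j<m. cmod (G j z))))"
    by (rule mult_left_mono) simp
  also have "\<dots> = fact m * (\<Prod>i<m. \<kappa> i) * (cmod (f k z) * (\<Prod>j<m. cmod (G j z)))"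
    by (simp only: mult_ac)
  finally show ?thesis unfolding G(1,3) k(2) F_def .
qed

text \<open>Over m consecutive zeros of P, separation makes each point hand its function on to the
  next, so one f k vanishes at all of them and no other function at any. There the multiplicities of
  P are those of f k, which fills one column of the Casoratian.\<close>

lemma zero_mult_casoratian_ge_prod:
  assumes "2 \<le> m" and ent: "\<And>j. j \<in> {1..m + 1} \<Longrightarrow> entire (f j)"
    and nz: "\<And>j. j \<in> {1..m + 1} \<Longrightarrow> \<exists>z. f j z \<noteq> 0"
    and sum: "\<And>z. (\<Sum>j = 1..m. f j z) = f (m + 1) z"
    and sep: "\<And>i j w. i \<in> {1..m + 1} \<Longrightarrow> j \<in> {1..m + 1} \<Longrightarrow> i \<noteq> j \<Longrightarrow> f i w = 0 \<Longrightarrow> f j (w + 1) \<noteq> 0"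
    and C: "\<exists>z. casoratian m (\<lambda>j. f (Suc j)) z \<noteq> 0"
    and N: "\<And>i. i \<le> m - 1 \<Longrightarrow> N \<le> zero_mult (\<lambda>z. \<Prod>j = 1..m + 1. f j z) (w + of_nat i)"
  shows "N \<le> zero_mult (casoratian m (\<lambda>j. f (Suc j))) w"
proof (cases "N = 0")
  case False
  let ?P = "\<lambda>z. \<Prod>j = 1..m + 1. f j z"
  have mult_P: "zero_mult ?P w = (\<Sum>j\<in>{1..m + 1}. zero_mult (f j) w)" for w
    using ent nz by (intro zero_mult_prod) auto
  have ex_zero: "\<exists>j\<in>{1..m + 1}. f j (w + of_nat i) = 0" if "i \<le> m - 1" for i
  proof (rule ccontr)
    assume "\<not> (\<exists>j\<in>{1..m + 1}. f j (w + of_nat i) = 0)"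
    then have "zero_mult ?P (w + of_nat i) = 0"
      unfolding mult_P using zero_mult_eq_0_iff[OF ent nz] by (intro sum.neutral) auto
    then show False using N[OF that] False by simp
  qed
  have step: "i = j" if "i \<in> {1..m + 1}" "j \<in> {1..m + 1}" "f i (w + of_nat n) = 0"
    "f j (w + of_nat (Suc n)) = 0" for i j n
    using sep[OF that(1,2), of "w + of_nat n"] that(3,4) by (auto simp: add_ac)
  obtain k where k: "k \<in> {1..m + 1}" "f k w = 0" using ex_zero[of 0] by auto
  have k_zero: "f k (w + of_nat i) = 0" if "i \<le> m - 1" for i
    using that
  proof (induction i)
    case 0
    then show ?case using k by simp
  next
    case (Suc i)
    obtain j where "j \<in> {1..m + 1}" "f j (w + of_nat (Suc i)) = 0" using ex_zero[OF Suc.prems] by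
        blast
    moreover from this have "k = j" using Suc k(1) by (intro step[of k j i]) auto
    ultimately show ?case by simp
  qed
  \<comment> \<open>The first point is compared with its successor, which exists because m >= 2, and
    every other point with its predecessor.\<close>
  have only_k: "j = k" if "i \<le> m - 1" "j \<in> {1..m + 1}" "f j (w + of_nat i) = 0" for i j
  proof (cases i)
    case 0
    then show ?thesis using step[of j k 0] k_zero[of 1] that k(1) assms(1) by simp
  next
    case (Suc n)
    then show ?thesis using step[of k j n] k_zero[of n] that k(1) by simp
  qed
  have N': "N \<le> zero_mult (f k) (w + of_nat i)" if "i < m" for i
  proof -
    have "i \<le> m - 1" using that by simp
    have "zero_mult ?P (w + of_nat i) = (\<Sum>j\<in>{k}. zero_mult (f j) (w + of_nat i))"
      unfolding mult_P using k(1) only_k[OF \<open>i \<le> m - 1\<close>] zero_mult_eq_0_iff[OF ent nz]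
      by (intro sum.mono_neutral_right) auto
    then show ?thesis using N[OF \<open>i \<le> m - 1\<close>] by simp
  qed
  show ?thesis
  proof (cases "k = m + 1")
    case False
    then obtain k' where "k = Suc k'" "k' < m" using k(1) by (cases k) auto
    then show ?thesis using N' C ent nz
      by (intro zero_mult_casoratian_ge[of m _ k']) auto
  next
    case True
    \<comment> \<open>f_{m+1} is not a column yet; it is put in place of the first one.\<close>
    define G where "G = (\<lambda>j. f (Suc j))(0 := f (m + 1))"
    have eq: "casoratian m G = casoratian m (\<lambda>j. f (Suc j))"
      unfolding G_def using casoratian_replace[OF sum, of 0] assms(1) by (auto simp: fun_eq_iff)
    have "N \<le> zero_mult (casoratian m G) w"
    proof (rule zero_mult_casoratian_ge[of m G 0])
      show "entire (G j)" if "j < m" for j using that ent by (auto simp: G_def)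
      show "\<exists>z. G 0 z \<noteq> 0" using nz[of "m + 1"] by (simp add: G_def)
      show "N \<le> zero_mult (G 0) (w + of_nat i)" if "i < m" for i
        using N'[OF that] True by (simp add: G_def)
    qed (use assms(1) C eq in auto)
    then show ?thesis by (simp only: eq)
  qed
qed simp

section \<open>Integration over circles\<close>

lemma countable_zero_moduli:
  assumes "entire F" "\<exists>z. F z \<noteq> 0"
  shows "countable {r. \<exists>z. cmod z = r \<and> F z = 0}"
proof -
  have "{r. \<exists>z. cmod z = r \<and> F z = 0} \<subseteq> cmod ` (\<Union>n. zeros_in F (real n))"
  proof clarsimp
    fix z assume "F z = 0"
    obtain n where "cmod z \<le> real n" using real_arch_simple by blast
    then show "cmod z \<in> cmod ` (\<Union>n. zeros_in F (real n))"
      using \<open>F z = 0\<close> by (auto simp: zeros_in_def)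
  qed
  moreover have "countable (cmod ` (\<Union>n. zeros_in F (real n)))"
    by (rule countable_image[OF countable_UN[OF countableI_type countable_finite[OF
        finite_zeros_in[OF assms]]]])
  ultimately show ?thesis by (rule countable_subset)
qed

lemma continuous_on_rcis: "continuous_on A (rcis r)"
  unfolding rcis_def[abs_def] cis_conv_exp by (intro continuous_intros)

lemma continuous_on_Max:
  fixes g :: "'a \<Rightarrow> 'b :: topological_space \<Rightarrow> real"
  assumes "finite J" "J \<noteq> {}" "\<And>j. j \<in> J \<Longrightarrow> continuous_on A (g j)"
  shows "continuous_on A (\<lambda>x. MAX j\<in>J. g j x)"
  using assms
proof (induction J rule: finite_ne_induct)
  case (insert j J)
  then have "continuous_on A (\<lambda>x. max (g j x) (MAX j\<in>J. g j x))"
    by (intro continuous_on_max) auto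
  then show ?case using insert by (simp add: Max_insert)
qed simp

lemma max_norm_pos:
  assumes "finite J" "j \<in> J" "f j z \<noteq> 0"
  shows "0 < max_norm J f z"
proof -
  have "cmod (f j z) \<le> max_norm J f z"
    unfolding max_norm_def using assms by (intro Max_ge) auto
  then show ?thesis using assms(3) zero_less_norm_iff by (meson less_le_trans)
qed

text \<open>The bound with an additive constant. \<open>K\<close> gathers what is independent of r:
  the two Jensen constants, ln m!, the part of the counting function up to radius 1, and the
  normalising term of the characteristic.\<close>

lemma T_tilde_Nbar_bound:
  fixes f :: "nat \<Rightarrow> complex \<Rightarrow> complex"
  assumes m: "2 \<le> m"
    and ent: "\<And>j. j \<in> {1..m + 1} \<Longrightarrow> entire (f j)"
    and nz: "\<And>j. j \<in> {1..m + 1} \<Longrightarrow> \<exists>z. f j z \<noteq> 0"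
    and sum: "\<And>z. (\<Sum>j = 1..m. f j z) = f (m + 1) z"
    and sep: "\<And>i j w. i \<in> {1..m + 1} \<Longrightarrow> j \<in> {1..m + 1} \<Longrightarrow> i \<noteq> j \<Longrightarrow> f i w = 0 \<Longrightarrow> f j (w + 1) \<noteq> 0"
    and C_nz: "\<exists>z. casoratian m (\<lambda>j. f (Suc j)) z \<noteq> 0"
    and growth: "\<And>j. j \<in> {1..m + 1} \<Longrightarrow> growth_le s (f j)" and su: "0 < s" "s < u" "u < 1"
  shows "\<exists>E K. finite_log_measure E \<and> (\<forall>r>1. r \<notin> E \<longrightarrow> T_tilde {1..m + 1} f r
    \<le> (real m - 1) * Nbar_diff r (\<lambda>z. \<Prod>j = 1..m + 1. f j z)
      - real m * (real m - 1) / 2 * (1 - u) * ln r + K)"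
proof -
  define P where "P z = (\<Prod>j = 1..m + 1. f j z)" for z
  define C where "C = casoratian m (\<lambda>j. f (Suc j))"
  define \<kappa> where "\<kappa> = real m * (real m - 1) / 2 * (1 - u)"
  define T0 where "T0 = (if max_norm {1..m + 1} f 0 \<noteq> 0 then ln (max_norm {1..m + 1} f 0)
      else (MAX j\<in>{j\<in>{1..m + 1}. \<exists>z. f j z \<noteq> 0}. ln (cmod (leading_coeff_at_0 (f j)))))"
  have P: "entire P" "\<exists>z. P z \<noteq> 0"
  proof -
    show "entire P" unfolding P_def[abs_def] by (rule entire_prod[OF ent])
    show "\<exists>z. P z \<noteq> 0" unfolding P_def by (rule entire_prod_nonzero[OF _ ent nz]) simp
  qed
  have C: "entire C" "\<exists>z. C z \<noteq> 0"
  proof -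
    show "entire C" unfolding C_def by (rule entire_casoratian) (simp add: ent)
    show "\<exists>z. C z \<noteq> 0" unfolding C_def by (rule C_nz)
  qed
  have count: "zero_count P t \<le> zero_count C t + (m - 1) * nbar_diff t P" for t
  proof (rule zero_count_le_nbar_diff[OF P C])
    fix w N assume "\<And>i. i \<le> m - 1 \<Longrightarrow> N \<le> zero_mult P (w + of_nat i)"
    then show "N \<le> zero_mult C w"
      unfolding C_def P_def[abs_def]
      by (intro zero_mult_casoratian_ge_prod[OF m ent nz sum sep C_nz])
  qed
  have "\<exists>E. finite_log_measure E \<and> (\<forall>z i. 1 \<le> cmod z \<longrightarrow> cmod z \<notin> E \<longrightarrow> i < m \<longrightarrow>
      cmod ((fdiff ^^ i) (f j) z) \<le> cmod z powr (real i * (u - 1)) * cmod (f j z))"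
    if "j \<in> {1..m + 1}" for j
    using fdiff_funpow_quotient_small[OF ent[OF that] su(1) growth[OF that] su(2,3), of m] by metis
  then obtain E where E: "\<And>j. j \<in> {1..m + 1} \<Longrightarrow> finite_log_measure (E j)"
    and E_le: "\<And>j z i. j \<in> {1..m + 1} \<Longrightarrow> 1 \<le> cmod z \<Longrightarrow> cmod z \<notin> E j \<Longrightarrow> i < m \<Longrightarrow>
      cmod ((fdiff ^^ i) (f j) z) \<le> cmod z powr (real i * (u - 1)) * cmod (f j z)"
    by metis
  obtain KP where KP: "\<And>r. 1 \<le> r \<Longrightarrow> (\<forall>z. cmod z = r \<longrightarrow> P z \<noteq> 0) \<Longrightarrow>
    ((\<lambda>\<theta>. ln (cmod (P (rcis r \<theta>)))) has_integral
      (2 * pi * (KP + integral {1..r} (\<lambda>t. real (zero_count P t) / t)))) {0..2 * pi}"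
    using Jensen_formula[OF P] by blast
  obtain KC where KC: "\<And>r. 1 \<le> r \<Longrightarrow> (\<forall>z. cmod z = r \<longrightarrow> C z \<noteq> 0) \<Longrightarrow>
    ((\<lambda>\<theta>. ln (cmod (C (rcis r \<theta>)))) has_integral
      (2 * pi * (KC + integral {1..r} (\<lambda>t. real (zero_count C t) / t)))) {0..2 * pi}"
    using Jensen_formula[OF C] by blast
  \<comment> \<open>Circles through zeros of P or C are excluded; off them the Jensen formula
    applies and all logarithms are of positive numbers.\<close>
  define Z where "Z = {r. \<exists>z. cmod z = r \<and> P z = 0} \<union> {r. \<exists>z. cmod z = r \<and> C z = 0}"
  define E' where "E' = (\<Union>j\<in>{1..m + 1}. E j) \<union> (Z \<inter> {1..})"
  have "finite_log_measure E'"
    unfolding E'_def Z_def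
    by (intro finite_log_measure_Un finite_log_measure_UN E finite_log_measure_countable
        countable_Int1 countable_Un countable_zero_moduli P C) auto
  moreover have "T_tilde {1..m + 1} f r \<le> (real m - 1) * Nbar_diff r P - \<kappa> * ln r
      + (KP - KC + ln (fact m) - (real m - 1) * Nbar_diff 1 P - T0)"
    if r: "1 < r" "r \<notin> E'" for r
  proof -
    have P0: "P z \<noteq> 0" and C0: "C z \<noteq> 0" if "cmod z = r" for z
      using that r by (auto simp: E'_def Z_def)
    let ?u = "\<lambda>\<theta>. max_norm {1..m + 1} f (rcis r \<theta>)"
    let ?B = "\<lambda>\<theta>. ln (cmod (P (rcis r \<theta>))) - ln (cmod (C (rcis r \<theta>))) + (ln (fact m) - \<kappa> * ln r)"
    have cmod_rcis: "cmod (rcis r \<theta>) = r" for \<theta> using r by simp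
    have u_pos: "0 < ?u \<theta>" for \<theta>
    proof (rule max_norm_pos)
      show "f 1 (rcis r \<theta>) \<noteq> 0"
      proof
        assume "f 1 (rcis r \<theta>) = 0"
        then have "P (rcis r \<theta>) = 0"
          unfolding P_def by (intro prod_zero bexI[of _ 1]) auto
        then show False using P0[OF cmod_rcis] by blast
      qed
    qed auto
    have ptw: "ln (?u \<theta>) \<le> ?B \<theta>" for \<theta>
    proof -
      let ?z = "rcis r \<theta>"
      have "?u \<theta> * cmod (C ?z) \<le> fact m * (\<Prod>i<m. r powr (real i * (u - 1))) * cmod (P ?z)"
        unfolding C_def P_def
      proof (rule max_norm_casoratian_le[OF sum])
        fix i j assume "i < m" "j \<in> {1..m + 1}"
        then show "cmod ((fdiff ^^ i) (f j) ?z) \<le> r powr (real i * (u - 1)) * cmod (f j ?z)"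
          using E_le[of j ?z i] r cmod_rcis by (auto simp: E'_def)
      qed simp
      also have "(\<Prod>i<m. r powr (real i * (u - 1))) = r powr (\<Sum>i<m. real i * (u - 1))"
        using r by (simp add: powr_sum)
      \<comment> \<open>Row i contributes i(u - 1), and 0 + 1 + ... + (m - 1) = m(m - 1)/2.\<close>
      also have "(\<Sum>i<m. real i * (u - 1)) = - \<kappa>"
      proof -
        have "2 * (\<Sum>i<n. real i) = real n * (real n - 1)" for n
          by (induction n) (auto simp: algebra_simps)
        from this[of m] have "(\<Sum>i<m. real i) = real m * (real m - 1) / 2" by simp
        then have "(\<Sum>i<m. real i * (u - 1)) = real m * (real m - 1) / 2 * (u - 1)"
          by (simp only: sum_distrib_right[symmetric])
        also have "\<dots> = - \<kappa>" by (simp add: \<kappa>_def field_simps)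
        finally show ?thesis .
      qed
      finally have le: "?u \<theta> * cmod (C ?z) \<le> fact m * r powr - \<kappa> * cmod (P ?z)" .
      have pos: "0 < cmod (C ?z)" "0 < cmod (P ?z)" "0 < r powr - \<kappa>"
        using P0[OF cmod_rcis] C0[OF cmod_rcis] r by auto
      have "ln (?u \<theta> * cmod (C ?z)) \<le> ln (fact m * r powr - \<kappa> * cmod (P ?z))"
        using le u_pos[of \<theta>] pos by (intro ln_mono) auto
      moreover have "ln (?u \<theta> * cmod (C ?z)) = ln (?u \<theta>) + ln (cmod (C ?z))"
        using u_pos[of \<theta>] pos by (intro ln_mult_pos)
      moreover have "ln (fact m * r powr - \<kappa> * cmod (P ?z)) = ln (fact m) - \<kappa> * ln r + ln (cmod (P
          ?z))"
        using pos r by (simp add: ln_mult_pos ln_powr)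
      ultimately show ?thesis by linarith
    qed
    have intB: "(?B has_integral (2 * pi * (KP + integral {1..r} (\<lambda>t. real (zero_count P t) / t))
        - 2 * pi * (KC + integral {1..r} (\<lambda>t. real (zero_count C t) / t))
        + (ln (fact m) - \<kappa> * ln r) * (2 * pi))) {0..2 * pi}"
    proof (intro has_integral_add has_integral_diff KP KC)
      show "((\<lambda>\<theta>. ln (fact m) - \<kappa> * ln r) has_integral (ln (fact m) - \<kappa> * ln r) * (2 * pi)) {0..2
          * pi}"
        using has_integral_const_real[of "ln (fact m) - \<kappa> * ln r" 0 "2 * pi"] by (simp add:
            mult.commute)
    qed (use r P0 C0 in auto)
    have "continuous_on {0..2 * pi} ?u"
      unfolding max_norm_def
    proof (rule continuous_on_Max)
      fix j assume j: "j \<in> {1..m + 1}"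
      have "continuous_on {0..2 * pi} (f j \<circ> rcis r)"
        by (intro continuous_on_compose continuous_on_rcis entire_continuous_on ent j)
      then show "continuous_on {0..2 * pi} (\<lambda>\<theta>. cmod (f j (rcis r \<theta>)))"
        unfolding o_def by (rule continuous_on_norm)
    qed auto
    then have "continuous_on {0..2 * pi} (\<lambda>\<theta>. ln (?u \<theta>))"
      using u_pos by (intro continuous_on_ln) (auto simp: less_imp_neq[symmetric])
    then have "(\<lambda>\<theta>. ln (?u \<theta>)) integrable_on {0..2 * pi}" by (rule integrable_continuous_real)
    then have "integral {0..2 * pi} (\<lambda>\<theta>. ln (?u \<theta>)) \<le> integral {0..2 * pi} ?B"
      using intB ptw by (intro integral_le) (auto simp: has_integral_integrable)
    then have "integral {0..2 * pi} (\<lambda>\<theta>. ln (?u \<theta>))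
        \<le> 2 * pi * (KP - KC + (integral {1..r} (\<lambda>t. real (zero_count P t) / t)
          - integral {1..r} (\<lambda>t. real (zero_count C t) / t)) + (ln (fact m) - \<kappa> * ln r))"
      unfolding integral_unique[OF intB] by (simp add: algebra_simps)
    then have mean: "1 / (2 * pi) * integral {0..2 * pi} (\<lambda>\<theta>. ln (?u \<theta>))
        \<le> KP - KC + (integral {1..r} (\<lambda>t. real (zero_count P t) / t)
          - integral {1..r} (\<lambda>t. real (zero_count C t) / t)) + (ln (fact m) - \<kappa> * ln r)"
      by (simp add: pos_divide_le_eq mult.commute)
    have count_int: "(\<lambda>t. real (zero_count F t) / t) integrable_on {1..r}"
      if "entire F" "\<exists>z. F z \<noteq> 0" for F
      using has_integral_zero_count[OF that, of r] r(1) by (auto intro: has_integral_integrable)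
    have nbar_int: "((\<lambda>t. real (nbar_diff t P) / t) has_integral (Nbar_diff r P - Nbar_diff 1 P))
        {1..r}"
      using Nbar_diff_split[OF P, of r] r(1) by simp
    \<comment> \<open>The pointwise comparison of the zero counts, integrated against dt/t.\<close>
    have "integral {1..r} (\<lambda>t. real (zero_count P t) / t) \<le>
        integral {1..r} (\<lambda>t. real (zero_count C t) / t + (real m - 1) * (real (nbar_diff t P) / t))"
    proof (rule integral_le)
      show "(\<lambda>t. real (zero_count P t) / t) integrable_on {1..r}"
        by (rule count_int[OF P])
      show "(\<lambda>t. real (zero_count C t) / t + (real m - 1) * (real (nbar_diff t P) / t))
          integrable_on {1..r}"
        by (intro integrable_add integrable_on_mult_right count_int[OF C]
            has_integral_integrable[OF nbar_int])
      fix t assume t: "t \<in> {1..r}"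
      have "real (zero_count P t) \<le> real (zero_count C t + (m - 1) * nbar_diff t P)"
        using count[of t] by (rule of_nat_mono)
      then have "real (zero_count P t) \<le> real (zero_count C t) + (real m - 1) * real (nbar_diff t
          P)"
        using m by (simp add: of_nat_diff)
      then have "real (zero_count P t) / t \<le> (real (zero_count C t) + (real m - 1) * real
          (nbar_diff t P)) / t"
        using t by (intro divide_right_mono) auto
      then show "real (zero_count P t) / t \<le> real (zero_count C t) / t + (real m - 1) * (real
          (nbar_diff t P) / t)"
        by (simp add: add_divide_distrib)
    qed
    also have "\<dots> = integral {1..r} (\<lambda>t. real (zero_count C t) / t)
        + (real m - 1) * (Nbar_diff r P - Nbar_diff 1 P)"
      by (intro integral_unique has_integral_add has_integral_mult_right nbar_int
          integrable_integral count_int[OF C])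
    finally have "integral {1..r} (\<lambda>t. real (zero_count P t) / t)
        - integral {1..r} (\<lambda>t. real (zero_count C t) / t)
        \<le> (real m - 1) * Nbar_diff r P - (real m - 1) * Nbar_diff 1 P"
      by (simp add: right_diff_distrib)
    with mean have "1 / (2 * pi) * integral {0..2 * pi} (\<lambda>\<theta>. ln (?u \<theta>)) - T0
        \<le> (real m - 1) * Nbar_diff r P - \<kappa> * ln r
          + (KP - KC + ln (fact m) - (real m - 1) * Nbar_diff 1 P - T0)"
      by linarith
    then show ?thesis unfolding T_tilde_def T0_def .
  qed
  ultimately show ?thesis unfolding P_def[abs_def] \<kappa>_def by blast
qed

theorem theorem3p10:
  fixes m :: nat and f :: "nat \<Rightarrow> complex \<Rightarrow> complex" and \<delta> :: real
  assumes "m > 2"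
    and "\<And>j. j \<in> {1..m+1} \<Longrightarrow> entire (f j)"
    and "\<And>j. j \<in> {1..m+1} \<Longrightarrow> growth_order (f j) < 1"
    and "pairwise (\<lambda>i j. rel_shifting_prime (f i) (f j)) {1..m+1}"
    and "lin_indep_over_periodic {1..m} f"
    and "\<And>z. (\<Sum>j=1..m. f j z) = f (m+1) z"
    and "ereal \<delta> = (MAX j\<in>{1..m+1}. growth_order (f j))"
  shows "\<exists>R>0. \<forall>\<epsilon>>0. \<exists>E. finite_log_measure E \<and>
    (\<forall>r>R. r \<notin> E \<longrightarrow>
       T_tilde {1..m+1} f r
         \<le> (real m - 1) * Nbar_diff r (\<lambda>z. \<Prod>j=1..m+1. f j z)
             - real m * (real m - 1) / 2 * (1 - \<delta> - \<epsilon>) * ln r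
     \<and> (real m - 1) * Nbar_diff r (\<lambda>z. \<Prod>j=1..m+1. f j z)
             - real m * (real m - 1) / 2 * (1 - \<delta> - \<epsilon>) * ln r
         = (real m - 1) * (\<Sum>j=1..m+1. Nbar_diff r (f j))
             - real m * (real m - 1) / 2 * (1 - \<delta> - \<epsilon>) * ln r)"
proof -
  let ?J = "{1..m + 1}"
  have "(MAX j\<in>?J. growth_order (f j)) < 1"
    using assms(3) by (subst Max_less_iff) auto
  then have "ereal \<delta> < 1" by (simp only: assms(7))
  then have \<delta>1: "\<delta> < 1" by simp
  have order_le: "growth_order (f j) \<le> ereal \<delta>" if "j \<in> ?J" for j
    unfolding assms(7) using that by (intro Max_ge) auto
  have "0 \<le> growth_order (f 1)" by (rule growth_order_nonneg)
  also have "\<dots> \<le> ereal \<delta>" by (rule order_le) simp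
  finally have \<delta>0: "0 \<le> \<delta>" by simp
  have growth: "growth_le s (f j)" if "j \<in> ?J" "\<delta> < s" for j s
  proof (rule growth_order_less_imp_growth_le)
    show "growth_order (f j) < ereal s"
      using order_le[OF that(1)] that(2) by (meson ereal_less(2) less_ereal.simps(1) order_le_less_trans)
  qed (use assms(2) that \<delta>0 in auto)
  have nz: "\<exists>z. f j z \<noteq> 0" if j: "j \<in> ?J" for j
  proof (cases "j = m + 1")
    case True
    have "\<exists>z. (\<Sum>j\<in>{1..m}. f j z) \<noteq> 0"
      using assms(1,5) by (intro lin_indep_over_periodic_nonzero[of "{1..m}"]) auto
    then show ?thesis using True assms(6) by simp
  next
    case False
    then have "\<exists>z. (\<Sum>i\<in>{j}. f i z) \<noteq> 0"
      using assms(5) j by (intro lin_indep_over_periodic_nonzero[of "{1..m}"]) auto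
    then show ?thesis by simp
  qed
  \<comment> \<open>Separation needs just some growth exponent below 1, chosen here independently of
    epsilon.\<close>
  define s0 where "s0 = (1 + \<delta>) / 2"
  have s0: "\<delta> < s0" "0 < s0" "s0 < 1" using \<delta>0 \<delta>1 by (auto simp: s0_def)
  have sep: "f j (w + 1) \<noteq> 0" if "i \<in> ?J" "j \<in> ?J" "i \<noteq> j" "f i w = 0" for i j w
    using that assms(2,4) nz growth s0
    by (intro rel_shifting_prime_no_consecutive_zeros[of "f i" s0]) (auto simp: pairwise_def)
  have C_nz: "\<exists>z. casoratian m (\<lambda>j. f (Suc j)) z \<noteq> 0"
    using assms(2) by (intro casoratian_nonzero lin_indep_over_periodic_reindex assms(5)) auto
  let ?N = "\<lambda>r. Nbar_diff r (\<lambda>z. \<Prod>j=1..m+1. f j z)"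
  have N_eq: "?N r = (\<Sum>j=1..m+1. Nbar_diff r (f j))" for r
    by (intro Nbar_diff_sum nbar_diff_prod assms(2) nz sep) auto
  let ?c = "real m * (real m - 1) / 2"
  have c: "?c > 0" using assms(1) by simp
  have "\<exists>E. finite_log_measure E \<and> (\<forall>r>1. r \<notin> E \<longrightarrow>
      T_tilde ?J f r \<le> (real m - 1) * ?N r - ?c * (1 - \<delta> - \<epsilon>) * ln r)" if "\<epsilon> > 0" for \<epsilon>
  proof -
    \<comment> \<open>The cap keeps the exponent \<delta> + e/2 below 1. For larger \<epsilon> the
      claim is weaker, since ln r > 0.\<close>
    define e where "e = min \<epsilon> (1 - \<delta>)"
    have e: "0 < e" "e \<le> \<epsilon>" "e \<le> 1 - \<delta>" using that \<delta>1 by (auto simp: e_def)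
    obtain E K where E: "finite_log_measure E" "\<And>r. r > 1 \<Longrightarrow> r \<notin> E \<Longrightarrow>
        T_tilde ?J f r \<le> (real m - 1) * ?N r - ?c * (1 - (\<delta> + e / 2)) * ln r + K"
      using T_tilde_Nbar_bound[of m f "\<delta> + e / 4" "\<delta> + e / 2"] assms(1,2,6) nz sep C_nz
        growth \<delta>0 e by auto
    \<comment> \<open>Half of e is spent on the exponent u = \<delta> + e/2; beyond
      \<open>r0\<close> the other half, times ln r, absorbs the constant K.\<close>
    define r0 where "r0 = exp (2 * \<bar>K\<bar> / (?c * e))"
    have "T_tilde ?J f r \<le> (real m - 1) * ?N r - ?c * (1 - \<delta> - \<epsilon>) * ln r"
      if r: "r > 1" "r \<notin> {1..r0} \<union> E" for r
    proof -
      have "r0 < r" using r by auto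
      then have "2 * \<bar>K\<bar> / (?c * e) < ln r"
        using r(1) unfolding r0_def by (metis exp_gt_zero ln_exp ln_less_cancel_iff order_less_trans)
      then have "2 * \<bar>K\<bar> < ln r * (?c * e)" using c e(1) by (subst (asm) pos_divide_less_eq) auto
      then have "K \<le> ?c * (e / 2) * ln r" by (simp add: mult_ac)
      moreover have "T_tilde ?J f r \<le> (real m - 1) * ?N r - ?c * (1 - (\<delta> + e / 2)) * ln r + K"
        using E(2) r by auto
      moreover have "c * (1 - (\<delta> + e / 2)) * L - c * (e / 2) * L = c * (1 - \<delta> - e) * L" for c L :: real
        by (simp add: field_simps)
      from this[of ?c "ln r"]
      have "?c * (1 - (\<delta> + e / 2)) * ln r - ?c * (e / 2) * ln r = ?c * (1 - \<delta> - e) * ln r" .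
      moreover have "?c * (1 - \<delta> - \<epsilon>) * ln r \<le> ?c * (1 - \<delta> - e) * ln r"
        using c e(2) r(1) by (intro mult_right_mono mult_left_mono) auto
      ultimately show ?thesis by linarith
    qed
    moreover have "finite_log_measure ({1..r0} \<union> E)"
      by (intro finite_log_measure_Un finite_log_measure_Icc E)
    ultimately show ?thesis by blast
  qed
  \<comment> \<open>R = 1 serves every \<epsilon>, because the interval up to \<open>r0\<close> was
    put into the exceptional set.\<close>
  then show ?thesis unfolding N_eq by (intro exI[of _ 1]) auto
qed

end
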